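(* Let $G$ be an infinite finitely generated group, $X\subseteq\mathrm{Lip}_0(G)$ a pointwise closed invariant linear subspace, and $(x_n)_n\subseteq\mathbb{R}[G]$ elements such that $\tilde X=\big(\mathrm{Lip}_0(G)\oplus\mathrm{constants}\big)\cap\bigcap_n\ker(P_{x_n})$. Let $\delta:G\to\mathcal{F}(G)$ be the canonical embedding and $Q:\mathcal{F}(G)\to\mathcal{F}_X(G)$ the canonical quotient map. Then for every Banach space $Z$ and every Lipschitz map $f:G\to Z$ satisfying $f(1_G)=0$ and $f\star x_n=0$ for all $n$, there is a unique bounded linear operator $F:\mathcal{F}_X(G)\to Z$ with $F\circ Q\circ\delta=f$, and it satisfies $\|F\|=\mathrm{Lip}(f)$. Moreover, any Banach space satisfying the same universal property is linearly isometric to $\mathcal{F}_X(G)$. That is: if $E$ is a Banach space with a Lipschitz map $\iota:G\to E$ satisfying $\iota(1_G)=0$ and $\iota\star x_n=0$ for all $n$, such that for every Banach space $Z$ and every Lipschitz map $f:G\to Z$ with $f(1_G)=0$ and $f\star x_n=0$ for all $n$ there is a unique bounded linear operator $F:E\to Z$ with $F\circ\iota=f$, and $\|F\|=\mathrm{Lip}(f)$, then $E$ is linearly isometric to $\mathcal{F}_X(G)$.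
   Context: Banach spaces are real. $G$ has a fixed finite symmetric generating set $S$ and is viewed as its Cayley graph with edges $(g,gs)$, $g\in G$, $s\in S$, with the associated word metric $d$ and distinguished vertex $1_G$. $\mathrm{Lip}(f)$ is the optimal Lipschitz constant. $\mathrm{Lip}_0(G)$ is the Banach space of Lipschitz $f:G\to\mathbb{R}$ with $f(1_G)=0$, normed by $\mathrm{Lip}(\cdot)$. For $g\in G$, $(g\cdot f)(x)=f(g^{-1}x)-f(g^{-1})$; $X$ is invariant if $g\cdot X=X$ for all $g\in G$. It is pointwise closed if it is closed in $\mathrm{Lip}_0(G)$ for pointwise convergence. $\mathrm{constants}$ is the space of constant real functions on $G$, $\mathrm{Lip}_0(G)\oplus\mathrm{constants}$ is viewed as the space of all real Lipschitz functions on $G$, and $\tilde X:=X\oplus\mathrm{constants}$. $\mathbb{R}[G]$ is the real group algebra (finitely supported functions on $G$). For $x\in\mathbb{R}[G]$ and a function $f$ on $G$ with values in $\mathbb{R}$ or in a Banach space $Z$, $(f\star x)(g)=\sum_{h\in G}x(h)f(gh^{-1})$; for real-valued $f$, $P_x(f)=f\star x$ and $\ker(P_x)=\{f\in\mathbb{R}^G:P_x(f)=0\}$. $\mathcal{F}(G)$ is the Lipschitz-free space over $(G,d,1_G)$, with canonical isometric embedding $\delta:G\to\mathcal{F}(G)$, $\delta(1_G)=0$, characterized by: every Lipschitz map $f:G\to Z$ into a Banach space with $f(1_G)=0$ factors uniquely as $f=\tilde f\circ\delta$ with $\tilde f$ bounded linear, and $\|\tilde f\|=\mathrm{Lip}(f)$.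 In particular $\mathcal{F}(G)^*=\mathrm{Lip}_0(G)$. $\mathcal{F}_X(G):=\mathcal{F}(G)/X_\perp$, where $X_\perp=\{z\in\mathcal{F}(G): f(z)=0\ \forall f\in X\}$. *)

theory Defs
  imports
    "HOL-Analysis.Analysis"
    "HOL-Algebra.Module"
    "HOL-Algebra.AbelCoset"
    "HOL-Algebra.Generated_Groups"
begin

text \<open>
  The space \<open>F_X(G)\<close> depends on the terms \<open>G\<close> and \<open>X\<close>, and the universal property quantifies
  over all Banach spaces inside a formula.  Hence Banach spaces are structures with a carrier set
  and not types of class \<open>banach\<close>.  The linear structure is a HOL-Algebra module over the reals;
  the fields \<open>mult\<close> and \<open>one\<close> inherited from the ring record carry no meaning.
\<close>

definition real_ring :: "real ring" where
  "real_ring = \<lparr>carrier = UNIV, mult = (*), one = 1, zero = 0, add = (+)\<rparr>"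

record 'a nspace = "(real, 'a) module" +
  vnorm :: "'a \<Rightarrow> real"

definition normed_space :: "'a nspace \<Rightarrow> bool" where
  "normed_space E \<longleftrightarrow> Module.module real_ring E \<and>
     (\<forall>x\<in>carrier E. vnorm E x = 0 \<longleftrightarrow> x = \<zero>\<^bsub>E\<^esub>) \<and>
     (\<forall>a. \<forall>x\<in>carrier E. vnorm E (a \<odot>\<^bsub>E\<^esub> x) = \<bar>a\<bar> * vnorm E x) \<and>
     (\<forall>x\<in>carrier E. \<forall>y\<in>carrier E. vnorm E (x \<oplus>\<^bsub>E\<^esub> y) \<le> vnorm E x + vnorm E y)"

text \<open>The locale \<open>Metric_space\<close> demands nonnegativity and symmetry also off the carrier, so
  distances are set to \<open>0\<close> there.\<close>

definition norm_dist :: "'a nspace \<Rightarrow> 'a \<Rightarrow> 'a \<Rightarrow> real" where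
  "norm_dist E x y = (if x \<in> carrier E \<and> y \<in> carrier E then vnorm E (x \<ominus>\<^bsub>E\<^esub> y) else 0)"

definition norm_metric :: "'a nspace \<Rightarrow> 'a metric" where
  "norm_metric E = metric (carrier E, norm_dist E)"

definition banach_space :: "'a nspace \<Rightarrow> bool" where
  "banach_space E \<longleftrightarrow> normed_space E \<and> mcomplete_of (norm_metric E)"

definition real_line :: "real nspace" where
  "real_line = \<lparr>carrier = UNIV, mult = (*), one = 1, zero = 0, add = (+), smult = (*), vnorm = abs\<rparr>"

text \<open>Operators are extensional outside the carrier, so that uniqueness of an operator is
  uniqueness of a HOL function.\<close>

definition bounded_operators :: "'a nspace \<Rightarrow> 'b nspace \<Rightarrow> ('a \<Rightarrow> 'b) set" where
  "bounded_operators E Z = {T \<in> carrier E \<rightarrow>\<^sub>E carrier Z.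
     (\<forall>x\<in>carrier E. \<forall>y\<in>carrier E. T (x \<oplus>\<^bsub>E\<^esub> y) = T x \<oplus>\<^bsub>Z\<^esub> T y) \<and>
     (\<forall>a. \<forall>x\<in>carrier E. T (a \<odot>\<^bsub>E\<^esub> x) = a \<odot>\<^bsub>Z\<^esub> T x) \<and>
     (\<exists>B. \<forall>x\<in>carrier E. vnorm Z (T x) \<le> B * vnorm E x)}"

definition op_norm :: "'a nspace \<Rightarrow> 'b nspace \<Rightarrow> ('a \<Rightarrow> 'b) \<Rightarrow> real" where
  "op_norm E Z T = (SUP x\<in>{x \<in> carrier E. vnorm E x \<le> 1}. vnorm Z (T x))"

definition dual_space :: "'a nspace \<Rightarrow> ('a \<Rightarrow> real) nspace" where
  "dual_space E = \<lparr>carrier = bounded_operators E real_line, mult = undefined, one = undefined,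
     zero = (\<lambda>x\<in>carrier E. 0),
     add = (\<lambda>\<phi> \<psi>. \<lambda>x\<in>carrier E. \<phi> x + \<psi> x),
     smult = (\<lambda>a \<phi>. \<lambda>x\<in>carrier E. a * \<phi> x),
     vnorm = op_norm E real_line\<rparr>"

definition linear_subspace :: "'a set \<Rightarrow> 'a nspace \<Rightarrow> bool" where
  "linear_subspace H E \<longleftrightarrow> submodule H real_ring E"

definition closed_span :: "'a nspace \<Rightarrow> 'a set \<Rightarrow> 'a set" where
  "closed_span E A =
     mtopology_of (norm_metric E) closure_of ((\<lambda>H. linear_subspace H E) hull A)"

definition quotient_space :: "'a nspace \<Rightarrow> 'a set \<Rightarrow> 'a set nspace" where
  "quotient_space E N = \<lparr>carrier = a_rcosets\<^bsub>E\<^esub> N, mult = undefined, one = undefined,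
     zero = N,
     add = set_add E,
     smult = (\<lambda>a C. \<Union>x\<in>C. N +>\<^bsub>E\<^esub> (a \<odot>\<^bsub>E\<^esub> x)),
     vnorm = (\<lambda>C. INF x\<in>C. vnorm E x)\<rparr>"

definition linearly_isometric :: "'a nspace \<Rightarrow> 'b nspace \<Rightarrow> bool" where
  "linearly_isometric E F \<longleftrightarrow> (\<exists>T\<in>bounded_operators E F.
     bij_betw T (carrier E) (carrier F) \<and> (\<forall>x\<in>carrier E. vnorm F (T x) = vnorm E x))"

definition cayley_edges :: "('g, 'm) monoid_scheme \<Rightarrow> 'g set \<Rightarrow> ('g \<times> 'g) set" where
  "cayley_edges G S = {(g, g \<otimes>\<^bsub>G\<^esub> s) | g s. g \<in> carrier G \<and> s \<in> S}"

definition word_dist :: "('g, 'm) monoid_scheme \<Rightarrow> 'g set \<Rightarrow> 'g \<Rightarrow> 'g \<Rightarrow> real" where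
  "word_dist G S g h =
     (if g \<in> carrier G \<and> h \<in> carrier G then real (LEAST n. (g, h) \<in> cayley_edges G S ^^ n) else 0)"

definition word_metric :: "('g, 'm) monoid_scheme \<Rightarrow> 'g set \<Rightarrow> 'g metric" where
  "word_metric G S = metric (carrier G, word_dist G S)"

definition lip_const :: "'a metric \<Rightarrow> 'b metric \<Rightarrow> ('a \<Rightarrow> 'b) \<Rightarrow> real" where
  "lip_const m m' f = Inf {B. 0 \<le> B \<and>
     (\<forall>x\<in>mspace m. \<forall>y\<in>mspace m. mdist m' (f x) (f y) \<le> B * mdist m x y)}"

definition lip0 :: "('g, 'm) monoid_scheme \<Rightarrow> 'g set \<Rightarrow> ('g \<Rightarrow> real) nspace" where
  "lip0 G S = \<lparr>
     carrier = {f \<in> carrier G \<rightarrow>\<^sub>E UNIV.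
        Lipschitz_continuous_map (word_metric G S) euclidean_metric f \<and> f \<one>\<^bsub>G\<^esub> = 0},
     mult = undefined, one = undefined,
     zero = (\<lambda>g\<in>carrier G. 0),
     add = (\<lambda>f f'. \<lambda>g\<in>carrier G. f g + f' g),
     smult = (\<lambda>a f. \<lambda>g\<in>carrier G. a * f g),
     vnorm = lip_const (word_metric G S) euclidean_metric\<rparr>"

definition translate :: "('g, 'm) monoid_scheme \<Rightarrow> 'g \<Rightarrow> ('g \<Rightarrow> real) \<Rightarrow> 'g \<Rightarrow> real" where
  "translate G g f = (\<lambda>x\<in>carrier G. f (inv\<^bsub>G\<^esub> g \<otimes>\<^bsub>G\<^esub> x) - f (inv\<^bsub>G\<^esub> g))"

definition invariant :: "('g, 'm) monoid_scheme \<Rightarrow> ('g \<Rightarrow> real) set \<Rightarrow> bool" where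
  "invariant G X \<longleftrightarrow> (\<forall>g\<in>carrier G. translate G g ` X = X)"

definition pointwise_closed ::
    "('g, 'm) monoid_scheme \<Rightarrow> 'g set \<Rightarrow> ('g \<Rightarrow> real) set \<Rightarrow> bool" where
  "pointwise_closed G S X \<longleftrightarrow>
     closedin (subtopology (product_topology (\<lambda>_. euclideanreal) (carrier G)) (carrier (lip0 G S))) X"

definition plus_constants :: "('g, 'm) monoid_scheme \<Rightarrow> ('g \<Rightarrow> real) set \<Rightarrow> ('g \<Rightarrow> real) set" where
  "plus_constants G X = {(\<lambda>g\<in>carrier G. f g + c) | f c. f \<in> X}"

definition group_algebra :: "('g, 'm) monoid_scheme \<Rightarrow> ('g \<Rightarrow> real) set" where
  "group_algebra G = {x \<in> carrier G \<rightarrow>\<^sub>E UNIV. finite {h \<in> carrier G. x h \<noteq> 0}}"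

definition convolve ::
    "('g, 'm) monoid_scheme \<Rightarrow> 'z nspace \<Rightarrow> ('g \<Rightarrow> 'z) \<Rightarrow> ('g \<Rightarrow> real) \<Rightarrow> 'g \<Rightarrow> 'z" where
  "convolve G Z f x = (\<lambda>g\<in>carrier G.
     \<Oplus>\<^bsub>Z\<^esub>h\<in>{h \<in> carrier G. x h \<noteq> 0}. x h \<odot>\<^bsub>Z\<^esub> f (g \<otimes>\<^bsub>G\<^esub> inv\<^bsub>G\<^esub> h))"

definition ker_P :: "('g, 'm) monoid_scheme \<Rightarrow> ('g \<Rightarrow> real) \<Rightarrow> ('g \<Rightarrow> real) set" where
  "ker_P G x = {f \<in> carrier G \<rightarrow>\<^sub>E UNIV. convolve G real_line f x = (\<lambda>g\<in>carrier G. 0)}"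

text \<open>The Lipschitz-free space is realised as the closed linear span of the evaluation
  functionals in the dual of the space of Lipschitz functions; a Lipschitz function \<open>f\<close> acts on
  \<open>z\<close> in the free space by \<open>z f\<close>.\<close>

definition delta :: "('g, 'm) monoid_scheme \<Rightarrow> 'g set \<Rightarrow> 'g \<Rightarrow> ('g \<Rightarrow> real) \<Rightarrow> real" where
  "delta G S g = (\<lambda>f\<in>carrier (lip0 G S). f g)"

definition free_space :: "('g, 'm) monoid_scheme \<Rightarrow> 'g set \<Rightarrow> (('g \<Rightarrow> real) \<Rightarrow> real) nspace" where
  "free_space G S =
     dual_space (lip0 G S)\<lparr>carrier := closed_span (dual_space (lip0 G S)) (delta G S ` carrier G)\<rparr>"

definition preannihilator ::
    "('g, 'm) monoid_scheme \<Rightarrow> 'g set \<Rightarrow> ('g \<Rightarrow> real) set \<Rightarrow> (('g \<Rightarrow> real) \<Rightarrow> real) set" where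
  "preannihilator G S X = {z \<in> carrier (free_space G S). \<forall>f\<in>X. z f = 0}"

definition free_quotient ::
    "('g, 'm) monoid_scheme \<Rightarrow> 'g set \<Rightarrow> ('g \<Rightarrow> real) set \<Rightarrow> (('g \<Rightarrow> real) \<Rightarrow> real) set nspace" where
  "free_quotient G S X = quotient_space (free_space G S) (preannihilator G S X)"

definition free_quotient_map ::
    "('g, 'm) monoid_scheme \<Rightarrow> 'g set \<Rightarrow> ('g \<Rightarrow> real) set \<Rightarrow>
     (('g \<Rightarrow> real) \<Rightarrow> real) \<Rightarrow> (('g \<Rightarrow> real) \<Rightarrow> real) set" where
  "free_quotient_map G S X z = preannihilator G S X +>\<^bsub>free_space G S\<^esub> z"

text \<open>
  HOL cannot quantify over types inside a formula, so a hypothesis about all Banach spaces \<open>Z\<close>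
  ranges over the Banach spaces whose carrier lies in one type \<open>'u\<close>.  If \<open>real\<close> embeds in
  \<open>'u\<close>, this covers up to isometry every separable Banach space, in particular the quotient of
  the free space.  A Banach space over any type \<open>'e\<close> has an isometric copy over
  \<open>'u = 'e + real\<close>.
\<close>

definition admissible_map ::
    "('g, 'm) monoid_scheme \<Rightarrow> 'g set \<Rightarrow> (nat \<Rightarrow> 'g \<Rightarrow> real) \<Rightarrow> 'z nspace \<Rightarrow> ('g \<Rightarrow> 'z) \<Rightarrow> bool" where
  "admissible_map G S x Z f \<longleftrightarrow>
     Lipschitz_continuous_map (word_metric G S) (norm_metric Z) f \<and> f \<one>\<^bsub>G\<^esub> = \<zero>\<^bsub>Z\<^esub> \<and>
     (\<forall>n. convolve G Z f (x n) = (\<lambda>g\<in>carrier G. \<zero>\<^bsub>Z\<^esub>))"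

definition factors_uniquely ::
    "('g, 'm) monoid_scheme \<Rightarrow> 'g set \<Rightarrow> 'e nspace \<Rightarrow> ('g \<Rightarrow> 'e) \<Rightarrow> 'z nspace \<Rightarrow> ('g \<Rightarrow> 'z) \<Rightarrow> bool"
  where
  "factors_uniquely G S E \<iota> Z f \<longleftrightarrow>
     (\<exists>!F. F \<in> bounded_operators E Z \<and> (\<forall>g\<in>carrier G. F (\<iota> g) = f g)) \<and>
     (\<forall>F. F \<in> bounded_operators E Z \<and> (\<forall>g\<in>carrier G. F (\<iota> g) = f g) \<longrightarrow>
        op_norm E Z F = lip_const (word_metric G S) (norm_metric Z) f)"

text \<open>\<open>metric (M, d)\<close> is meaningful only if \<open>d\<close> is a metric on \<open>M\<close>.\<close>

lemma real_ring_simps [simp]: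
  "carrier real_ring = UNIV" "mult real_ring = (*)" "one real_ring = 1"
  "zero real_ring = 0" "add real_ring = (+)"
  by (simp_all add: real_ring_def)

lemma Metric_space_norm_dist:
  assumes "normed_space E"
  shows "Metric_space (carrier E) (norm_dist E)"
proof -
  interpret M: Module.module real_ring E using assms by (simp add: normed_space_def)
  have hom: "vnorm E (a \<odot>\<^bsub>E\<^esub> x) = \<bar>a\<bar> * vnorm E x" if "x \<in> carrier E" for a x
    using assms that by (simp add: normed_space_def)
  have tri: "vnorm E (x \<oplus>\<^bsub>E\<^esub> y) \<le> vnorm E x + vnorm E y"
    if "x \<in> carrier E" "y \<in> carrier E" for x y
    using assms that by (simp add: normed_space_def)
  have z: "vnorm E x = 0 \<longleftrightarrow> x = \<zero>\<^bsub>E\<^esub>" if "x \<in> carrier E" for x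
    using assms that by (simp add: normed_space_def)
  have m1: "\<ominus>\<^bsub>real_ring\<^esub> 1 = -1"
    by (rule M.R.minus_equality) auto
  have neg: "vnorm E (\<ominus>\<^bsub>E\<^esub> x) = vnorm E x" if "x \<in> carrier E" for x
    using M.smult_l_minus[of 1 x] hom[of x "-1"] that M.smult_one[of x] m1 by simp
  have nonneg: "0 \<le> vnorm E x" if "x \<in> carrier E" for x
    using tri[of x "\<ominus>\<^bsub>E\<^esub> x"] neg[of x] z[of "\<zero>\<^bsub>E\<^esub>"] that by (simp add: M.M.r_neg)
  show ?thesis
  proof
    show "0 \<le> norm_dist E x y" for x y
      by (simp add: norm_dist_def nonneg)
    show "norm_dist E x y = norm_dist E y x" for x y
      using neg[of "x \<ominus>\<^bsub>E\<^esub> y"]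
      by (auto simp: norm_dist_def M.M.minus_eq M.M.minus_add M.M.minus_minus M.M.a_comm)
    show "norm_dist E x y = 0 \<longleftrightarrow> x = y" if "x \<in> carrier E" "y \<in> carrier E" for x y
      using that z[of "x \<ominus>\<^bsub>E\<^esub> y"]
      by (simp add: norm_dist_def)
        (metis M.M.a_inv_closed M.M.minus_eq M.M.minus_equality M.M.minus_minus M.M.r_neg)
    show "norm_dist E x w \<le> norm_dist E x y + norm_dist E y w"
      if "x \<in> carrier E" "y \<in> carrier E" "w \<in> carrier E" for x y w
    proof -
      have "(x \<ominus>\<^bsub>E\<^esub> y) \<oplus>\<^bsub>E\<^esub> (y \<ominus>\<^bsub>E\<^esub> w) = x \<ominus>\<^bsub>E\<^esub> w"
        using that by (simp add: M.M.minus_eq M.M.a_assoc M.M.r_neg2 M.M.r_neg1)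
      then show ?thesis
        using tri[of "x \<ominus>\<^bsub>E\<^esub> y" "y \<ominus>\<^bsub>E\<^esub> w"] that by (simp add: norm_dist_def)
    qed
  qed
qed

lemma Metric_space_word_dist:
  assumes "group G" and S: "S \<subseteq> carrier G" and sym: "\<forall>s\<in>S. inv\<^bsub>G\<^esub> s \<in> S"
    and gen: "generate G S = carrier G"
  shows "Metric_space (carrier G) (word_dist G S)"
proof -
  interpret group G by fact
  let ?R = "cayley_edges G S"
  let ?L = "\<lambda>g h. LEAST n. (g, h) \<in> ?R ^^ n"
  have symR: "sym ?R"
  proof (rule symI)
    fix a b assume "(a, b) \<in> ?R"
    then obtain s where s: "a \<in> carrier G" "s \<in> S" "b = a \<otimes>\<^bsub>G\<^esub> s"
      by (auto simp: cayley_edges_def)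
    then have "a = b \<otimes>\<^bsub>G\<^esub> inv\<^bsub>G\<^esub> s" "b \<in> carrier G"
      using S by (auto simp: m_assoc)
    then show "(b, a) \<in> ?R" using sym s unfolding cayley_edges_def by blast
  qed
  have symn: "(h, g) \<in> ?R ^^ n" if "(g, h) \<in> ?R ^^ n" for g h n
    using that
  proof (induction n arbitrary: h)
    case (Suc n)
    then obtain k where "(g, k) \<in> ?R ^^ n" "(k, h) \<in> ?R" by auto
    then show ?case using Suc.IH symD[OF symR] relpow_Suc_I2 by metis
  qed auto
  have reach: "\<forall>g\<in>carrier G. (g, g \<otimes>\<^bsub>G\<^esub> k) \<in> ?R\<^sup>*" if "k \<in> generate G S" for k
    using that
  proof (induction rule: generate.induct)
    case (incl h)
    then show ?case by (auto simp: cayley_edges_def)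
  next
    case (inv h)
    then show ?case using sym by (auto simp: cayley_edges_def)
  next
    case (eng h1 h2)
    show ?case
    proof
      fix g assume g: "g \<in> carrier G"
      have h: "h1 \<in> carrier G" "h2 \<in> carrier G" using eng.hyps gen by auto
      have "(g, g \<otimes>\<^bsub>G\<^esub> h1) \<in> ?R\<^sup>*" "(g \<otimes>\<^bsub>G\<^esub> h1, (g \<otimes>\<^bsub>G\<^esub> h1) \<otimes>\<^bsub>G\<^esub> h2) \<in> ?R\<^sup>*"
        using eng.IH g h by auto
      then show "(g, g \<otimes>\<^bsub>G\<^esub> (h1 \<otimes>\<^bsub>G\<^esub> h2)) \<in> ?R\<^sup>*"
        using g h by (simp add: m_assoc)
    qed
  qed auto
  have ex: "\<exists>n. (g, h) \<in> ?R ^^ n" if "g \<in> carrier G" "h \<in> carrier G" for g h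
  proof -
    have "(g, g \<otimes>\<^bsub>G\<^esub> (inv\<^bsub>G\<^esub> g \<otimes>\<^bsub>G\<^esub> h)) \<in> ?R\<^sup>*"
      using reach[of "inv\<^bsub>G\<^esub> g \<otimes>\<^bsub>G\<^esub> h"] that gen by simp
    moreover have "g \<otimes>\<^bsub>G\<^esub> (inv\<^bsub>G\<^esub> g \<otimes>\<^bsub>G\<^esub> h) = h"
      using that by (simp flip: m_assoc)
    ultimately show ?thesis by (simp add: rtrancl_imp_relpow)
  qed
  have attained: "(g, h) \<in> ?R ^^ ?L g h" if "g \<in> carrier G" "h \<in> carrier G" for g h
    using ex[OF that] by (rule LeastI_ex)
  show ?thesis
  proof
    show "0 \<le> word_dist G S g h" for g h
      by (simp add: word_dist_def)
    have "((g, h) \<in> ?R ^^ n) = ((h, g) \<in> ?R ^^ n)" for g h n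
      using symn by blast
    then show "word_dist G S g h = word_dist G S h g" for g h
      by (simp add: word_dist_def)
    show "word_dist G S g h = 0 \<longleftrightarrow> g = h" if "g \<in> carrier G" "h \<in> carrier G" for g h
    proof
      assume "word_dist G S g h = 0"
      then have "?L g h = 0" using that by (simp add: word_dist_def)
      then have "(g, h) \<in> ?R ^^ 0" using attained[OF that] by metis
      then show "g = h" by simp
    next
      assume "g = h"
      then have "(g, h) \<in> ?R ^^ 0" by simp
      then have "?L g h \<le> 0" by (rule Least_le)
      then show "word_dist G S g h = 0" by (simp add: word_dist_def)
    qed
    show "word_dist G S g k \<le> word_dist G S g h + word_dist G S h k"
      if "g \<in> carrier G" "h \<in> carrier G" "k \<in> carrier G" for g h k
    proof -
      have "(g, k) \<in> ?R ^^ (?L g h + ?L h k)"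
        unfolding relpow_add
        using attained[OF that(1,2)] attained[OF that(2,3)] by (rule relcompI)
      then have "?L g k \<le> ?L g h + ?L h k" by (rule Least_le)
      then show ?thesis using that by (simp add: word_dist_def)
    qed
  qed
qed

end

theory Submission
  imports Defs
begin

text \<open>
  Let \<open>F\<close> be the Lipschitz-free space, \<open>N\<close> the preannihilator of \<open>X\<close> and \<open>Q\<close> the quotient map onto
  \<open>F / N\<close>.  The hypothesis on \<open>X\<close> says that a real Lipschitz function vanishing at the identity
  lies in \<open>X\<close> exactly if all its convolutions with the \<open>x n\<close> vanish (lemma \<open>X_iff\<close>).

  Existence.  Let \<open>f\<close> be an admissible map into a Banach space \<open>Z\<close>.  For every bounded functional
  \<open>\<phi>\<close> on \<open>Z\<close> the function \<open>\<phi> \<circ> f\<close> is Lipschitz and, since \<open>\<phi>\<close> commutes with convolutions, it lies in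
  \<open>X\<close>.  An element \<open>z\<close> of \<open>F\<close> is a functional on Lipschitz functions, so the value at \<open>z\<close> of the linear
  extension \<open>T\<close> of \<open>f\<close> must be the vector \<open>v\<close> with \<open>\<phi> v = z (\<phi> \<circ> f)\<close> for all \<open>\<phi>\<close>.  The set of those
  \<open>z\<close> for which such a \<open>v\<close> exists contains the evaluations, is a linear subspace, and is closed because
  \<open>Z\<close> is complete; hence it is \<open>F\<close> (\<open>represents_exists\<close>).  The defining equation of \<open>v\<close> also shows
  \<open>T = 0\<close> on \<open>N\<close>, and with the Hahn-Banach theorem it bounds the norm of \<open>T\<close> by the Lipschitz
  constant of \<open>f\<close>.  So \<open>T\<close> factors through \<open>Q\<close> without increase of the norm.  The reverse norm
  inequality and uniqueness hold since \<open>Q \<circ> \<delta>\<close> is 1-Lipschitz with dense span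
  (\<open>universal_property\<close>).

  Uniqueness of the space.  Let \<open>\<iota>\<close> from the group to \<open>E\<close> be another universal map.  Factoring \<open>\<iota>\<close>
  through itself gives the identity, so \<open>\<iota>\<close> is 1-Lipschitz and induces a contraction \<open>T\<close> from \<open>F / N\<close>
  to \<open>E\<close>.  The universal property of \<open>E\<close> is now applied to the scalar field only.  Every functional on
  \<open>F / N\<close> restricts to an admissible function, because \<open>Q \<circ> \<delta>\<close> is admissible, and therefore factors
  through \<open>T\<close> with no larger norm; by Hahn-Banach \<open>T\<close> is isometric.  The range of \<open>T\<close> is closed,
  and a functional on \<open>E\<close> vanishing on it vanishes on \<open>\<iota>\<close>, hence is zero; by Hahn-Banach in
  the quotient of \<open>E\<close> by the range, \<open>T\<close> is onto (\<open>universal_space_isometric\<close>).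
\<close>

section \<open>Normed spaces on carriers\<close>

lemma cring_real_ring: "cring real_ring"
proof (rule cringI)
  show "abelian_group real_ring"
  proof (rule abelian_groupI)
    show "\<exists>y\<in>carrier real_ring. y \<oplus>\<^bsub>real_ring\<^esub> x = \<zero>\<^bsub>real_ring\<^esub>" for x
      by (auto intro: exI[of _ "- x"])
  qed auto
qed (auto intro!: comm_monoidI simp: algebra_simps)

text \<open>Additive inverses need not be supplied, since \<open>(-1) \<odot> x\<close> is one as soon as \<open>0 \<odot> x = \<zero>\<close>.\<close>
lemma normed_spaceI:
  fixes E :: "'a nspace" (structure)
  assumes "\<zero> \<in> carrier E"
    and "\<And>x y. \<lbrakk>x \<in> carrier E; y \<in> carrier E\<rbrakk> \<Longrightarrow> x \<oplus> y \<in> carrier E"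
    and smult: "\<And>a x. x \<in> carrier E \<Longrightarrow> a \<odot> x \<in> carrier E"
    and "\<And>x y z. \<lbrakk>x \<in> carrier E; y \<in> carrier E; z \<in> carrier E\<rbrakk> \<Longrightarrow> (x \<oplus> y) \<oplus> z = x \<oplus> (y \<oplus> z)"
    and "\<And>x y. \<lbrakk>x \<in> carrier E; y \<in> carrier E\<rbrakk> \<Longrightarrow> x \<oplus> y = y \<oplus> x"
    and "\<And>x. x \<in> carrier E \<Longrightarrow> \<zero> \<oplus> x = x"
    and distr: "\<And>a b x. x \<in> carrier E \<Longrightarrow> (a + b) \<odot> x = (a \<odot> x) \<oplus> (b \<odot> x)"
    and "\<And>a x y. \<lbrakk>x \<in> carrier E; y \<in> carrier E\<rbrakk> \<Longrightarrow> a \<odot> (x \<oplus> y) = (a \<odot> x) \<oplus> (a \<odot> y)"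
    and "\<And>a b x. x \<in> carrier E \<Longrightarrow> (a * b) \<odot> x = a \<odot> (b \<odot> x)"
    and one: "\<And>x. x \<in> carrier E \<Longrightarrow> 1 \<odot> x = x"
    and zero: "\<And>x. x \<in> carrier E \<Longrightarrow> 0 \<odot> x = \<zero>"
    and "\<And>x. \<lbrakk>x \<in> carrier E; vnorm E x = 0\<rbrakk> \<Longrightarrow> x = \<zero>"
    and hom: "\<And>a x. x \<in> carrier E \<Longrightarrow> vnorm E (a \<odot> x) = \<bar>a\<bar> * vnorm E x"
    and "\<And>x y. \<lbrakk>x \<in> carrier E; y \<in> carrier E\<rbrakk> \<Longrightarrow> vnorm E (x \<oplus> y) \<le> vnorm E x + vnorm E y"
  shows "normed_space E"
proof -
  have "\<exists>y\<in>carrier E. y \<oplus> x = \<zero>" if "x \<in> carrier E" for x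
    using distr[of x "-1" 1] that smult[of x "-1"] one zero by auto
  then have "abelian_group E"
    using assms by (intro abelian_groupI) auto
  then have "Module.module real_ring E"
    using assms by (intro moduleI cring_real_ring) auto
  moreover have "vnorm E \<zero> = 0"
    using hom[of \<zero> 0] zero[of \<zero>] assms(1) by simp
  ultimately show ?thesis
    unfolding normed_space_def by (intro conjI ballI allI iffI) (simp_all add: assms)
qed

locale carrier_normed_space =
  fixes E :: "'a nspace" (structure)
  assumes normed: "normed_space E"

sublocale carrier_normed_space \<subseteq> Module.module real_ring E
  using normed by (simp add: normed_space_def)

context carrier_normed_space
begin

lemma scale_closed [simp, intro]: "x \<in> carrier E \<Longrightarrow> a \<odot> x \<in> carrier E"
  using smult_closed[of a x] by simp

lemma scale_one [simp]: "x \<in> carrier E \<Longrightarrow> 1 \<odot> x = x"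
  using smult_one[of x] by simp

lemma scale_zero [simp]: "x \<in> carrier E \<Longrightarrow> 0 \<odot> x = \<zero>"
  using smult_l_null[of x] by simp

lemma scale_scale: "x \<in> carrier E \<Longrightarrow> a \<odot> (b \<odot> x) = (a * b) \<odot> x"
  using smult_assoc1[of a b x] by simp

lemma scale_left_distrib: "x \<in> carrier E \<Longrightarrow> (a + b) \<odot> x = a \<odot> x \<oplus> b \<odot> x"
  using smult_l_distr[of a b x] by simp

lemma scale_right_distrib:
  "x \<in> carrier E \<Longrightarrow> y \<in> carrier E \<Longrightarrow> a \<odot> (x \<oplus> y) = a \<odot> x \<oplus> a \<odot> y"
  using smult_r_distr[of a x y] by simp

lemma a_inv_eq_scale: "x \<in> carrier E \<Longrightarrow> \<ominus> x = (-1) \<odot> x"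
  using scale_left_distrib[of x "-1" 1] by (simp add: minus_equality)

lemma minus_eq_scale: "x \<in> carrier E \<Longrightarrow> y \<in> carrier E \<Longrightarrow> x \<ominus> y = x \<oplus> (-1) \<odot> y"
  by (simp add: minus_eq a_inv_eq_scale)

lemma minus_closed' [simp, intro]: "x \<in> carrier E \<Longrightarrow> y \<in> carrier E \<Longrightarrow> x \<ominus> y \<in> carrier E"
  by (simp add: minus_eq)

lemma norm_scale: "x \<in> carrier E \<Longrightarrow> vnorm E (a \<odot> x) = \<bar>a\<bar> * vnorm E x"
  using normed by (simp add: normed_space_def)

lemma norm_eq_zero: "x \<in> carrier E \<Longrightarrow> vnorm E x = 0 \<longleftrightarrow> x = \<zero>"
  using normed by (simp add: normed_space_def)

lemma norm_zero [simp]: "vnorm E \<zero> = 0"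
  by (simp add: norm_eq_zero)

lemma norm_add_le: "x \<in> carrier E \<Longrightarrow> y \<in> carrier E \<Longrightarrow> vnorm E (x \<oplus> y) \<le> vnorm E x + vnorm E y"
  using normed by (simp add: normed_space_def)

lemma norm_a_inv [simp]: "x \<in> carrier E \<Longrightarrow> vnorm E (\<ominus> x) = vnorm E x"
  by (simp add: a_inv_eq_scale norm_scale)

lemma norm_nonneg [simp]: "x \<in> carrier E \<Longrightarrow> 0 \<le> vnorm E x"
  using norm_add_le[of x "\<ominus> x"] by (simp add: r_neg)

lemma minus_add_minus:
  "\<lbrakk>x \<in> carrier E; y \<in> carrier E; z \<in> carrier E\<rbrakk> \<Longrightarrow> (x \<ominus> y) \<oplus> (y \<ominus> z) = x \<ominus> z"
  by (simp add: minus_eq a_assoc r_neg2 r_neg1)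

lemma add_minus_cancel:
  "\<lbrakk>x \<in> carrier E; y \<in> carrier E\<rbrakk> \<Longrightarrow> (x \<ominus> y) \<oplus> y = x"
  by (simp add: minus_eq a_assoc l_neg)

lemma minus_self [simp]: "x \<in> carrier E \<Longrightarrow> x \<ominus> x = \<zero>"
  by (simp add: minus_eq r_neg)

lemma minus_zero [simp]: "x \<in> carrier E \<Longrightarrow> x \<ominus> \<zero> = x"
  by (simp add: minus_eq)

lemma eq_iff_minus: "\<lbrakk>x \<in> carrier E; y \<in> carrier E\<rbrakk> \<Longrightarrow> x = y \<longleftrightarrow> x \<ominus> y = \<zero>"
  using add_minus_cancel[of x y] by auto

lemma add_minus_add:
  "\<lbrakk>x \<in> carrier E; y \<in> carrier E; x' \<in> carrier E; y' \<in> carrier E\<rbrakk>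
    \<Longrightarrow> (x \<oplus> y) \<ominus> (x' \<oplus> y') = (x \<ominus> x') \<oplus> (y \<ominus> y')"
  by (simp add: minus_eq minus_add a_ac)

lemma scale_minus:
  "\<lbrakk>x \<in> carrier E; y \<in> carrier E\<rbrakk> \<Longrightarrow> a \<odot> x \<ominus> a \<odot> y = a \<odot> (x \<ominus> y)"
  by (simp add: minus_eq_scale scale_right_distrib scale_scale)

lemma norm_minus_commute: "\<lbrakk>x \<in> carrier E; y \<in> carrier E\<rbrakk> \<Longrightarrow> vnorm E (x \<ominus> y) = vnorm E (y \<ominus> x)"
  using norm_a_inv[of "x \<ominus> y"] by (simp add: minus_eq minus_add a_comm)

lemma norm_minus_triangle:
  "\<lbrakk>x \<in> carrier E; y \<in> carrier E; z \<in> carrier E\<rbrakk>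
    \<Longrightarrow> vnorm E (x \<ominus> z) \<le> vnorm E (x \<ominus> y) + vnorm E (y \<ominus> z)"
  using norm_add_le[of "x \<ominus> y" "y \<ominus> z"] by (simp add: minus_add_minus)

lemma norm_minus_zero_imp_eq: "\<lbrakk>x \<in> carrier E; y \<in> carrier E; vnorm E (x \<ominus> y) = 0\<rbrakk> \<Longrightarrow> x = y"
  using eq_iff_minus[of x y] norm_eq_zero[of "x \<ominus> y"] by simp

lemma linear_subspaceI:
  assumes "H \<subseteq> carrier E" and "\<zero> \<in> H" and "\<And>x y. x \<in> H \<Longrightarrow> y \<in> H \<Longrightarrow> x \<oplus> y \<in> H"
    and "\<And>a x. x \<in> H \<Longrightarrow> a \<odot> x \<in> H"
  shows "linear_subspace H E"
  unfolding linear_subspace_def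
proof (rule submoduleI)
  show "\<ominus> a \<in> H" if "a \<in> H" for a
    using assms that a_inv_eq_scale[of a] by auto
qed (use assms in auto)

lemma linear_subspaceD:
  assumes "linear_subspace H E"
  shows "H \<subseteq> carrier E" and "\<zero> \<in> H" and "\<And>x y. x \<in> H \<Longrightarrow> y \<in> H \<Longrightarrow> x \<oplus> y \<in> H"
    and "\<And>a x. x \<in> H \<Longrightarrow> a \<odot> x \<in> H" and "\<And>x y. x \<in> H \<Longrightarrow> y \<in> H \<Longrightarrow> x \<ominus> y \<in> H"
proof -
  note E = submoduleE[OF assms[unfolded linear_subspace_def]]
  show sub: "H \<subseteq> carrier E" and add: "\<And>x y. x \<in> H \<Longrightarrow> y \<in> H \<Longrightarrow> x \<oplus> y \<in> H"
    and sc: "\<And>a x. x \<in> H \<Longrightarrow> a \<odot> x \<in> H"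
    using E by auto
  obtain h where "h \<in> H" using E(2) by auto
  then show "\<zero> \<in> H" using sc[of h 0] sub by auto
  show "x \<ominus> y \<in> H" if "x \<in> H" "y \<in> H" for x y
    using that add[OF _ sc] sub by (subst minus_eq_scale) auto
qed

lemma Metric_space_norm: "Metric_space (carrier E) (norm_dist E)"
  by (rule Metric_space_norm_dist[OF normed])

lemma mspace_norm_metric [simp]: "mspace (norm_metric E) = carrier E"
  by (simp add: norm_metric_def Metric_space.mspace_metric[OF Metric_space_norm])

lemma mdist_norm_metric [simp]: "mdist (norm_metric E) = norm_dist E"
  by (simp add: norm_metric_def Metric_space.mdist_metric[OF Metric_space_norm])

text \<open>Convergence and closedness are phrased through the norm, so that topologies occur only where
  the given definitions are unfolded.\<close>

definition norm_limit :: "(nat \<Rightarrow> 'a) \<Rightarrow> 'a \<Rightarrow> bool" where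
  "norm_limit \<sigma> l \<longleftrightarrow> l \<in> carrier E \<and> (\<lambda>n. vnorm E (\<sigma> n \<ominus> l)) \<longlonglongrightarrow> 0"

definition norm_closed :: "'a set \<Rightarrow> bool" where
  "norm_closed N \<longleftrightarrow> (\<forall>x\<in>carrier E. (\<forall>e>0. \<exists>y\<in>N. vnorm E (y \<ominus> x) < e) \<longrightarrow> x \<in> N)"

lemma norm_limit_iff_limitin:
  assumes "range \<sigma> \<subseteq> carrier E"
  shows "norm_limit \<sigma> l \<longleftrightarrow>
    limitin (Metric_space.mtopology (carrier E) (norm_dist E)) \<sigma> l sequentially"
proof -
  have "\<sigma> n \<in> carrier E" for n using assms by auto
  then show ?thesis
    unfolding norm_limit_def Metric_space.limit_metric_sequentially[OF Metric_space_norm] LIMSEQ_def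
    by (auto simp: norm_dist_def)
qed

lemma banach_limit:
  assumes "banach_space E" and \<sigma>: "\<And>n. \<sigma> n \<in> carrier E"
    and "\<And>e. e > 0 \<Longrightarrow> \<exists>N. \<forall>m\<ge>N. \<forall>n\<ge>N. vnorm E (\<sigma> m \<ominus> \<sigma> n) < e"
  obtains l where "norm_limit \<sigma> l"
proof -
  have "Metric_space.MCauchy (carrier E) (norm_dist E) \<sigma>"
    unfolding Metric_space.MCauchy_def[OF Metric_space_norm]
    using assms by (auto simp: norm_dist_def)
  then obtain l where "limitin (Metric_space.mtopology (carrier E) (norm_dist E)) \<sigma> l sequentially"
    using assms(1) unfolding banach_space_def mcomplete_of_def
      Metric_space.mcomplete_def[OF Metric_space_norm]
    by (auto simp: Metric_space.mcomplete_def[OF Metric_space_norm])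
  then show thesis
    using \<sigma> by (intro that[of l]) (simp add: norm_limit_iff_limitin image_subset_iff)
qed

text \<open>For completeness it is enough that the sequences with geometrically small steps converge,
  because every Cauchy sequence has such a subsequence and inherits its limit.\<close>

lemma banach_spaceI:
  assumes fast: "\<And>\<sigma>. \<lbrakk>\<And>n. \<sigma> n \<in> carrier E; \<And>n. vnorm E (\<sigma> (Suc n) \<ominus> \<sigma> n) < (1/2)^n\<rbrakk>
    \<Longrightarrow> \<exists>l. norm_limit \<sigma> l"
  shows "banach_space E"
proof -
  interpret Metric_space "carrier E" "norm_dist E" by (rule Metric_space_norm)
  have "\<exists>x. limitin mtopology \<sigma> x sequentially" if C: "MCauchy \<sigma>" for \<sigma>
  proof -
    have \<sigma>: "\<And>n. \<sigma> n \<in> carrier E" using C by (auto simp: MCauchy_def)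
    have ex: "\<exists>N. \<forall>m\<ge>N. \<forall>n\<ge>N. vnorm E (\<sigma> m \<ominus> \<sigma> n) < (1/2)^k" for k :: nat
    proof -
      have "norm_dist E (\<sigma> m) (\<sigma> n) = vnorm E (\<sigma> m \<ominus> \<sigma> n)" for m n
        using \<sigma> by (simp add: norm_dist_def)
      moreover have "(0::real) < (1/2)^k" by simp
      ultimately show ?thesis using C unfolding MCauchy_def by auto
    qed
    define N where "N k = (SOME N. \<forall>m\<ge>N. \<forall>n\<ge>N. vnorm E (\<sigma> m \<ominus> \<sigma> n) < (1/2)^k)" for k
    have N: "vnorm E (\<sigma> m \<ominus> \<sigma> n) < (1/2)^k" if "m \<ge> N k" "n \<ge> N k" for k m n
      using someI_ex[OF ex, of k] that unfolding N_def by blast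
    \<comment> \<open>The indices \<open>N k\<close> need not increase, so they are pushed up to form a subsequence.\<close>
    define r where "r = rec_nat (N 0) (\<lambda>k m. max (Suc m) (N (Suc k)))"
    have r: "r (Suc k) = max (Suc (r k)) (N (Suc k))" "r 0 = N 0" for k
      by (simp_all add: r_def)
    have mono: "strict_mono r"
      by (rule strict_mono_Suc_iff[THEN iffD2]) (auto simp: r)
    have ge: "r k \<ge> N k" for k by (cases k) (auto simp: r)
    have "vnorm E ((\<sigma> \<circ> r) (Suc k) \<ominus> (\<sigma> \<circ> r) k) < (1/2)^k" for k
      using N[of k "r (Suc k)" "r k"] ge[of k] strict_monoD[OF mono, of k "Suc k"] by auto
    then obtain l where "norm_limit (\<sigma> \<circ> r) l"
      using fast[of "\<sigma> \<circ> r"] \<sigma> by auto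
    then have "limitin mtopology (\<sigma> \<circ> r) l sequentially"
      using \<sigma> by (simp add: norm_limit_iff_limitin image_subset_iff)
    then show ?thesis
      using MCauchy_convergent_subsequence[OF C mono] by blast
  qed
  then have "mcomplete" by (simp add: mcomplete_def)
  then show ?thesis
    using normed by (simp add: banach_space_def mcomplete_of_def)
qed

lemma norm_limit_unique:
  assumes "\<And>n. \<sigma> n \<in> carrier E" "norm_limit \<sigma> l" "norm_limit \<sigma> l'"
  shows "l = l'"
proof -
  have c: "l \<in> carrier E" "l' \<in> carrier E" using assms by (auto simp: norm_limit_def)
  have "(\<lambda>n. vnorm E (\<sigma> n \<ominus> l) + vnorm E (\<sigma> n \<ominus> l')) \<longlonglongrightarrow> 0 + 0"
    using assms unfolding norm_limit_def by (intro tendsto_add) auto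
  moreover have "vnorm E (l \<ominus> l') \<le> vnorm E (\<sigma> n \<ominus> l) + vnorm E (\<sigma> n \<ominus> l')" for n
    using norm_minus_triangle[of l "\<sigma> n" l'] norm_minus_commute[of "\<sigma> n" l] assms(1) c by simp
  ultimately have "vnorm E (l \<ominus> l') \<le> 0"
    by (intro LIMSEQ_le_const[of _ 0 "vnorm E (l \<ominus> l')"]) auto
  then show ?thesis
    using norm_nonneg[OF minus_closed'[OF c]] by (intro norm_minus_zero_imp_eq[OF c]) simp
qed

lemma norm_limit_closed:
  assumes "norm_closed N" "norm_limit \<sigma> l" "\<And>n. \<sigma> n \<in> N"
  shows "l \<in> N"
proof -
  have "\<exists>y\<in>N. vnorm E (y \<ominus> l) < e" if "e > 0" for e
  proof -
    have "eventually (\<lambda>n. vnorm E (\<sigma> n \<ominus> l) < e) sequentially"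
      using assms that by (intro order_tendstoD(2)[of _ 0]) (auto simp: norm_limit_def)
    then show ?thesis using assms(3) by (auto simp: eventually_sequentially)
  qed
  then show ?thesis
    using assms by (auto simp: norm_closed_def norm_limit_def)
qed

lemma fast_imp_Cauchy:
  assumes \<sigma>: "\<And>n. \<sigma> n \<in> carrier E" and fast: "\<And>n. vnorm E (\<sigma> (Suc n) \<ominus> \<sigma> n) < (1/2)^n"
    and "e > 0"
  shows "\<exists>N. \<forall>m\<ge>N. \<forall>n\<ge>N. vnorm E (\<sigma> m \<ominus> \<sigma> n) < e"
proof -
  have step: "vnorm E (\<sigma> (n + k) \<ominus> \<sigma> n) \<le> 2 * (1/2)^n - 2 * (1/2)^(n+k)" for n k
  proof (induction k)
    case (Suc k)
    have "vnorm E (\<sigma> (n + Suc k) \<ominus> \<sigma> n) \<le> (1/2)^(n+k) + vnorm E (\<sigma> (n + k) \<ominus> \<sigma> n)"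
      using norm_minus_triangle[of "\<sigma> (n + Suc k)" "\<sigma> (n+k)" "\<sigma> n"] fast[of "n+k"] \<sigma> by simp
    then show ?case using Suc by simp
  qed (simp add: \<sigma>)
  obtain N where N: "(1/2)^N < e / 4"
    using real_arch_pow_inv[of "e/4" "1/2"] \<open>e > 0\<close> by auto
  have "vnorm E (\<sigma> m \<ominus> \<sigma> N) < e / 2" if "m \<ge> N" for m
  proof -
    have "vnorm E (\<sigma> m \<ominus> \<sigma> N) \<le> 2 * (1/2)^N - 2 * (1/2)^m"
      using step[of N "m - N"] that by simp
    moreover have "(0::real) < 2 * (1/2)^m" by simp
    ultimately show ?thesis using N by linarith
  qed
  then have "vnorm E (\<sigma> m \<ominus> \<sigma> n) < e" if "m \<ge> N" "n \<ge> N" for m n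
    using that norm_minus_triangle[of "\<sigma> m" "\<sigma> N" "\<sigma> n"] norm_minus_commute[of "\<sigma> n" "\<sigma> N"] \<sigma>
    by (smt (verit) field_sum_of_halves)
  then show ?thesis by blast
qed

end

subsection \<open>Bounded operators\<close>

lemma normed_space_real_line: "normed_space real_line"
  by (rule normed_spaceI) (auto simp: real_line_def algebra_simps abs_mult)

locale bounded_operator = E: carrier_normed_space E + Z: carrier_normed_space Z
  for E :: "'a nspace" and Z :: "'b nspace" and T :: "'a \<Rightarrow> 'b" +
  assumes op: "T \<in> bounded_operators E Z"
begin

lemma closed [simp, intro]: "x \<in> carrier E \<Longrightarrow> T x \<in> carrier Z"
  using op by (auto simp: bounded_operators_def)

lemma extensional: "x \<notin> carrier E \<Longrightarrow> T x = undefined"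
  using op by (auto simp: bounded_operators_def PiE_def extensional_def)

lemma add: "x \<in> carrier E \<Longrightarrow> y \<in> carrier E \<Longrightarrow> T (x \<oplus>\<^bsub>E\<^esub> y) = T x \<oplus>\<^bsub>Z\<^esub> T y"
  using op by (auto simp: bounded_operators_def)

lemma scale: "x \<in> carrier E \<Longrightarrow> T (a \<odot>\<^bsub>E\<^esub> x) = a \<odot>\<^bsub>Z\<^esub> T x"
  using op by (auto simp: bounded_operators_def)

lemma zero [simp]: "T \<zero>\<^bsub>E\<^esub> = \<zero>\<^bsub>Z\<^esub>"
  using scale[of "\<zero>\<^bsub>E\<^esub>" 0] by simp

lemma minus: "x \<in> carrier E \<Longrightarrow> y \<in> carrier E \<Longrightarrow> T (x \<ominus>\<^bsub>E\<^esub> y) = T x \<ominus>\<^bsub>Z\<^esub> T y"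
  by (simp add: E.minus_eq_scale Z.minus_eq_scale add scale)

lemma finsum:
  assumes "finite A" "f \<in> A \<rightarrow> carrier E"
  shows "T (finsum E f A) = finsum Z (\<lambda>i. T (f i)) A"
  using assms
proof (induction rule: finite_induct)
  case (insert a A)
  then show ?case by (simp add: add Pi_iff)
qed simp

lemma bdd: "bdd_above ((\<lambda>x. vnorm Z (T x)) ` {x \<in> carrier E. vnorm E x \<le> 1})"
proof -
  obtain B where B: "\<forall>x\<in>carrier E. vnorm Z (T x) \<le> B * vnorm E x"
    using op unfolding bounded_operators_def by blast
  have "vnorm Z (T x) \<le> \<bar>B\<bar>" if x: "x \<in> carrier E" "vnorm E x \<le> 1" for x
  proof -
    have "vnorm Z (T x) \<le> B * vnorm E x" using B x by blast
    also have "\<dots> \<le> \<bar>B\<bar> * vnorm E x"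
      using E.norm_nonneg[OF x(1)] by (intro mult_right_mono) auto
    also have "\<dots> \<le> \<bar>B\<bar> * 1" using x by (intro mult_left_mono) auto
    finally show ?thesis by simp
  qed
  then show ?thesis by (auto simp: bdd_above_def)
qed

lemma op_norm_nonneg: "0 \<le> op_norm E Z T"
  using cSUP_upper[OF _ bdd, of "\<zero>\<^bsub>E\<^esub>"] by (simp add: op_norm_def)

lemma norm_le_op_norm:
  assumes x: "x \<in> carrier E"
  shows "vnorm Z (T x) \<le> op_norm E Z T * vnorm E x"
proof (cases "vnorm E x = 0")
  case True
  then have "x = \<zero>\<^bsub>E\<^esub>" using x by (simp add: E.norm_eq_zero)
  then show ?thesis by simp
next
  case False
  then have pos: "vnorm E x > 0" using E.norm_nonneg[OF x] by simp
  let ?y = "(1 / vnorm E x) \<odot>\<^bsub>E\<^esub> x"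
  have "vnorm E ?y \<le> 1" using x pos by (simp add: E.norm_scale)
  then have "vnorm Z (T ?y) \<le> op_norm E Z T"
    using x cSUP_upper[OF _ bdd, of ?y] by (simp add: op_norm_def)
  then show ?thesis using x pos by (simp add: scale Z.norm_scale field_simps)
qed

lemma op_norm_le:
  assumes "0 \<le> B" "\<And>x. x \<in> carrier E \<Longrightarrow> vnorm Z (T x) \<le> B * vnorm E x"
  shows "op_norm E Z T \<le> B"
  unfolding op_norm_def
proof (rule cSUP_least)
  show "{x \<in> carrier E. vnorm E x \<le> 1} \<noteq> {}"
    using E.norm_zero E.zero_closed by (auto intro!: exI[of _ "\<zero>\<^bsub>E\<^esub>"])
  show "vnorm Z (T x) \<le> B" if "x \<in> {x \<in> carrier E. vnorm E x \<le> 1}" for x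
    using that assms(1) assms(2)[of x] mult_left_le[of "vnorm E x" B] by auto
qed

lemma norm_limit:
  assumes "\<And>n. \<sigma> n \<in> carrier E" "E.norm_limit \<sigma> l"
  shows "Z.norm_limit (\<lambda>n. T (\<sigma> n)) (T l)"
  unfolding Z.norm_limit_def
proof
  have l: "l \<in> carrier E" using assms by (simp add: E.norm_limit_def)
  then show "T l \<in> carrier Z" by simp
  have "(\<lambda>n. op_norm E Z T * vnorm E (\<sigma> n \<ominus>\<^bsub>E\<^esub> l)) \<longlonglongrightarrow> op_norm E Z T * 0"
    using assms by (intro tendsto_mult_left) (simp add: E.norm_limit_def)
  then have lim: "(\<lambda>n. op_norm E Z T * vnorm E (\<sigma> n \<ominus>\<^bsub>E\<^esub> l)) \<longlonglongrightarrow> 0" by simp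
  show "(\<lambda>n. vnorm Z (T (\<sigma> n) \<ominus>\<^bsub>Z\<^esub> T l)) \<longlonglongrightarrow> 0"
  proof (rule tendsto_sandwich[OF _ _ tendsto_const lim])
    have "vnorm Z (T (\<sigma> n) \<ominus>\<^bsub>Z\<^esub> T l) \<le> op_norm E Z T * vnorm E (\<sigma> n \<ominus>\<^bsub>E\<^esub> l)" for n
      using norm_le_op_norm[of "\<sigma> n \<ominus>\<^bsub>E\<^esub> l"] minus[of "\<sigma> n" l] assms(1) l by simp
    then show "\<forall>\<^sub>F n in sequentially.
        vnorm Z (T (\<sigma> n) \<ominus>\<^bsub>Z\<^esub> T l) \<le> op_norm E Z T * vnorm E (\<sigma> n \<ominus>\<^bsub>E\<^esub> l)"
      by simp
  qed (use assms(1) l in auto)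
qed

text \<open>Kernels are closed, which is how agreement on a set with dense span spreads.\<close>

lemma kernel_closed: "E.norm_closed {x \<in> carrier E. T x = \<zero>\<^bsub>Z\<^esub>}"
  unfolding E.norm_closed_def
proof (intro ballI impI)
  fix x assume x: "x \<in> carrier E"
    and approx: "\<forall>e>0. \<exists>y\<in>{x \<in> carrier E. T x = \<zero>\<^bsub>Z\<^esub>}. vnorm E (y \<ominus>\<^bsub>E\<^esub> x) < e"
  have "vnorm Z (T x) \<le> 0"
  proof (rule field_le_epsilon)
    fix e :: real assume "e > 0"
    let ?e = "e / (op_norm E Z T + 1)"
    have "?e > 0" using \<open>e > 0\<close> op_norm_nonneg by simp
    then obtain y where y: "y \<in> carrier E" "T y = \<zero>\<^bsub>Z\<^esub>" "vnorm E (y \<ominus>\<^bsub>E\<^esub> x) < ?e"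
      using approx by auto
    have "vnorm Z (T x) = vnorm Z (T (x \<ominus>\<^bsub>E\<^esub> y))"
      using x y by (simp add: minus)
    also have "\<dots> \<le> op_norm E Z T * vnorm E (x \<ominus>\<^bsub>E\<^esub> y)"
      using x y by (intro norm_le_op_norm) auto
    also have "\<dots> \<le> op_norm E Z T * ?e"
      using x y op_norm_nonneg E.norm_minus_commute[of x y] by (intro mult_left_mono) auto
    also have "\<dots> \<le> e"
      using op_norm_nonneg \<open>e > 0\<close> by (simp add: divide_simps)
    finally show "vnorm Z (T x) \<le> 0 + e" by simp
  qed
  then have "vnorm Z (T x) = 0" using x by (intro antisym) auto
  then show "x \<in> {x \<in> carrier E. T x = \<zero>\<^bsub>Z\<^esub>}"
    using x Z.norm_eq_zero[of "T x"] by auto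
qed

lemma kernel_subspace: "linear_subspace {x \<in> carrier E. T x = \<zero>\<^bsub>Z\<^esub>} E"
  by (rule E.linear_subspaceI) (auto simp: add scale)

end

lemma bounded_operatorI:
  assumes "normed_space E" "normed_space Z" "T \<in> bounded_operators E Z"
  shows "bounded_operator E Z T"
  using assms by (simp add: bounded_operator_def bounded_operator_axioms_def carrier_normed_space_def)

lemma bounded_operatorsI:
  assumes "\<And>x. x \<in> carrier E \<Longrightarrow> T x \<in> carrier Z"
    and "\<And>x y. x \<in> carrier E \<Longrightarrow> y \<in> carrier E \<Longrightarrow> T (x \<oplus>\<^bsub>E\<^esub> y) = T x \<oplus>\<^bsub>Z\<^esub> T y"
    and "\<And>a x. x \<in> carrier E \<Longrightarrow> T (a \<odot>\<^bsub>E\<^esub> x) = a \<odot>\<^bsub>Z\<^esub> T x"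
    and "\<And>x. x \<in> carrier E \<Longrightarrow> vnorm Z (T x) \<le> B * vnorm E x"
    and E: "normed_space E"
  shows "(\<lambda>x\<in>carrier E. T x) \<in> bounded_operators E Z"
proof -
  interpret carrier_normed_space E using E by (simp add: carrier_normed_space_def)
  have "\<forall>x\<in>carrier E. vnorm Z (T x) \<le> B * vnorm E x" using assms by blast
  then show ?thesis using assms(1-3) by (auto simp: bounded_operators_def)
qed

lemma compose_bounded_operators:
  assumes "bounded_operator E F T" "bounded_operator F Z U"
  shows "(\<lambda>x\<in>carrier E. U (T x)) \<in> bounded_operators E Z"
proof -
  interpret T: bounded_operator E F T by fact
  interpret U: bounded_operator F Z U by fact
  show ?thesis
  proof (rule bounded_operatorsI[where B = "op_norm F Z U * op_norm E F T"])
    show "vnorm Z (U (T x)) \<le> op_norm F Z U * op_norm E F T * vnorm E x" if "x \<in> carrier E" for x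
      using U.norm_le_op_norm[of "T x"] T.norm_le_op_norm[OF that] U.op_norm_nonneg that
      by (smt (verit) T.closed mult.assoc mult_left_mono)
  qed (auto simp: T.add U.add T.scale U.scale T.E.normed)
qed

section \<open>The Hahn-Banach theorem\<close>

context carrier_normed_space
begin

definition sublinear :: "('a \<Rightarrow> real) \<Rightarrow> bool" where
  "sublinear p \<longleftrightarrow> (\<forall>x\<in>carrier E. \<forall>y\<in>carrier E. p (x \<oplus> y) \<le> p x + p y) \<and>
     (\<forall>a\<ge>0. \<forall>x\<in>carrier E. p (a \<odot> x) \<le> a * p x)"

lemma sublinearD:
  assumes "sublinear p"
  shows "\<And>x y. x \<in> carrier E \<Longrightarrow> y \<in> carrier E \<Longrightarrow> p (x \<oplus> y) \<le> p x + p y"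
    and "\<And>a x. 0 \<le> a \<Longrightarrow> x \<in> carrier E \<Longrightarrow> p (a \<odot> x) \<le> a * p x"
  using assms by (auto simp: sublinear_def)

lemma sublinear_zero:
  assumes "sublinear p" shows "p \<zero> = 0"
  using sublinearD(1)[OF assms, of \<zero> \<zero>] sublinearD(2)[OF assms, of 0 \<zero>] by simp

lemma sublinear_neg_le:
  assumes "sublinear p" "x \<in> carrier E" shows "- p (\<ominus> x) \<le> p x"
  using sublinearD(1)[OF assms(1), of x "\<ominus> x"] sublinear_zero[OF assms(1)] assms(2)
  by (simp add: r_neg)

lemma sublinear_scale:
  assumes "sublinear p" "x \<in> carrier E" "0 \<le> a" shows "p (a \<odot> x) = a * p x"
proof (cases "a = 0")
  case True
  then show ?thesis using assms sublinear_zero by simp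
next
  case False
  have "p ((1/a) \<odot> (a \<odot> x)) \<le> (1/a) * p (a \<odot> x)"
    using assms by (intro sublinearD) auto
  then have "a * p x \<le> p (a \<odot> x)"
    using False assms by (simp add: scale_scale field_simps)
  then show ?thesis using sublinearD(2)[OF assms(1,3,2)] by simp
qed

text \<open>Tilting replaces \<open>p\<close> by its largest sublinear minorant whose value at \<open>\<ominus> y\<close> is at most
  \<open>- p y\<close>, that is, by one which is additive along \<open>y\<close>.\<close>

definition tilt :: "('a \<Rightarrow> real) \<Rightarrow> 'a \<Rightarrow> 'a \<Rightarrow> real" where
  "tilt p y x = (if x \<in> carrier E then INF t\<in>{0..}. p (x \<oplus> t \<odot> y) - t * p y else 0)"

context
  fixes p y
  assumes p: "sublinear p" and y: "y \<in> carrier E"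
begin

lemma tilt_le:
  assumes x: "x \<in> carrier E" and "0 \<le> t"
  shows "tilt p y x \<le> p (x \<oplus> t \<odot> y) - t * p y"
proof -
  have "- p (\<ominus> x) \<le> p (x \<oplus> s \<odot> y) - s * p y" if "0 \<le> s" for s
  proof -
    have "\<ominus> x \<oplus> (x \<oplus> s \<odot> y) = s \<odot> y"
      using x y by (simp add: r_neg1)
    then show ?thesis
      using sublinearD(1)[OF p, of "\<ominus> x" "x \<oplus> s \<odot> y"] sublinear_scale[OF p y that] x y by simp
  qed
  then have "bdd_below ((\<lambda>t. p (x \<oplus> t \<odot> y) - t * p y) ` {0..})"
    by (auto simp: bdd_below_def)
  then show ?thesis
    using assms unfolding tilt_def by (auto intro!: cINF_lower)
qed

lemma le_tilt:
  assumes "x \<in> carrier E" and "\<And>t. 0 \<le> t \<Longrightarrow> c \<le> p (x \<oplus> t \<odot> y) - t * p y"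
  shows "c \<le> tilt p y x"
  using assms unfolding tilt_def by (auto intro!: cINF_greatest)

lemma tilt_below: "x \<in> carrier E \<Longrightarrow> tilt p y x \<le> p x"
  using tilt_le[of x 0] y by simp

lemma tilt_neg: "tilt p y (\<ominus> y) \<le> - p y"
  using tilt_le[of "\<ominus> y" 1] y sublinear_zero[OF p] by (simp add: l_neg)

lemma tilt_sublinear: "sublinear (tilt p y)"
  unfolding sublinear_def
proof (intro conjI ballI allI impI)
  fix x x' assume x: "x \<in> carrier E" "x' \<in> carrier E"
  have sum: "tilt p y (x \<oplus> x') \<le> (p (x \<oplus> t \<odot> y) - t * p y) + (p (x' \<oplus> t' \<odot> y) - t' * p y)"
    if "0 \<le> t" "0 \<le> t'" for t t'
  proof -
    have "(x \<oplus> x') \<oplus> (t + t') \<odot> y = (x \<oplus> t \<odot> y) \<oplus> (x' \<oplus> t' \<odot> y)"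
      using x y by (simp add: scale_left_distrib a_ac)
    then show ?thesis
      using tilt_le[of "x \<oplus> x'" "t + t'"] sublinearD(1)[OF p, of "x \<oplus> t \<odot> y" "x' \<oplus> t' \<odot> y"] x y that
      by (simp add: algebra_simps)
  qed
  have "tilt p y (x \<oplus> x') - (p (x \<oplus> t \<odot> y) - t * p y) \<le> tilt p y x'" if "0 \<le> t" for t
    using sum[OF that] by (intro le_tilt[OF x(2)]) (simp add: diff_le_eq add.commute)
  then have "tilt p y (x \<oplus> x') - tilt p y x' \<le> tilt p y x"
    by (intro le_tilt[OF x(1)]) (simp add: diff_le_eq add.commute)
  then show "tilt p y (x \<oplus> x') \<le> tilt p y x + tilt p y x'" by simp
next
  fix a x assume a: "(0::real) \<le> a" and x: "x \<in> carrier E"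
  have *: "tilt p y (a \<odot> x) \<le> a * (p (x \<oplus> t \<odot> y) - t * p y)" if "0 \<le> t" for t
  proof -
    have "(a \<odot> x) \<oplus> (a * t) \<odot> y = a \<odot> (x \<oplus> t \<odot> y)"
      using x y by (simp add: scale_right_distrib scale_scale)
    then show ?thesis
      using tilt_le[of "a \<odot> x" "a * t"] sublinear_scale[OF p, of "x \<oplus> t \<odot> y" a] x y that a
      by (simp add: algebra_simps)
  qed
  show "tilt p y (a \<odot> x) \<le> a * tilt p y x"
  proof (cases "a = 0")
    case True
    then show ?thesis using *[of 0] by simp
  next
    case False
    then have "tilt p y (a \<odot> x) / a \<le> tilt p y x"
      using * a x by (intro le_tilt) (auto simp: divide_simps mult.commute)
    then show ?thesis using a False by (simp add: divide_simps mult.commute)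
  qed
qed

end

text \<open>Below every sublinear functional there is a minimal one by Zorn's lemma, and tilting shows
  that a minimal one is linear.  Since only functionals on the whole space occur, there are no
  partial extensions to glue.\<close>

lemma minimal_sublinear_exists:
  assumes p: "sublinear p"
  obtains m where "sublinear m" "\<And>x. x \<in> carrier E \<Longrightarrow> m x \<le> p x"
    "\<And>q. \<lbrakk>sublinear q; \<And>x. x \<in> carrier E \<Longrightarrow> q x \<le> m x\<rbrakk> \<Longrightarrow> \<forall>x\<in>carrier E. q x = m x"
proof -
  define A where "A = {q. sublinear q \<and> (\<forall>x\<in>carrier E. q x \<le> p x) \<and> (\<forall>x. x \<notin> carrier E \<longrightarrow> q x = 0)}"
  define P where "P q r \<longleftrightarrow> (\<forall>x. r x \<le> q x)" for q r :: "'a \<Rightarrow> real"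
  define cut where "cut q x = (if x \<in> carrier E then q x else 0)" for q :: "'a \<Rightarrow> real" and x
  have cut_sub: "sublinear (cut q)" if "sublinear q" for q
    using that by (simp add: sublinear_def cut_def)
  have "partial_order_on A (relation_of P A)"
    by (intro partial_order_on_relation_ofI) (auto simp: P_def fun_eq_iff intro: order_trans antisym)
  moreover have "\<exists>u\<in>A. \<forall>q\<in>C. P q u" if C: "C \<in> Chains (relation_of P A)" for C
  proof (cases "C = {}")
    case True
    have "cut p \<in> A" using p cut_sub by (auto simp: A_def cut_def)
    then show ?thesis using True by auto
  next
    case False
    have CA: "C \<subseteq> A" and chain: "\<And>q r. q \<in> C \<Longrightarrow> r \<in> C \<Longrightarrow> P q r \<or> P r q"
      using C by (auto simp: Chains_def relation_of_def)
    have CD: "sublinear q" "\<And>x. x \<in> carrier E \<Longrightarrow> q x \<le> p x"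
        "\<And>x. x \<notin> carrier E \<Longrightarrow> q x = 0" if "q \<in> C" for q
      using that CA by (auto simp: A_def)
    define u where "u x = (if x \<in> carrier E then INF q\<in>C. q x else 0)" for x
    have bdd: "bdd_below ((\<lambda>q. q x) ` C)" if x: "x \<in> carrier E" for x
    proof -
      have "- p (\<ominus> x) \<le> q x" if "q \<in> C" for q
        using sublinear_neg_le[OF CD(1)[OF that] x] CD(2)[OF that, of "\<ominus> x"] x by simp
      then show ?thesis by (auto simp: bdd_below_def)
    qed
    have u_le: "u x \<le> q x" if "x \<in> carrier E" "q \<in> C" for x q
      using that bdd by (auto simp: u_def intro!: cINF_lower)
    have le_u: "c \<le> u x" if "x \<in> carrier E" "\<And>q. q \<in> C \<Longrightarrow> c \<le> q x" for x c
      using that False by (auto simp: u_def intro!: cINF_greatest)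
    have "sublinear u"
      unfolding sublinear_def
    proof (intro conjI ballI allI impI)
      fix x y assume xy: "x \<in> carrier E" "y \<in> carrier E"
      have sum: "u (x \<oplus> y) \<le> q x + r y" if qr: "q \<in> C" "r \<in> C" for q r
      proof -
        obtain s where s: "s \<in> C" "s x \<le> q x" "s y \<le> r y"
          using chain[OF qr] qr unfolding P_def by blast
        have "s (x \<oplus> y) \<le> s x + s y"
          using s CD xy by (intro sublinearD) auto
        then show ?thesis using u_le[of "x \<oplus> y" s] s xy by simp
      qed
      have "u (x \<oplus> y) - q x \<le> u y" if "q \<in> C" for q
        using sum[OF that] by (intro le_u[OF xy(2)]) (simp add: diff_le_eq add.commute)
      then have "u (x \<oplus> y) - u y \<le> u x"
        by (intro le_u[OF xy(1)]) (simp add: diff_le_eq add.commute)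
      then show "u (x \<oplus> y) \<le> u x + u y" by simp
    next
      fix a x assume a: "(0::real) \<le> a" and x: "x \<in> carrier E"
      have *: "u (a \<odot> x) \<le> a * q x" if "q \<in> C" for q
        using u_le[OF _ that, of "a \<odot> x"] sublinearD(2)[OF CD(1)[OF that] a x] x by simp
      show "u (a \<odot> x) \<le> a * u x"
      proof (cases "a = 0")
        case True
        then show ?thesis using * False by fastforce
      next
        case False
        then have "u (a \<odot> x) / a \<le> u x"
          using * a x by (intro le_u) (auto simp: divide_simps mult.commute)
        then show ?thesis using a False by (simp add: divide_simps mult.commute)
      qed
    qed
    moreover have "\<forall>x\<in>carrier E. u x \<le> p x"
    proof
      fix x assume x: "x \<in> carrier E"
      obtain q where "q \<in> C" using False by auto
      then show "u x \<le> p x" using u_le[OF x, of q] CD(2)[of q x] x by simp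
    qed
    ultimately have "u \<in> A" by (simp add: A_def u_def)
    moreover have "P q u" if "q \<in> C" for q
      unfolding P_def
    proof
      show "u x \<le> q x" for x
        using u_le[OF _ that] CD(3)[OF that] by (cases "x \<in> carrier E") (auto simp: u_def)
    qed
    ultimately show ?thesis by auto
  qed
  ultimately obtain m where m: "m \<in> A" "\<And>q. q \<in> A \<Longrightarrow> P m q \<Longrightarrow> q = m"
    using predicate_Zorn[of A P] by blast
  show thesis
  proof (rule that[of m])
    show "sublinear m" "\<And>x. x \<in> carrier E \<Longrightarrow> m x \<le> p x" using m(1) by (auto simp: A_def)
    fix q assume q: "sublinear q" "\<And>x. x \<in> carrier E \<Longrightarrow> q x \<le> m x"
    have "cut q \<in> A"
      using q(1) cut_sub order_trans[OF q(2)] m(1) by (auto simp: A_def cut_def)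
    moreover have "P m (cut q)" using q m(1) by (auto simp: A_def P_def cut_def)
    ultimately have "cut q = m" by (rule m(2))
    then show "\<forall>x\<in>carrier E. q x = m x" by (auto simp: cut_def)
  qed
qed

text \<open>Tilting \<open>p\<close> along \<open>z\<close> before minimising forces the value \<open>p z\<close> at \<open>z\<close>: every minorant \<open>m\<close> of the
  tilted functional has \<open>m (\<ominus> z) \<le> - p z\<close>.\<close>
theorem Hahn_Banach:
  assumes p: "sublinear p" and z: "z \<in> carrier E"
  obtains m where "\<And>x y. \<lbrakk>x \<in> carrier E; y \<in> carrier E\<rbrakk> \<Longrightarrow> m (x \<oplus> y) = m x + m y"
    "\<And>a x. x \<in> carrier E \<Longrightarrow> m (a \<odot> x) = a * m x"
    "\<And>x. x \<in> carrier E \<Longrightarrow> m x \<le> p x" "m z = p z"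
proof -
  obtain m where m: "sublinear m" and le: "\<And>x. x \<in> carrier E \<Longrightarrow> m x \<le> tilt p z x"
    and min: "\<And>q. \<lbrakk>sublinear q; \<And>x. x \<in> carrier E \<Longrightarrow> q x \<le> m x\<rbrakk> \<Longrightarrow> \<forall>x\<in>carrier E. q x = m x"
    using minimal_sublinear_exists[OF tilt_sublinear[OF p z]] by blast
  have neg: "m (\<ominus> y) = - m y" if y: "y \<in> carrier E" for y
  proof -
    have "tilt m y (\<ominus> y) = m (\<ominus> y)"
      using min[OF tilt_sublinear[OF m y] tilt_below[OF m y]] y by auto
    then have "m (\<ominus> y) \<le> - m y" using tilt_neg[OF m y] by simp
    then show ?thesis using sublinear_neg_le[OF m y] by simp
  qed
  have add: "m (x \<oplus> y) = m x + m y" if xy: "x \<in> carrier E" "y \<in> carrier E" for x y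
  proof -
    have "(x \<oplus> y) \<oplus> \<ominus> y = x" using xy by (simp add: a_assoc r_neg)
    then have "m x \<le> m (x \<oplus> y) - m y"
      using sublinearD(1)[OF m, of "x \<oplus> y" "\<ominus> y"] neg[of y] xy by simp
    then show ?thesis using sublinearD(1)[OF m xy] by simp
  qed
  have scale: "m (a \<odot> x) = a * m x" if x: "x \<in> carrier E" for a x
  proof (cases "0 \<le> a")
    case True
    then show ?thesis using sublinear_scale[OF m x] by simp
  next
    case False
    then have "m (\<ominus> ((- a) \<odot> x)) = a * m x"
      using neg[of "(- a) \<odot> x"] sublinear_scale[OF m x, of "- a"] x by simp
    moreover have "\<ominus> ((- a) \<odot> x) = a \<odot> x"
      using x by (simp add: a_inv_eq_scale scale_scale)
    ultimately show ?thesis by simp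
  qed
  have below: "m x \<le> p x" if "x \<in> carrier E" for x
    using le[OF that] tilt_below[OF p z that] by simp
  moreover have "p z \<le> m z"
    using le[of "\<ominus> z"] tilt_neg[OF p z] neg[OF z] z by simp
  ultimately show thesis
    using that[of m] add scale z by (meson antisym)
qed

lemma norming_functional:
  assumes z: "z \<in> carrier E"
  obtains \<phi> where "\<phi> \<in> bounded_operators E real_line" "\<phi> z = vnorm E z"
    "\<And>x. x \<in> carrier E \<Longrightarrow> \<bar>\<phi> x\<bar> \<le> vnorm E x"
proof -
  have "sublinear (vnorm E)" by (auto simp: sublinear_def norm_add_le norm_scale)
  then obtain m where m: "\<And>x y. \<lbrakk>x \<in> carrier E; y \<in> carrier E\<rbrakk> \<Longrightarrow> m (x \<oplus> y) = m x + m y"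
    "\<And>a x. x \<in> carrier E \<Longrightarrow> m (a \<odot> x) = a * m x"
    "\<And>x. x \<in> carrier E \<Longrightarrow> m x \<le> vnorm E x" "m z = vnorm E z"
    by (rule Hahn_Banach[OF _ z]) blast
  have abs: "\<bar>m x\<bar> \<le> vnorm E x" if "x \<in> carrier E" for x
    using m(3)[of x] m(3)[of "(-1) \<odot> x"] m(2)[of x "-1"] that by (simp add: norm_scale abs_le_iff)
  have "(\<lambda>x\<in>carrier E. m x) \<in> bounded_operators E real_line"
    by (rule bounded_operatorsI[where B = 1]) (auto simp: m(1,2) abs real_line_def normed)
  then show thesis using that[of "\<lambda>x\<in>carrier E. m x"] z m abs by simp
qed

end

section \<open>Closed spans, duals and quotients\<close>

subsection \<open>Subspaces and closed spans\<close>

context carrier_normed_space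
begin

lemma normed_subspace:
  assumes "linear_subspace H E"
  shows "normed_space (E\<lparr>carrier := H\<rparr>)"
proof -
  note H = linear_subspaceD[OF assms]
  have [simp]: "x \<in> carrier E" if "x \<in> H" for x using H(1) that by auto
  show ?thesis
    by (rule normed_spaceI)
      (simp_all add: H(2,3,4) a_assoc scale_left_distrib scale_right_distrib
        scale_scale norm_eq_zero norm_scale norm_add_le, simp add: a_comm)
qed

lemma minus_subspace:
  assumes "linear_subspace H E" "x \<in> H" "y \<in> H"
  shows "x \<ominus>\<^bsub>E\<lparr>carrier := H\<rparr>\<^esub> y = x \<ominus> y"
proof -
  interpret H: carrier_normed_space "E\<lparr>carrier := H\<rparr>"
    using normed_subspace[OF assms(1)] by (simp add: carrier_normed_space_def)
  show ?thesis
    using H.minus_eq_scale[of x y] minus_eq_scale[of x y] subsetD[OF linear_subspaceD(1)[OF assms(1)]]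
      assms by simp
qed

lemma banach_subspace:
  assumes "banach_space E" and H: "linear_subspace H E" and cl: "norm_closed H"
  shows "banach_space (E\<lparr>carrier := H\<rparr>)"
proof -
  interpret H: carrier_normed_space "E\<lparr>carrier := H\<rparr>"
    using normed_subspace[OF H] by (simp add: carrier_normed_space_def)
  have sub: "x \<in> carrier E" if "x \<in> H" for x using linear_subspaceD(1)[OF H] that by auto
  show ?thesis
  proof (rule H.banach_spaceI)
    fix \<sigma> assume \<sigma>: "\<And>n. \<sigma> n \<in> carrier (E\<lparr>carrier := H\<rparr>)"
      and fast: "\<And>n. vnorm (E\<lparr>carrier := H\<rparr>) (\<sigma> (Suc n) \<ominus>\<^bsub>E\<lparr>carrier := H\<rparr>\<^esub> \<sigma> n) < (1/2)^n"
    have \<sigma>H: "\<sigma> n \<in> H" for n using \<sigma> by simp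
    have "vnorm E (\<sigma> (Suc n) \<ominus> \<sigma> n) < (1/2)^n" for n
      using fast[of n] by (simp add: minus_subspace[OF H \<sigma>H \<sigma>H])
    then obtain l where l: "norm_limit \<sigma> l"
      using banach_limit[OF assms(1), of \<sigma>] fast_imp_Cauchy[of \<sigma>] sub[OF \<sigma>H] by metis
    then have "l \<in> H" by (rule norm_limit_closed[OF cl _ \<sigma>H])
    then have "H.norm_limit \<sigma> l"
      using l by (simp add: H.norm_limit_def norm_limit_def minus_subspace[OF H \<sigma>H])
    then show "\<exists>l. H.norm_limit \<sigma> l" by blast
  qed
qed

definition norm_closure :: "'a set \<Rightarrow> 'a set" where
  "norm_closure H = {x \<in> carrier E. \<forall>e>0. \<exists>y\<in>H. vnorm E (y \<ominus> x) < e}"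

lemma norm_closure_eq_closure_of:
  assumes "H \<subseteq> carrier E"
  shows "mtopology_of (norm_metric E) closure_of H = norm_closure H"
proof -
  interpret Metric_space "carrier E" "norm_dist E" by (rule Metric_space_norm)
  have "y \<in> mball x r \<longleftrightarrow> vnorm E (y \<ominus> x) < r" if "x \<in> carrier E" "y \<in> H" for x y r
    using that assms norm_minus_commute[of x y] by (auto simp: norm_dist_def in_mball)
  then show ?thesis
    unfolding norm_metric_def mtopology_of metric_closure_of norm_closure_def
    by (intro Collect_cong conj_cong all_cong1 imp_cong bex_cong) auto
qed

lemma norm_closure_closed:
  assumes "H \<subseteq> carrier E"
  shows "norm_closed (norm_closure H)"
  unfolding norm_closed_def
proof (intro ballI impI)
  fix x assume x: "x \<in> carrier E" and ex: "\<forall>e>0. \<exists>y\<in>norm_closure H. vnorm E (y \<ominus> x) < e"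
  have "\<exists>z\<in>H. vnorm E (z \<ominus> x) < e" if "e > 0" for e
  proof -
    obtain y where y: "y \<in> norm_closure H" "vnorm E (y \<ominus> x) < e/2"
      using ex \<open>e > 0\<close> half_gt_zero by metis
    then obtain z where z: "z \<in> H" "vnorm E (z \<ominus> y) < e/2"
      using \<open>e > 0\<close> half_gt_zero unfolding norm_closure_def by blast
    have "vnorm E (z \<ominus> x) \<le> vnorm E (z \<ominus> y) + vnorm E (y \<ominus> x)"
      using y z x assms by (intro norm_minus_triangle) (auto simp: norm_closure_def)
    then show ?thesis using z y by (intro bexI[of _ z]) auto
  qed
  then show "x \<in> norm_closure H" using x by (simp add: norm_closure_def)
qed

lemma norm_closure_superset: "H \<subseteq> carrier E \<Longrightarrow> H \<subseteq> norm_closure H"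
  unfolding norm_closure_def by (auto intro!: bexI)

lemma norm_closure_subspace:
  assumes "linear_subspace H E"
  shows "linear_subspace (norm_closure H) E"
proof (rule linear_subspaceI)
  note H = linear_subspaceD[OF assms]
  have Hc: "x \<in> carrier E" if "x \<in> H" for x using H(1) that by auto
  show sub: "norm_closure H \<subseteq> carrier E" by (auto simp: norm_closure_def)
  show "\<zero> \<in> norm_closure H" using norm_closure_superset[OF H(1)] H(2) by auto
  fix x assume x: "x \<in> norm_closure H"
  have xE: "x \<in> carrier E" using sub x by auto
  show "a \<odot> x \<in> norm_closure H" for a
  proof -
    have "\<exists>z\<in>H. vnorm E (z \<ominus> a \<odot> x) < e" if e: "e > 0" for e
    proof -
      \<comment> \<open>The summand 1 covers the case \<open>a = 0\<close>.\<close>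
      have "e / (\<bar>a\<bar> + 1) > 0" using e by simp
      then obtain y where y: "y \<in> H" "vnorm E (y \<ominus> x) < e / (\<bar>a\<bar> + 1)"
        using x unfolding norm_closure_def by blast
      have "vnorm E (a \<odot> y \<ominus> a \<odot> x) = \<bar>a\<bar> * vnorm E (y \<ominus> x)"
        using Hc[OF y(1)] xE by (simp add: scale_minus norm_scale)
      also have "\<dots> \<le> \<bar>a\<bar> * (e / (\<bar>a\<bar> + 1))"
        using y(2) by (intro mult_left_mono) auto
      also have "\<dots> < e" using e by (simp add: field_simps)
      finally show ?thesis using H(4)[OF y(1)] by blast
    qed
    then show ?thesis using xE by (simp add: norm_closure_def)
  qed
  fix y assume y: "y \<in> norm_closure H"
  have yE: "y \<in> carrier E" using sub y by auto
  have "\<exists>z\<in>H. vnorm E (z \<ominus> (x \<oplus> y)) < e" if e: "e > 0" for e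
  proof -
    obtain x' where x': "x' \<in> H" "vnorm E (x' \<ominus> x) < e/2"
      using x e half_gt_zero unfolding norm_closure_def by blast
    obtain y' where y': "y' \<in> H" "vnorm E (y' \<ominus> y) < e/2"
      using y e half_gt_zero unfolding norm_closure_def by blast
    have "vnorm E ((x' \<oplus> y') \<ominus> (x \<oplus> y)) \<le> vnorm E (x' \<ominus> x) + vnorm E (y' \<ominus> y)"
      using Hc[OF x'(1)] Hc[OF y'(1)] xE yE by (simp add: add_minus_add norm_add_le)
    then show ?thesis using x' y' H(3)[OF x'(1) y'(1)] by (intro bexI[of _ "x' \<oplus> y'"]) auto
  qed
  then show "x \<oplus> y \<in> norm_closure H" using xE yE by (simp add: norm_closure_def)
qed

lemma hull_subspace:
  assumes "A \<subseteq> carrier E"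
  shows "linear_subspace ((\<lambda>H. linear_subspace H E) hull A) E"
proof -
  have c: "linear_subspace (carrier E) E" by (rule linear_subspaceI) auto
  show ?thesis
  proof (rule linear_subspaceI)
    show "(\<lambda>H. linear_subspace H E) hull A \<subseteq> carrier E"
      by (rule hull_minimal) (use c assms in auto)
  qed (auto simp: hull_def dest: linear_subspaceD)
qed

lemma closed_span_eq:
  "A \<subseteq> carrier E \<Longrightarrow> closed_span E A = norm_closure ((\<lambda>H. linear_subspace H E) hull A)"
  by (simp add: closed_span_def norm_closure_eq_closure_of linear_subspaceD(1)[OF hull_subspace])

lemma closed_span_subspace: "A \<subseteq> carrier E \<Longrightarrow> linear_subspace (closed_span E A) E"
  by (simp add: closed_span_eq norm_closure_subspace hull_subspace)

lemma closed_span_closed: "A \<subseteq> carrier E \<Longrightarrow> norm_closed (closed_span E A)"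
  by (simp add: closed_span_eq norm_closure_closed linear_subspaceD(1) hull_subspace)

lemma closed_span_superset: "A \<subseteq> carrier E \<Longrightarrow> A \<subseteq> closed_span E A"
  using norm_closure_superset[OF linear_subspaceD(1)[OF hull_subspace[of A]]]
    hull_subset[of A "\<lambda>H. linear_subspace H E"]
  by (auto simp: closed_span_eq)

text \<open>Closed subspaces of the closed span, tested inside the span alone, are everything once they
  contain the generators; this is the induction principle for the Lipschitz-free space.\<close>

lemma closed_span_induct:
  fixes A
  assumes A: "A \<subseteq> carrier E" and F: "F = E\<lparr>carrier := closed_span E A\<rparr>"
    and N: "linear_subspace N F" "carrier_normed_space.norm_closed F N" and "A \<subseteq> N"
  shows "N = carrier F"
proof -
  note S = closed_span_subspace[OF A]
  interpret F: carrier_normed_space F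
    using normed_subspace[OF S] by (simp add: carrier_normed_space_def F)
  note NF = F.linear_subspaceD[OF N(1)]
  have sub: "closed_span E A \<subseteq> carrier E" using linear_subspaceD(1)[OF S] .
  have cF: "carrier F = closed_span E A" by (simp add: F)
  have "linear_subspace N E"
    by (rule linear_subspaceI) (use NF sub in \<open>auto simp: F\<close>)
  then have hull: "(\<lambda>H. linear_subspace H E) hull A \<subseteq> N"
    using \<open>A \<subseteq> N\<close> by (simp add: hull_minimal)
  have "x \<in> N" if x: "x \<in> closed_span E A" for x
  proof -
    have "\<exists>y\<in>N. vnorm F (y \<ominus>\<^bsub>F\<^esub> x) < e" if "e > 0" for e
    proof -
      obtain y where y: "y \<in> N" "vnorm E (y \<ominus> x) < e"
        using x hull \<open>e > 0\<close> unfolding closed_span_eq[OF A] norm_closure_def by blast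
      then have "y \<in> closed_span E A" using NF(1) by (auto simp: F)
      then have "vnorm F (y \<ominus>\<^bsub>F\<^esub> x) = vnorm E (y \<ominus> x)"
        using minus_subspace[OF S _ x, of y] by (simp add: F)
      then show ?thesis using y by (intro bexI[of _ y]) simp_all
    qed
    then show ?thesis
      using N(2) x by (auto simp: F.norm_closed_def cF)
  qed
  then show ?thesis using NF(1) by (auto simp: cF)
qed

end

subsection \<open>The dual of a normed space\<close>

lemma real_line_simps [simp]:
  "carrier real_line = UNIV" "zero real_line = 0" "add real_line = (+)" "smult real_line = (*)"
  "vnorm real_line = abs"
  by (simp_all add: real_line_def)

interpretation real_line: carrier_normed_space real_line
  by (simp add: carrier_normed_space_def normed_space_real_line)

lemma real_line_minus [simp]: "x \<ominus>\<^bsub>real_line\<^esub> y = x - y"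
  using real_line.minus_eq_scale[of x y] by simp

lemma dual_space_simps [simp]:
  "carrier (dual_space E) = bounded_operators E real_line"
  "\<zero>\<^bsub>dual_space E\<^esub> = (\<lambda>x\<in>carrier E. 0)"
  "\<phi> \<oplus>\<^bsub>dual_space E\<^esub> \<psi> = (\<lambda>x\<in>carrier E. \<phi> x + \<psi> x)"
  "a \<odot>\<^bsub>dual_space E\<^esub> \<phi> = (\<lambda>x\<in>carrier E. a * \<phi> x)"
  "vnorm (dual_space E) = op_norm E real_line"
  by (simp_all add: dual_space_def)

context carrier_normed_space
begin

lemma functional: "\<phi> \<in> bounded_operators E real_line \<Longrightarrow> bounded_operator E real_line \<phi>"
  by (rule bounded_operatorI) (auto simp: normed normed_space_real_line)

lemma functional_eqI:
  assumes "\<phi> \<in> bounded_operators E real_line" "\<psi> \<in> bounded_operators E real_line"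
    and "\<And>x. x \<in> carrier E \<Longrightarrow> \<phi> x = \<psi> x"
  shows "\<phi> = \<psi>"
  using bounded_operator.extensional[OF functional[OF assms(1)]]
    bounded_operator.extensional[OF functional[OF assms(2)]] assms(3) by (metis ext)

lemma functional_norm_le:
  "\<phi> \<in> bounded_operators E real_line \<Longrightarrow> x \<in> carrier E \<Longrightarrow> \<bar>\<phi> x\<bar> \<le> op_norm E real_line \<phi> * vnorm E x"
  using bounded_operator.norm_le_op_norm[OF functional, of \<phi> x] by simp

lemma op_norm_functional_le:
  assumes "\<phi> \<in> bounded_operators E real_line" "0 \<le> B"
    and "\<And>x. x \<in> carrier E \<Longrightarrow> \<bar>\<phi> x\<bar> \<le> B * vnorm E x"
  shows "op_norm E real_line \<phi> \<le> B"
  using bounded_operator.op_norm_le[OF functional[OF assms(1)] assms(2)] assms(3) by simp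

lemma normed_dual: "normed_space (dual_space E)"
proof (rule normed_spaceI)
  note op = bounded_operator.op_norm_nonneg[OF functional]
  note add = bounded_operator.add[OF functional, simplified]
  note scale = bounded_operator.scale[OF functional, simplified]
  note ext = bounded_operator.extensional[OF functional]
  show z: "\<zero>\<^bsub>dual_space E\<^esub> \<in> carrier (dual_space E)"
    unfolding dual_space_simps by (rule bounded_operatorsI[where B = 0]) (auto simp: normed)
  show ac: "\<phi> \<oplus>\<^bsub>dual_space E\<^esub> \<psi> \<in> carrier (dual_space E)"
    if "\<phi> \<in> carrier (dual_space E)" "\<psi> \<in> carrier (dual_space E)" for \<phi> \<psi>
    using that unfolding dual_space_simps
  proof (intro bounded_operatorsI[where B = "op_norm E real_line \<phi> + op_norm E real_line \<psi>"] normed)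
    fix x assume "x \<in> carrier E"
    then show "vnorm real_line (\<phi> x + \<psi> x)
        \<le> (op_norm E real_line \<phi> + op_norm E real_line \<psi>) * vnorm E x"
      using functional_norm_le[of \<phi> x] functional_norm_le[of \<psi> x] that
      by (simp add: algebra_simps)
  qed (auto simp: add scale algebra_simps)
  show sc: "a \<odot>\<^bsub>dual_space E\<^esub> \<phi> \<in> carrier (dual_space E)"
    if "\<phi> \<in> carrier (dual_space E)" for a \<phi>
    using that unfolding dual_space_simps
  proof (intro bounded_operatorsI[where B = "\<bar>a\<bar> * op_norm E real_line \<phi>"] normed)
    fix x assume "x \<in> carrier E"
    then show "vnorm real_line (a * \<phi> x) \<le> \<bar>a\<bar> * op_norm E real_line \<phi> * vnorm E x"
      using functional_norm_le[of \<phi> x] that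
      by (simp add: abs_mult mult.assoc mult_left_mono)
  qed (auto simp: add scale algebra_simps)
  show "\<phi> = \<zero>\<^bsub>dual_space E\<^esub>"
    if "\<phi> \<in> carrier (dual_space E)" "vnorm (dual_space E) \<phi> = 0" for \<phi>
    using that z functional_norm_le[of \<phi>] by (intro functional_eqI) auto
  have le: "op_norm E real_line (a \<odot>\<^bsub>dual_space E\<^esub> \<phi>) \<le> \<bar>a\<bar> * op_norm E real_line \<phi>"
    if "\<phi> \<in> carrier (dual_space E)" for a \<phi>
  proof (rule op_norm_functional_le)
    show "a \<odot>\<^bsub>dual_space E\<^esub> \<phi> \<in> bounded_operators E real_line" using sc that by simp
    show "\<bar>(a \<odot>\<^bsub>dual_space E\<^esub> \<phi>) x\<bar> \<le> \<bar>a\<bar> * op_norm E real_line \<phi> * vnorm E x" if "x \<in> carrier E" for x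
      using functional_norm_le[of \<phi> x] that \<open>\<phi> \<in> carrier _\<close>
      by (simp add: abs_mult mult.assoc mult_left_mono)
  qed (use that op in auto)
  show "vnorm (dual_space E) (a \<odot>\<^bsub>dual_space E\<^esub> \<phi>) = \<bar>a\<bar> * vnorm (dual_space E) \<phi>"
    if \<phi>: "\<phi> \<in> carrier (dual_space E)" for a \<phi>
  proof (cases "a = 0")
    case True
    then show ?thesis
      using le[OF \<phi>, of 0] op[of "0 \<odot>\<^bsub>dual_space E\<^esub> \<phi>"] sc[OF \<phi>, of 0] by simp
  next
    case False
    have "(1/a) \<odot>\<^bsub>dual_space E\<^esub> (a \<odot>\<^bsub>dual_space E\<^esub> \<phi>) = \<phi>"
    proof (rule functional_eqI)
      show "(1/a) \<odot>\<^bsub>dual_space E\<^esub> (a \<odot>\<^bsub>dual_space E\<^esub> \<phi>) \<in> bounded_operators E real_line"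
        using sc[OF sc[OF \<phi>], of "1/a" a] by simp
    qed (use False \<phi> in auto)
    then have "op_norm E real_line \<phi> \<le> \<bar>1/a\<bar> * op_norm E real_line (a \<odot>\<^bsub>dual_space E\<^esub> \<phi>)"
      using le[OF sc[OF \<phi>], of "1/a" a] by simp
    then have "\<bar>a\<bar> * op_norm E real_line \<phi> \<le> op_norm E real_line (a \<odot>\<^bsub>dual_space E\<^esub> \<phi>)"
      using False by (simp add: field_simps)
    then show ?thesis using le[OF \<phi>, of a] by simp
  qed
  show "vnorm (dual_space E) (\<phi> \<oplus>\<^bsub>dual_space E\<^esub> \<psi>) \<le> vnorm (dual_space E) \<phi> + vnorm (dual_space E) \<psi>"
    if "\<phi> \<in> carrier (dual_space E)" "\<psi> \<in> carrier (dual_space E)" for \<phi> \<psi>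
    unfolding dual_space_simps(5)
  proof (rule op_norm_functional_le)
    show "\<phi> \<oplus>\<^bsub>dual_space E\<^esub> \<psi> \<in> bounded_operators E real_line" using ac that by simp
    show "\<bar>(\<phi> \<oplus>\<^bsub>dual_space E\<^esub> \<psi>) x\<bar> \<le> (op_norm E real_line \<phi> + op_norm E real_line \<psi>) * vnorm E x"
      if "x \<in> carrier E" for x
      using functional_norm_le[of \<phi> x] functional_norm_le[of \<psi> x] that
        \<open>\<phi> \<in> carrier _\<close> \<open>\<psi> \<in> carrier _\<close> by (simp add: algebra_simps)
  qed (use that op in auto)
qed (auto intro!: functional_eqI simp: algebra_simps restrict_def bounded_operators_def PiE_def extensional_def fun_eq_iff)

lemma dual_minus:
  assumes "\<phi> \<in> bounded_operators E real_line" "\<psi> \<in> bounded_operators E real_line" "x \<in> carrier E"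
  shows "(\<phi> \<ominus>\<^bsub>dual_space E\<^esub> \<psi>) x = \<phi> x - \<psi> x"
proof -
  interpret D: carrier_normed_space "dual_space E"
    using normed_dual by (simp add: carrier_normed_space_def)
  show ?thesis using D.minus_eq_scale[of \<phi> \<psi>] assms by simp
qed

text \<open>A Cauchy sequence of functionals converges pointwise, and the Cauchy estimate survives the
  passage to the limit in one index uniformly on the unit ball.\<close>
theorem banach_dual: "banach_space (dual_space E)"
proof -
  interpret D: carrier_normed_space "dual_space E"
    using normed_dual by (simp add: carrier_normed_space_def)
  show ?thesis
  proof (rule D.banach_spaceI)
    fix \<sigma> assume \<sigma>: "\<And>n. \<sigma> n \<in> carrier (dual_space E)"
      and fast: "\<And>n. vnorm (dual_space E) (\<sigma> (Suc n) \<ominus>\<^bsub>dual_space E\<^esub> \<sigma> n) < (1/2)^n"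
    have Cau: "\<exists>N. \<forall>m\<ge>N. \<forall>n\<ge>N. vnorm (dual_space E) (\<sigma> m \<ominus>\<^bsub>dual_space E\<^esub> \<sigma> n) < e" if "e > 0" for e
      by (rule D.fast_imp_Cauchy[OF \<sigma> fast that])
    have diff: "\<bar>\<sigma> m x - \<sigma> n x\<bar> \<le> vnorm (dual_space E) (\<sigma> m \<ominus>\<^bsub>dual_space E\<^esub> \<sigma> n) * vnorm E x"
      if "x \<in> carrier E" for m n x
      using functional_norm_le[of "\<sigma> m \<ominus>\<^bsub>dual_space E\<^esub> \<sigma> n" x] dual_minus[of "\<sigma> m" "\<sigma> n" x]
        D.minus_closed'[OF \<sigma> \<sigma>, of m n] \<sigma> that by simp
    have "convergent (\<lambda>n. \<sigma> n x)" if x: "x \<in> carrier E" for x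
    proof -
      have "Cauchy (\<lambda>n. \<sigma> n x)"
        unfolding Cauchy_def
      proof (intro allI impI)
        fix e :: real assume "e > 0"
        have pos: "vnorm E x + 1 > 0" using norm_nonneg[OF x] by linarith
        then have "e / (vnorm E x + 1) > 0" using \<open>e > 0\<close> by simp
        then obtain N where N: "\<And>m n. \<lbrakk>m \<ge> N; n \<ge> N\<rbrakk> \<Longrightarrow>
            vnorm (dual_space E) (\<sigma> m \<ominus>\<^bsub>dual_space E\<^esub> \<sigma> n) < e / (vnorm E x + 1)"
          using Cau by meson
        have "\<bar>\<sigma> m x - \<sigma> n x\<bar> < e" if "m \<ge> N" "n \<ge> N" for m n
        proof -
          have "\<bar>\<sigma> m x - \<sigma> n x\<bar> \<le> e / (vnorm E x + 1) * vnorm E x"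
            using diff[OF x, of m n] mult_right_mono[OF less_imp_le[OF N[OF that]] norm_nonneg[OF x]]
            by linarith
          also have "\<dots> < e" using \<open>e > 0\<close> pos by (simp add: field_simps)
          finally show ?thesis .
        qed
        then show "\<exists>M. \<forall>m\<ge>M. \<forall>n\<ge>M. dist (\<sigma> m x) (\<sigma> n x) < e"
          by (auto simp: dist_real_def)
      qed
      then show ?thesis by (simp add: Cauchy_convergent)
    qed
    then obtain \<phi> where \<phi>: "\<And>x. x \<in> carrier E \<Longrightarrow> (\<lambda>n. \<sigma> n x) \<longlonglongrightarrow> \<phi> x"
      unfolding convergent_def by metis
    have close: "\<exists>N. \<forall>n\<ge>N. \<forall>x\<in>carrier E. \<bar>\<sigma> n x - \<phi> x\<bar> \<le> e * vnorm E x" if e: "e > 0" for e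
    proof -
      obtain N where N: "\<And>m n. \<lbrakk>m \<ge> N; n \<ge> N\<rbrakk> \<Longrightarrow>
          vnorm (dual_space E) (\<sigma> m \<ominus>\<^bsub>dual_space E\<^esub> \<sigma> n) < e"
        using Cau[OF e] by meson
      have "\<bar>\<sigma> n x - \<phi> x\<bar> \<le> e * vnorm E x" if n: "n \<ge> N" and x: "x \<in> carrier E" for n x
      proof (rule LIMSEQ_le_const2)
        show "(\<lambda>m. \<bar>\<sigma> n x - \<sigma> m x\<bar>) \<longlonglongrightarrow> \<bar>\<sigma> n x - \<phi> x\<bar>"
          by (intro tendsto_intros \<phi>[OF x])
        have "\<bar>\<sigma> n x - \<sigma> m x\<bar> \<le> e * vnorm E x" if "m \<ge> N" for m
          using diff[OF x, of n m]
            mult_right_mono[OF less_imp_le[OF N[OF n that]] norm_nonneg[OF x]]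
          by linarith
        then show "\<exists>M. \<forall>m\<ge>M. \<bar>\<sigma> n x - \<sigma> m x\<bar> \<le> e * vnorm E x" by blast
      qed
      then show ?thesis by blast
    qed
    obtain N1 where N1: "\<And>n x. n \<ge> N1 \<Longrightarrow> x \<in> carrier E \<Longrightarrow> \<bar>\<sigma> n x - \<phi> x\<bar> \<le> 1 * vnorm E x"
      using close[of 1] by auto
    define \<psi> where "\<psi> = (\<lambda>x\<in>carrier E. \<phi> x)"
    have \<psi>: "\<psi> \<in> bounded_operators E real_line"
      unfolding \<psi>_def
    proof (rule bounded_operatorsI[where B = "op_norm E real_line (\<sigma> N1) + 1"])
      fix x y assume xy: "x \<in> carrier E" "y \<in> carrier E"
      have "(\<lambda>n. \<sigma> n x + \<sigma> n y) \<longlonglongrightarrow> \<phi> x + \<phi> y" by (intro tendsto_add \<phi> xy)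
      moreover have "\<sigma> n x + \<sigma> n y = \<sigma> n (x \<oplus> y)" for n
        using bounded_operator.add[OF functional, of "\<sigma> n" x y] \<sigma> xy by simp
      ultimately show "\<phi> (x \<oplus> y) = \<phi> x \<oplus>\<^bsub>real_line\<^esub> \<phi> y"
        using LIMSEQ_unique[OF \<phi>[of "x \<oplus> y"]] xy by simp
    next
      fix a x assume x: "x \<in> carrier E"
      have "(\<lambda>n. a * \<sigma> n x) \<longlonglongrightarrow> a * \<phi> x" by (intro tendsto_mult_left \<phi> x)
      moreover have "a * \<sigma> n x = \<sigma> n (a \<odot> x)" for n
        using bounded_operator.scale[OF functional, of "\<sigma> n" x a] \<sigma> x by simp
      ultimately show "\<phi> (a \<odot> x) = a \<odot>\<^bsub>real_line\<^esub> \<phi> x"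
        using LIMSEQ_unique[OF \<phi>[of "a \<odot> x"]] x by simp
    next
      fix x assume x: "x \<in> carrier E"
      have "\<bar>\<sigma> N1 x\<bar> \<le> op_norm E real_line (\<sigma> N1) * vnorm E x"
        using \<sigma> x by (intro functional_norm_le) auto
      then show "vnorm real_line (\<phi> x) \<le> (op_norm E real_line (\<sigma> N1) + 1) * vnorm E x"
        using N1[OF order_refl x] by (simp add: algebra_simps)
    qed (auto simp: normed)
    have "(\<lambda>n. vnorm (dual_space E) (\<sigma> n \<ominus>\<^bsub>dual_space E\<^esub> \<psi>)) \<longlonglongrightarrow> 0"
    proof (rule LIMSEQ_I)
      fix e :: real assume "e > 0"
      then obtain N where N: "\<And>n x. n \<ge> N \<Longrightarrow> x \<in> carrier E \<Longrightarrow> \<bar>\<sigma> n x - \<phi> x\<bar> \<le> (e/2) * vnorm E x"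
        using close[of "e/2"] by auto
      have "vnorm (dual_space E) (\<sigma> n \<ominus>\<^bsub>dual_space E\<^esub> \<psi>) \<le> e/2" if "n \<ge> N" for n
        unfolding dual_space_simps
      proof (rule op_norm_functional_le)
        show "\<sigma> n \<ominus>\<^bsub>dual_space E\<^esub> \<psi> \<in> bounded_operators E real_line"
          using D.minus_closed'[of "\<sigma> n" \<psi>] \<sigma>[of n] \<psi> unfolding dual_space_simps by blast
        show "\<bar>(\<sigma> n \<ominus>\<^bsub>dual_space E\<^esub> \<psi>) x\<bar> \<le> e / 2 * vnorm E x" if "x \<in> carrier E" for x
          using N[OF \<open>n \<ge> N\<close> that] dual_minus[of "\<sigma> n" \<psi> x] \<sigma>[of n] \<psi> that
          by (simp add: \<psi>_def)
      qed (use \<open>e > 0\<close> in auto)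
      moreover have "0 \<le> vnorm (dual_space E) (\<sigma> n \<ominus>\<^bsub>dual_space E\<^esub> \<psi>)" for n
        using D.norm_nonneg[OF D.minus_closed'[OF \<sigma>, of \<psi> n]] \<psi> by simp
      ultimately have "norm (vnorm (dual_space E) (\<sigma> n \<ominus>\<^bsub>dual_space E\<^esub> \<psi>) - 0) < e" if "n \<ge> N" for n
        using that \<open>e > 0\<close> by (smt (verit) field_sum_of_halves real_norm_def)
      then show "\<exists>no. \<forall>n\<ge>no. norm (vnorm (dual_space E) (\<sigma> n \<ominus>\<^bsub>dual_space E\<^esub> \<psi>) - 0) < e" by blast
    qed
    then have "D.norm_limit \<sigma> \<psi>" using \<psi> by (simp add: D.norm_limit_def)
    then show "\<exists>l. D.norm_limit \<sigma> l" by blast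
  qed
qed

end

subsection \<open>Quotients by closed subspaces\<close>

locale closed_subspace_quotient = carrier_normed_space +
  fixes N
  assumes subspace: "linear_subspace N E" and closed: "norm_closed N"
begin

interpretation abelian_subgroup N E
proof (rule abelian_subgroupI3)
  show "additive_subgroup N E"
    using subspace by (intro additive_subgroupI) (simp add: linear_subspace_def submodule_def)
  show "abelian_group E" by unfold_locales
qed

abbreviation Quot where "Quot \<equiv> quotient_space E N"

lemma coset_mem_iff: "x \<in> carrier E \<Longrightarrow> z \<in> N +> x \<longleftrightarrow> z \<in> carrier E \<and> z \<ominus> x \<in> N"
  using a_rcos_module[of x z] a_r_coset_subset_G[OF a_subset, of x] by (auto simp: minus_eq)

lemma coset_eq_iff:
  assumes "x \<in> carrier E" "y \<in> carrier E"
  shows "N +> x = N +> y \<longleftrightarrow> x \<ominus> y \<in> N"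
  using a_repr_independence'[of x y] a_rcos_self[of x] coset_mem_iff[OF assms(2), of x] assms by auto

lemma coset_self: "x \<in> carrier E \<Longrightarrow> x \<in> N +> x"
  by (rule a_rcos_self)

lemma coset_zero: "N +> \<zero> = N"
  using a_subset by simp

lemma carrier_quotient: "carrier Quot = (\<lambda>x. N +> x) ` carrier E"
  by (auto simp: quotient_space_def A_RCOSETS_def')

lemma quotient_zero: "\<zero>\<^bsub>Quot\<^esub> = N +> \<zero>"
  by (simp add: quotient_space_def coset_zero)

lemma quotient_add:
  "\<lbrakk>x \<in> carrier E; y \<in> carrier E\<rbrakk> \<Longrightarrow> (N +> x) \<oplus>\<^bsub>Quot\<^esub> (N +> y) = N +> (x \<oplus> y)"
  by (simp add: quotient_space_def a_rcos_sum)

lemma quotient_scale: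
  assumes x: "x \<in> carrier E"
  shows "a \<odot>\<^bsub>Quot\<^esub> (N +> x) = N +> (a \<odot> x)"
proof -
  have eq: "N +> (a \<odot> y) = N +> (a \<odot> x)" if "y \<in> N +> x" for y
    using that x linear_subspaceD(4)[OF subspace, of "y \<ominus> x" a]
    by (simp add: coset_mem_iff coset_eq_iff scale_minus)
  have "(\<Union>y\<in>N +> x. N +> (a \<odot> y)) = (\<Union>y\<in>N +> x. N +> (a \<odot> x))"
    by (intro SUP_cong eq refl)
  also have "\<dots> = N +> (a \<odot> x)" using coset_self[OF x] by auto
  finally have "(\<Union>y\<in>N +> x. N +> (a \<odot> y)) = N +> (a \<odot> x)" .
  then show ?thesis by (simp add: quotient_space_def)
qed

lemma quotient_norm_eq: "vnorm Quot C = (INF x\<in>C. vnorm E x)"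
  by (simp add: quotient_space_def)

lemma quotient_norm_le:
  assumes "x \<in> carrier E" "z \<in> N +> x" shows "vnorm Quot (N +> x) \<le> vnorm E z"
  unfolding quotient_norm_eq
  using assms by (intro cINF_lower) (auto simp: coset_mem_iff bdd_below_def intro!: exI[of _ 0])

lemma quotient_norm_greatest:
  assumes "x \<in> carrier E" "\<And>z. z \<in> N +> x \<Longrightarrow> c \<le> vnorm E z" shows "c \<le> vnorm Quot (N +> x)"
  unfolding quotient_norm_eq using assms coset_self by (intro cINF_greatest) auto

lemma quotient_norm_approx:
  assumes "x \<in> carrier E" "vnorm Quot (N +> x) < c" obtains z where "z \<in> N +> x" "vnorm E z < c"
  using quotient_norm_greatest[OF assms(1), of c] assms(2) by fastforce

lemma quotient_norm_nonneg: "x \<in> carrier E \<Longrightarrow> 0 \<le> vnorm Quot (N +> x)"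
  by (rule quotient_norm_greatest) (auto simp: coset_mem_iff)

lemma quotient_norm_scale_le:
  assumes x: "x \<in> carrier E"
  shows "vnorm Quot (N +> (a \<odot> x)) \<le> \<bar>a\<bar> * vnorm Quot (N +> x)"
proof -
  have *: "vnorm Quot (N +> (a \<odot> x)) \<le> \<bar>a\<bar> * vnorm E z" if z: "z \<in> N +> x" for z
  proof -
    have "a \<odot> z \<in> N +> (a \<odot> x)"
      using z x linear_subspaceD(4)[OF subspace, of "z \<ominus> x" a]
      by (simp add: coset_mem_iff scale_minus)
    then show ?thesis
      using quotient_norm_le[of "a \<odot> x" "a \<odot> z"] x z by (simp add: norm_scale coset_mem_iff)
  qed
  show ?thesis
  proof (cases "a = 0")
    case True
    then show ?thesis using *[OF coset_self[OF x]] by simp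
  next
    case False
    then have "vnorm Quot (N +> (a \<odot> x)) / \<bar>a\<bar> \<le> vnorm Quot (N +> x)"
      using * x by (intro quotient_norm_greatest) (auto simp: divide_simps mult.commute)
    then show ?thesis using False by (simp add: divide_simps mult.commute)
  qed
qed

lemma normed_quotient: "normed_space Quot"
proof (rule normed_spaceI)
  note simps = carrier_quotient quotient_zero quotient_add quotient_scale
  show "C = \<zero>\<^bsub>Quot\<^esub>" if C: "C \<in> carrier Quot" "vnorm Quot C = 0" for C
  proof -
    obtain x where x: "x \<in> carrier E" "C = N +> x" using C by (auto simp: carrier_quotient)
    \<comment> \<open>Small representatives \<open>z\<close> of the coset of \<open>x\<close> give elements \<open>x \<ominus> z\<close> of \<open>N\<close> close to \<open>x\<close>.\<close>
    have "\<exists>y\<in>N. vnorm E (y \<ominus> x) < e" if e: "e > 0" for e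
    proof -
      obtain z where z: "z \<in> N +> x" "vnorm E z < e"
        using quotient_norm_approx[OF x(1), of e] x \<open>vnorm Quot C = 0\<close> e by auto
      then have zE: "z \<in> carrier E" and zN: "z \<ominus> x \<in> N" using x by (auto simp: coset_mem_iff)
      have "(-1) \<odot> (z \<ominus> x) = x \<ominus> z"
        using x zE by (simp add: minus_eq_scale scale_right_distrib scale_scale a_comm)
      then have "x \<ominus> z \<in> N" using linear_subspaceD(4)[OF subspace zN, of "-1"] by simp
      moreover have "(x \<ominus> z) \<ominus> x = \<ominus> z"
        using x zE by (simp add: minus_eq a_comm[of x] a_assoc r_neg)
      ultimately show ?thesis using z(2) zE by (intro bexI[of _ "x \<ominus> z"]) simp_all
    qed
    then have "x \<in> N" using closed x by (auto simp: norm_closed_def)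
    then show ?thesis using x coset_eq_iff[of x \<zero>] by (simp add: quotient_zero)
  qed
  show "vnorm Quot (a \<odot>\<^bsub>Quot\<^esub> C) = \<bar>a\<bar> * vnorm Quot C" if C: "C \<in> carrier Quot" for a C
  proof -
    obtain x where x: "x \<in> carrier E" "C = N +> x" using C by (auto simp: carrier_quotient)
    show ?thesis
    proof (cases "a = 0")
      case True
      then show ?thesis
        using x quotient_norm_scale_le[OF x(1), of 0] quotient_norm_nonneg[of \<zero>]
        by (simp add: quotient_scale)
    next
      case False
      have "vnorm Quot (N +> x) \<le> \<bar>1/a\<bar> * vnorm Quot (N +> (a \<odot> x))"
        using quotient_norm_scale_le[of "a \<odot> x" "1/a"] x False by (simp add: scale_scale)
      then have "\<bar>a\<bar> * vnorm Quot (N +> x) \<le> vnorm Quot (N +> (a \<odot> x))"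
        using False by (simp add: field_simps)
      then show ?thesis using quotient_norm_scale_le[OF x(1), of a] x by (simp add: quotient_scale)
    qed
  qed
  show "vnorm Quot (C \<oplus>\<^bsub>Quot\<^esub> D) \<le> vnorm Quot C + vnorm Quot D"
    if C: "C \<in> carrier Quot" and D: "D \<in> carrier Quot" for C D
  proof -
    obtain x where x: "x \<in> carrier E" "C = N +> x" using C by (auto simp: carrier_quotient)
    obtain y where y: "y \<in> carrier E" "D = N +> y" using D by (auto simp: carrier_quotient)
    have sum: "vnorm Quot (N +> (x \<oplus> y)) \<le> vnorm E z + vnorm E w"
      if z: "z \<in> N +> x" and w: "w \<in> N +> y" for z w
    proof -
      have zw: "z \<in> carrier E" "w \<in> carrier E" using z w x y by (auto simp: coset_mem_iff)
      have "z \<oplus> w \<in> N +> (x \<oplus> y)"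
        using z w x y linear_subspaceD(3)[OF subspace, of "z \<ominus> x" "w \<ominus> y"]
        by (simp add: coset_mem_iff add_minus_add)
      then have "vnorm Quot (N +> (x \<oplus> y)) \<le> vnorm E (z \<oplus> w)"
        using x y by (intro quotient_norm_le) auto
      then show ?thesis using norm_add_le[OF zw] by simp
    qed
    have "vnorm Quot (N +> (x \<oplus> y)) - vnorm E z \<le> vnorm Quot (N +> y)" if "z \<in> N +> x" for z
      using sum[OF that] by (intro quotient_norm_greatest y) (simp add: diff_le_eq add.commute)
    then have "vnorm Quot (N +> (x \<oplus> y)) - vnorm Quot (N +> y) \<le> vnorm Quot (N +> x)"
      by (intro quotient_norm_greatest x) (simp add: diff_le_eq add.commute)
    then show ?thesis using x y by (simp add: quotient_add)
  qed
  show "C \<oplus>\<^bsub>Quot\<^esub> D = D \<oplus>\<^bsub>Quot\<^esub> C" if "C \<in> carrier Quot" "D \<in> carrier Quot" for C D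
    using that by (auto simp: carrier_quotient quotient_add a_comm)
qed (auto simp: carrier_quotient quotient_zero quotient_add quotient_scale a_assoc
    scale_left_distrib scale_right_distrib scale_scale)

sublocale Q: carrier_normed_space Quot
  by (simp add: carrier_normed_space_def normed_quotient)

lemma quotient_map_closed: "x \<in> carrier E \<Longrightarrow> N +> x \<in> carrier Quot"
  by (auto simp: carrier_quotient)

lemma quotient_map_operator: "(\<lambda>x\<in>carrier E. N +> x) \<in> bounded_operators E Quot"
  by (rule bounded_operatorsI[where B = 1])
    (auto simp: quotient_map_closed quotient_add quotient_scale normed intro: quotient_norm_le coset_self)

lemma quotient_minus:
  "\<lbrakk>x \<in> carrier E; y \<in> carrier E\<rbrakk> \<Longrightarrow> (N +> x) \<ominus>\<^bsub>Quot\<^esub> (N +> y) = N +> (x \<ominus> y)"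
  by (simp add: Q.minus_eq_scale minus_eq_scale quotient_map_closed quotient_add quotient_scale)

text \<open>Completeness passes to the quotient because a sequence of cosets with geometrically small
  steps can be lifted, one representative after the other, to a sequence of the same kind.\<close>

theorem banach_quotient:
  assumes "banach_space E"
  shows "banach_space Quot"
proof (rule Q.banach_spaceI)
  fix \<sigma> assume \<sigma>: "\<And>n. \<sigma> n \<in> carrier Quot"
    and fast: "\<And>n. vnorm Quot (\<sigma> (Suc n) \<ominus>\<^bsub>Quot\<^esub> \<sigma> n) < (1/2)^n"
  have step: "\<exists>y. (y \<in> carrier E \<and> \<sigma> (Suc n) = N +> y) \<and> vnorm E (y \<ominus> x) < (1/2)^n"
    if x: "x \<in> carrier E \<and> \<sigma> n = N +> x" for x n
  proof -
    obtain w where w: "w \<in> carrier E" "\<sigma> (Suc n) = N +> w"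
      using \<sigma>[of "Suc n"] by (auto simp: carrier_quotient)
    have "vnorm Quot (N +> (w \<ominus> x)) < (1/2)^n"
      using fast[of n] x w by (simp add: quotient_minus)
    then obtain z where z: "z \<in> N +> (w \<ominus> x)" "vnorm E z < (1/2)^n"
      using quotient_norm_approx[of "w \<ominus> x"] x w by auto
    then have zE: "z \<in> carrier E" and zN: "z \<ominus> (w \<ominus> x) \<in> N"
      using x w by (auto simp: coset_mem_iff)
    have "(z \<oplus> x) \<ominus> w = z \<ominus> (w \<ominus> x)"
      using zE x w by (simp add: minus_eq_scale scale_right_distrib scale_scale a_ac)
    then have "N +> (z \<oplus> x) = \<sigma> (Suc n)"
      using zE zN x w by (simp add: coset_eq_iff)
    moreover have "(z \<oplus> x) \<ominus> x = z" using zE x by (simp add: minus_eq a_assoc r_neg)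
    ultimately show ?thesis using z zE x by (intro exI[of _ "z \<oplus> x"]) simp
  qed
  obtain x0 where "x0 \<in> carrier E \<and> \<sigma> 0 = N +> x0"
    using \<sigma>[of 0] by (auto simp: carrier_quotient)
  then obtain \<tau> where \<tau>: "\<And>n. \<tau> n \<in> carrier E \<and> \<sigma> n = N +> \<tau> n"
    and \<tau>_fast: "\<And>n. vnorm E (\<tau> (Suc n) \<ominus> \<tau> n) < (1/2)^n"
    using dependent_nat_choice[of "\<lambda>n x. x \<in> carrier E \<and> \<sigma> n = N +> x"
        "\<lambda>n x y. vnorm E (y \<ominus> x) < (1/2)^n"] step by metis
  have \<tau>E: "\<tau> n \<in> carrier E" for n using \<tau> by blast
  obtain l where l: "norm_limit \<tau> l"
    using banach_limit[OF assms \<tau>E fast_imp_Cauchy[OF \<tau>E \<tau>_fast]] by metis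
  then have lE: "l \<in> carrier E" by (simp add: norm_limit_def)
  interpret T: bounded_operator E Quot "\<lambda>x\<in>carrier E. N +> x"
    by (rule bounded_operatorI[OF normed normed_quotient quotient_map_operator])
  have "Q.norm_limit \<sigma> (N +> l)"
  proof -
    have "\<sigma> = (\<lambda>n. N +> \<tau> n)" using \<tau> by (intro ext) blast
    then show ?thesis using T.norm_limit[OF \<tau>E l] \<tau>E lE by simp
  qed
  then show "\<exists>l. Q.norm_limit \<sigma> l" by blast
qed

lemma factor_through_quotient:
  assumes Z: "normed_space Z" and T: "T \<in> bounded_operators E Z"
    and le: "\<And>x. x \<in> carrier E \<Longrightarrow> vnorm Z (T x) \<le> B * vnorm E x" and "0 \<le> B"
    and ker: "\<And>x. x \<in> N \<Longrightarrow> T x = \<zero>\<^bsub>Z\<^esub>"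
  obtains F where "F \<in> bounded_operators Quot Z" "\<And>x. x \<in> carrier E \<Longrightarrow> F (N +> x) = T x"
    "op_norm Quot Z F \<le> B"
proof -
  interpret T: bounded_operator E Z T by (rule bounded_operatorI[OF normed Z T])
  have rep: "T y = T x" if "x \<in> carrier E" "y \<in> N +> x" for x y
  proof -
    have y: "y \<in> carrier E" "y \<ominus> x \<in> N" using that by (simp_all add: coset_mem_iff)
    then have "T y \<ominus>\<^bsub>Z\<^esub> T x = \<zero>\<^bsub>Z\<^esub>"
      using ker[OF y(2)] T.minus[OF y(1) that(1)] by simp
    then show ?thesis by (rule T.Z.eq_iff_minus[THEN iffD2, rotated 2]) (use y that in auto)
  qed
  define F where "F = (\<lambda>C\<in>carrier Quot. T (SOME y. y \<in> C))"
  have F: "F (N +> x) = T x" if x: "x \<in> carrier E" for x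
    using rep[OF x] someI[of "\<lambda>y. y \<in> N +> x", OF coset_self[OF x]] x
    by (simp add: F_def quotient_map_closed)
  have bound: "vnorm Z (F (N +> x)) \<le> B * vnorm Quot (N +> x)" if x: "x \<in> carrier E" for x
  proof (cases "B = 0")
    case True
    then show ?thesis using F[OF x] le[OF x] by simp
  next
    case False
    have "vnorm Z (T x) / B \<le> vnorm Quot (N +> x)"
    proof (rule quotient_norm_greatest[OF x])
      fix z assume z: "z \<in> N +> x"
      then have "vnorm Z (T x) \<le> B * vnorm E z"
        using rep[OF x z] le[of z] x by (simp add: coset_mem_iff)
      then show "vnorm Z (T x) / B \<le> vnorm E z"
        using False \<open>0 \<le> B\<close> by (simp add: divide_simps mult.commute)
    qed
    then show ?thesis using False \<open>0 \<le> B\<close> F[OF x] by (simp add: divide_simps mult.commute)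
  qed
  have "(\<lambda>C\<in>carrier Quot. F C) \<in> bounded_operators Quot Z"
  proof (rule bounded_operatorsI[where B = B])
    show "vnorm Z (F C) \<le> B * vnorm Quot C" if "C \<in> carrier Quot" for C
      using bound that by (auto simp: carrier_quotient)
  qed (auto simp: carrier_quotient F quotient_add quotient_scale T.add T.scale normed_quotient)
  moreover have "(\<lambda>C\<in>carrier Quot. F C) = F" by (auto simp: F_def)
  ultimately have op: "F \<in> bounded_operators Quot Z" by simp
  moreover have "op_norm Quot Z F \<le> B"
    using bound by (intro bounded_operator.op_norm_le[OF bounded_operatorI[OF normed_quotient Z op] \<open>0 \<le> B\<close>])
      (auto simp: carrier_quotient)
  ultimately show thesis using that F by blast
qed

end

section \<open>Lipschitz functions and the Lipschitz-free space of a Cayley graph\<close>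

subsection \<open>Lipschitz constants\<close>

lemma lip_const_nonneg:
  assumes "Lipschitz_continuous_map m m' f"
  shows "0 \<le> lip_const m m' f"
  unfolding lip_const_def using assms unfolding Lipschitz_continuous_map_pos
  by (intro cInf_greatest) (auto intro: less_imp_le)

lemma lip_const_le:
  assumes "0 \<le> B" "\<And>x y. \<lbrakk>x \<in> mspace m; y \<in> mspace m\<rbrakk> \<Longrightarrow> mdist m' (f x) (f y) \<le> B * mdist m x y"
  shows "lip_const m m' f \<le> B"
  unfolding lip_const_def using assms by (intro cInf_lower) (auto simp: bdd_below_def)

text \<open>The infimum in the definition of the Lipschitz constant is itself a Lipschitz bound.  Pairs at
  distance zero are treated apart because there the bound cannot be divided by the distance.\<close>
lemma lip_const_bound:
  assumes f: "Lipschitz_continuous_map m m' f" and xy: "x \<in> mspace m" "y \<in> mspace m"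
  shows "mdist m' (f x) (f y) \<le> lip_const m m' f * mdist m x y"
proof (cases "mdist m x y = 0")
  case True
  obtain B where "\<forall>x\<in>mspace m. \<forall>y\<in>mspace m. mdist m' (f x) (f y) \<le> B * mdist m x y"
    using f unfolding Lipschitz_continuous_map_def by blast
  then have "mdist m' (f x) (f y) \<le> B * mdist m x y" using xy by blast
  then show ?thesis using True by simp
next
  case False
  then have pos: "mdist m x y > 0" using mdist_nonneg[of m x y] by linarith
  have "mdist m' (f x) (f y) / mdist m x y \<le> lip_const m m' f"
    unfolding lip_const_def using f pos xy unfolding Lipschitz_continuous_map_pos
    by (intro cInf_greatest) (auto simp: divide_simps intro: less_imp_le)
  then show ?thesis using pos by (simp add: divide_simps)
qed

lemma (in carrier_normed_space) lip_const_bound_norm: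
  assumes "Lipschitz_continuous_map m (norm_metric E) f" "x \<in> mspace m" "y \<in> mspace m"
  shows "vnorm E (f x \<ominus> f y) \<le> lip_const m (norm_metric E) f * mdist m x y"
  using lip_const_bound[OF assms] assms(2,3) Lipschitz_continuous_map_image[OF assms(1)]
  by (auto simp: norm_dist_def split: if_splits)

lemma (in bounded_operator) Lipschitz_compose:
  assumes f: "Lipschitz_continuous_map m (norm_metric E) f"
    and g: "\<And>x. x \<in> mspace m \<Longrightarrow> g x = T (f x)"
  shows "Lipschitz_continuous_map m (norm_metric Z) g"
    and "lip_const m (norm_metric Z) g \<le> op_norm E Z T * lip_const m (norm_metric E) f"
proof -
  have fE: "f x \<in> carrier E" if "x \<in> mspace m" for x
    using Lipschitz_continuous_map_image[OF f] that by auto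
  have bound: "mdist (norm_metric Z) (g x) (g y)
      \<le> op_norm E Z T * lip_const m (norm_metric E) f * mdist m x y"
    if xy: "x \<in> mspace m" "y \<in> mspace m" for x y
  proof -
    have "mdist (norm_metric Z) (g x) (g y) = vnorm Z (T (f x \<ominus>\<^bsub>E\<^esub> f y))"
      using xy fE by (simp add: norm_dist_def g minus)
    also have "\<dots> \<le> op_norm E Z T * vnorm E (f x \<ominus>\<^bsub>E\<^esub> f y)"
      using xy fE by (intro norm_le_op_norm) auto
    also have "\<dots> \<le> op_norm E Z T * (lip_const m (norm_metric E) f * mdist m x y)"
      by (intro mult_left_mono E.lip_const_bound_norm f xy op_norm_nonneg)
    finally show ?thesis by (simp add: mult.assoc)
  qed
  show "Lipschitz_continuous_map m (norm_metric Z) g"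
    unfolding Lipschitz_continuous_map_def using bound fE by (auto simp: g)
  show "lip_const m (norm_metric Z) g \<le> op_norm E Z T * lip_const m (norm_metric E) f"
    by (intro lip_const_le bound mult_nonneg_nonneg op_norm_nonneg lip_const_nonneg f)
qed

lemma norm_metric_real_line: "norm_metric real_line = euclidean_metric"
proof -
  have "norm_dist real_line = dist" by (auto simp: norm_dist_def dist_real_def fun_eq_iff)
  then show ?thesis by (simp add: norm_metric_def euclidean_metric_def)
qed

subsection \<open>The Lipschitz-free space\<close>

locale cayley_graph = group G for G :: "('g, 'm) monoid_scheme" (structure) +
  fixes S :: "'g set"
  assumes S_sub: "S \<subseteq> carrier G" and S_sym: "\<forall>s\<in>S. inv s \<in> S" and S_gen: "generate G S = carrier G"
begin

abbreviation d where "d \<equiv> word_dist G S"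
abbreviation Lip where "Lip \<equiv> lip0 G S"
abbreviation Free where "Free \<equiv> free_space G S"

lemma mspace_word [simp]: "mspace (word_metric G S) = carrier G"
  and mdist_word [simp]: "mdist (word_metric G S) = d"
proof -
  interpret Metric_space "carrier G" d
    by (rule Metric_space_word_dist[OF group_axioms S_sub S_sym S_gen])
  show "mspace (word_metric G S) = carrier G" "mdist (word_metric G S) = d"
    by (simp_all add: word_metric_def)
qed

lemma d_nonneg [simp]: "0 \<le> d g h"
  by (simp add: word_dist_def)

lemma lip0_simps [simp]:
  "\<zero>\<^bsub>Lip\<^esub> = (\<lambda>g\<in>carrier G. 0)"
  "f \<oplus>\<^bsub>Lip\<^esub> f' = (\<lambda>g\<in>carrier G. f g + f' g)"
  "a \<odot>\<^bsub>Lip\<^esub> f = (\<lambda>g\<in>carrier G. a * f g)"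
  by (simp_all add: lip0_def)

lemma lip0_carrier_iff:
  "f \<in> carrier Lip \<longleftrightarrow> f \<in> extensional (carrier G) \<and> f \<one> = 0 \<and>
    (\<exists>B. \<forall>g\<in>carrier G. \<forall>h\<in>carrier G. \<bar>f g - f h\<bar> \<le> B * d g h)"
  by (auto simp: lip0_def Lipschitz_continuous_map_def PiE_def dist_real_def)

lemma lip0_norm_nonneg: "f \<in> carrier Lip \<Longrightarrow> 0 \<le> vnorm Lip f"
  by (auto simp: lip0_def lip_const_nonneg)

lemma lip0_bound:
  "\<lbrakk>f \<in> carrier Lip; g \<in> carrier G; h \<in> carrier G\<rbrakk> \<Longrightarrow> \<bar>f g - f h\<bar> \<le> vnorm Lip f * d g h"
  using lip_const_bound[of "word_metric G S" euclidean_metric f g h]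
  by (auto simp: lip0_def dist_real_def)

lemma lip0_norm_le:
  "\<lbrakk>0 \<le> B; \<And>g h. \<lbrakk>g \<in> carrier G; h \<in> carrier G\<rbrakk> \<Longrightarrow> \<bar>f g - f h\<bar> \<le> B * d g h\<rbrakk> \<Longrightarrow> vnorm Lip f \<le> B"
  by (auto simp: lip0_def dist_real_def intro!: lip_const_le)

lemma lip0_eqI:
  "\<lbrakk>f \<in> carrier Lip; f' \<in> carrier Lip; \<And>g. g \<in> carrier G \<Longrightarrow> f g = f' g\<rbrakk> \<Longrightarrow> f = f'"
  by (rule extensionalityI[of _ "carrier G"]) (auto simp: lip0_carrier_iff)

lemma normed_lip0: "normed_space Lip"
proof (rule normed_spaceI)
  have add_bound: "\<bar>(f g + f' g) - (f h + f' h)\<bar> \<le> (vnorm Lip f + vnorm Lip f') * d g h"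
    if "f \<in> carrier Lip" "f' \<in> carrier Lip" "g \<in> carrier G" "h \<in> carrier G" for f f' g h
    using lip0_bound[of f g h] lip0_bound[of f' g h] that by (simp add: algebra_simps)
  have scale_bound: "\<bar>a * f g - a * f h\<bar> \<le> (\<bar>a\<bar> * vnorm Lip f) * d g h"
    if "f \<in> carrier Lip" "g \<in> carrier G" "h \<in> carrier G" for a f g h
    using mult_left_mono[OF lip0_bound[OF that], of "\<bar>a\<bar>"]
    by (simp add: right_diff_distrib[symmetric] abs_mult mult.assoc)
  show "\<zero>\<^bsub>Lip\<^esub> \<in> carrier Lip"
    by (auto simp: lip0_carrier_iff intro!: exI[of _ 0])
  show add: "f \<oplus>\<^bsub>Lip\<^esub> f' \<in> carrier Lip" if "f \<in> carrier Lip" "f' \<in> carrier Lip" for f f'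
    using add_bound[OF that] that unfolding lip0_carrier_iff[of "f \<oplus>\<^bsub>Lip\<^esub> f'"]
    by (auto simp: lip0_carrier_iff[of f] lip0_carrier_iff[of f'])
  show scale: "a \<odot>\<^bsub>Lip\<^esub> f \<in> carrier Lip" if "f \<in> carrier Lip" for a f
    using scale_bound[OF that] that unfolding lip0_carrier_iff[of "a \<odot>\<^bsub>Lip\<^esub> f"]
    by (auto simp: lip0_carrier_iff[of f])
  show "f = \<zero>\<^bsub>Lip\<^esub>" if f: "f \<in> carrier Lip" and 0: "vnorm Lip f = 0" for f
  proof (rule extensionalityI[of _ "carrier G"])
    show "f g = \<zero>\<^bsub>Lip\<^esub> g" if "g \<in> carrier G" for g
      using lip0_bound[OF f that one_closed] f 0 that by (simp add: lip0_carrier_iff)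
  qed (use f in \<open>auto simp: lip0_carrier_iff\<close>)
  have le: "vnorm Lip (a \<odot>\<^bsub>Lip\<^esub> f) \<le> \<bar>a\<bar> * vnorm Lip f" if "f \<in> carrier Lip" for a f
    using scale_bound[OF that] lip0_norm_nonneg[OF that] by (intro lip0_norm_le) auto
  show "vnorm Lip (a \<odot>\<^bsub>Lip\<^esub> f) = \<bar>a\<bar> * vnorm Lip f" if f: "f \<in> carrier Lip" for a f
  proof (cases "a = 0")
    case True
    then show ?thesis using le[OF f, of 0] lip0_norm_nonneg[OF scale[OF f, of 0]] by simp
  next
    case False
    have "(1/a) \<odot>\<^bsub>Lip\<^esub> (a \<odot>\<^bsub>Lip\<^esub> f) = f"
      using False f by (intro lip0_eqI[OF scale[OF scale[OF f]] f]) simp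
    then have "vnorm Lip f \<le> \<bar>1/a\<bar> * vnorm Lip (a \<odot>\<^bsub>Lip\<^esub> f)"
      using le[OF scale[OF f], of "1/a" a] by simp
    then have "\<bar>a\<bar> * vnorm Lip f \<le> vnorm Lip (a \<odot>\<^bsub>Lip\<^esub> f)"
      using False by (simp add: field_simps)
    then show ?thesis using le[OF f, of a] by simp
  qed
  show "vnorm Lip (f \<oplus>\<^bsub>Lip\<^esub> f') \<le> vnorm Lip f + vnorm Lip f'"
    if "f \<in> carrier Lip" "f' \<in> carrier Lip" for f f'
    using add_bound[OF that] lip0_norm_nonneg that by (intro lip0_norm_le) auto
qed (auto simp: fun_eq_iff algebra_simps restrict_def lip0_carrier_iff extensional_def)

sublocale Lip: carrier_normed_space Lip
  by (simp add: carrier_normed_space_def normed_lip0)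

sublocale Dual: carrier_normed_space "dual_space Lip"
  by (simp add: carrier_normed_space_def Lip.normed_dual)

lemma delta_apply [simp]: "f \<in> carrier Lip \<Longrightarrow> delta G S g f = f g"
  by (simp add: delta_def)

lemma delta_dual:
  assumes "g \<in> carrier G" shows "delta G S g \<in> bounded_operators Lip real_line"
  unfolding delta_def
proof (rule bounded_operatorsI[where B = "d g \<one>"])
  show "vnorm real_line (f g) \<le> d g \<one> * vnorm Lip f" if "f \<in> carrier Lip" for f
    using lip0_bound[OF that assms one_closed] that by (simp add: lip0_carrier_iff mult.commute)
qed (use assms in \<open>auto simp: normed_lip0\<close>)

lemma delta_sub: "delta G S ` carrier G \<subseteq> carrier (dual_space Lip)"
  using delta_dual by auto

lemma free_space_eq:
  "Free = dual_space Lip\<lparr>carrier := closed_span (dual_space Lip) (delta G S ` carrier G)\<rparr>"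
  by (simp add: free_space_def)

lemma free_carrier_dual: "z \<in> carrier Free \<Longrightarrow> z \<in> bounded_operators Lip real_line"
  using Dual.linear_subspaceD(1)[OF Dual.closed_span_subspace[OF delta_sub]]
  by (auto simp: free_space_eq)

sublocale Free: carrier_normed_space Free
  unfolding carrier_normed_space_def free_space_eq
  by (intro Dual.normed_subspace Dual.closed_span_subspace delta_sub)

lemma banach_free: "banach_space Free"
  unfolding free_space_eq
  by (intro Dual.banach_subspace Dual.closed_span_subspace Dual.closed_span_closed delta_sub
      Lip.banach_dual)

lemma free_simps [simp]:
  "\<zero>\<^bsub>Free\<^esub> = (\<lambda>f\<in>carrier Lip. 0)"
  "z \<oplus>\<^bsub>Free\<^esub> w = (\<lambda>f\<in>carrier Lip. z f + w f)"
  "a \<odot>\<^bsub>Free\<^esub> z = (\<lambda>f\<in>carrier Lip. a * z f)"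
  "vnorm Free = op_norm Lip real_line"
  by (simp_all add: free_space_eq)

lemma free_minus:
  assumes "z \<in> carrier Free" "w \<in> carrier Free" "f \<in> carrier Lip"
  shows "(z \<ominus>\<^bsub>Free\<^esub> w) f = z f - w f"
  using Free.minus_eq_scale[OF assms(1,2)] assms(3) by simp

lemma free_eval_le:
  "\<lbrakk>z \<in> carrier Free; f \<in> carrier Lip\<rbrakk> \<Longrightarrow> \<bar>z f\<bar> \<le> vnorm Free z * vnorm Lip f"
  using Lip.functional_norm_le[OF free_carrier_dual] by simp

lemma delta_free: "g \<in> carrier G \<Longrightarrow> delta G S g \<in> carrier Free"
  using Dual.closed_span_superset[OF delta_sub] by (auto simp: free_space_eq)

lemma free_induct:
  assumes "linear_subspace N Free" "Free.norm_closed N" "\<And>g. g \<in> carrier G \<Longrightarrow> delta G S g \<in> N"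
  shows "N = carrier Free"
  using assms by (intro Dual.closed_span_induct[OF delta_sub free_space_eq]) auto

lemma delta_one: "delta G S \<one> = \<zero>\<^bsub>Free\<^esub>"
  by (simp add: delta_def lip0_carrier_iff cong: restrict_cong)

lemma norm_delta_diff:
  assumes "g \<in> carrier G" "h \<in> carrier G"
  shows "vnorm Free (delta G S g \<ominus>\<^bsub>Free\<^esub> delta G S h) \<le> d g h"
  unfolding free_simps
proof (rule Lip.op_norm_functional_le)
  show "delta G S g \<ominus>\<^bsub>Free\<^esub> delta G S h \<in> bounded_operators Lip real_line"
    using assms by (intro free_carrier_dual Free.minus_closed' delta_free)
  show "\<bar>(delta G S g \<ominus>\<^bsub>Free\<^esub> delta G S h) f\<bar> \<le> d g h * vnorm Lip f" if "f \<in> carrier Lip" for f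
    using lip0_bound[OF that assms] that assms by (simp add: free_minus delta_free mult.commute)
qed simp

lemma eval_operator:
  assumes "f \<in> carrier Lip"
  shows "(\<lambda>z\<in>carrier Free. z f) \<in> bounded_operators Free real_line"
  using assms by (intro bounded_operatorsI[where B = "vnorm Lip f"] Free.normed)
    (auto intro: order_trans[OF free_eval_le] simp: mult.commute simp del: free_simps(4))

lemma eval_bounded_operator:
  "f \<in> carrier Lip \<Longrightarrow> bounded_operator Free real_line (\<lambda>z\<in>carrier Free. z f)"
  by (intro bounded_operatorI Free.normed normed_space_real_line eval_operator)

subsection \<open>The universal property of the Lipschitz-free space\<close>

definition pull :: "('z \<Rightarrow> real) \<Rightarrow> ('g \<Rightarrow> 'z) \<Rightarrow> 'g \<Rightarrow> real" where
  "pull \<phi> f = (\<lambda>g\<in>carrier G. \<phi> (f g))"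

context
  fixes Z :: "'z nspace" and f :: "'g \<Rightarrow> 'z"
  assumes Z: "banach_space Z" and f: "Lipschitz_continuous_map (word_metric G S) (norm_metric Z) f"
    and f_one: "f \<one> = \<zero>\<^bsub>Z\<^esub>"
begin

interpretation Z: carrier_normed_space Z
  using Z by (simp add: carrier_normed_space_def banach_space_def)

abbreviation (input) L where "L \<equiv> lip_const (word_metric G S) (norm_metric Z) f"

lemma f_closed: "g \<in> carrier G \<Longrightarrow> f g \<in> carrier Z"
  using Lipschitz_continuous_map_image[OF f] by auto

lemma pull_lip0:
  assumes \<phi>: "\<phi> \<in> bounded_operators Z real_line"
  shows "pull \<phi> f \<in> carrier Lip" "vnorm Lip (pull \<phi> f) \<le> op_norm Z real_line \<phi> * L"
proof -
  interpret bounded_operator Z real_line \<phi> by (rule Z.functional[OF \<phi>])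
  note comp = Lipschitz_compose[OF f, of "pull \<phi> f", simplified norm_metric_real_line]
  show "pull \<phi> f \<in> carrier Lip"
    using comp(1) zero f_one by (auto simp: lip0_def pull_def)
  show "vnorm Lip (pull \<phi> f) \<le> op_norm Z real_line \<phi> * L"
    using comp(2) by (auto simp: lip0_def pull_def)
qed

text \<open>The vector \<open>v\<close> is the value at \<open>z\<close>, tested against functionals, of the linear extension of \<open>f\<close>.\<close>

definition represents :: "(('g \<Rightarrow> real) \<Rightarrow> real) \<Rightarrow> 'z \<Rightarrow> bool" where
  "represents z v \<longleftrightarrow> v \<in> carrier Z \<and> (\<forall>\<phi>\<in>bounded_operators Z real_line. \<phi> v = z (pull \<phi> f))"

text \<open>A functional norming \<open>u \<ominus> v\<close> pulls \<open>f\<close> back to a function whose Lipschitz constant is at most that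
  of \<open>f\<close>.  This estimate carries the construction: it yields uniqueness of representing vectors, the norm
  bound, and the Cauchy property needed for limits.\<close>
lemma represents_diff:
  assumes "z \<in> carrier Free" "w \<in> carrier Free" "represents z u" "represents w v"
  shows "vnorm Z (u \<ominus>\<^bsub>Z\<^esub> v) \<le> L * vnorm Free (z \<ominus>\<^bsub>Free\<^esub> w)"
proof -
  have uv: "u \<in> carrier Z" "v \<in> carrier Z" using assms by (auto simp: represents_def)
  then obtain \<phi> where \<phi>: "\<phi> \<in> bounded_operators Z real_line"
      "\<phi> (u \<ominus>\<^bsub>Z\<^esub> v) = vnorm Z (u \<ominus>\<^bsub>Z\<^esub> v)" "\<And>x. x \<in> carrier Z \<Longrightarrow> \<bar>\<phi> x\<bar> \<le> vnorm Z x"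
    using Z.norming_functional[of "u \<ominus>\<^bsub>Z\<^esub> v"] by blast
  have "op_norm Z real_line \<phi> \<le> 1" using \<phi> by (intro Z.op_norm_functional_le) auto
  then have le: "vnorm Lip (pull \<phi> f) \<le> L"
    using pull_lip0(2)[OF \<phi>(1)] mult_right_mono[OF _ lip_const_nonneg[OF f], of "op_norm Z real_line \<phi>" 1]
    by simp
  have "vnorm Z (u \<ominus>\<^bsub>Z\<^esub> v) = z (pull \<phi> f) - w (pull \<phi> f)"
    using \<phi> assms uv bounded_operator.minus[OF Z.functional[OF \<phi>(1)], of u v]
    by (simp add: represents_def)
  also have "\<dots> \<le> vnorm Free (z \<ominus>\<^bsub>Free\<^esub> w) * vnorm Lip (pull \<phi> f)"
    using free_eval_le[of "z \<ominus>\<^bsub>Free\<^esub> w" "pull \<phi> f"] pull_lip0(1)[OF \<phi>(1)] assms(1,2)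
    by (simp add: free_minus del: free_simps)
  also have "\<dots> \<le> vnorm Free (z \<ominus>\<^bsub>Free\<^esub> w) * L"
    using assms by (intro mult_left_mono le Free.norm_nonneg) auto
  finally show ?thesis by (simp add: mult.commute)
qed

lemma represents_add:
  assumes "z \<in> carrier Free" "w \<in> carrier Free" "represents z u" "represents w v"
  shows "represents (z \<oplus>\<^bsub>Free\<^esub> w) (u \<oplus>\<^bsub>Z\<^esub> v)"
  using assms bounded_operator.add[OF Z.functional] pull_lip0(1) by (simp add: represents_def)

lemma represents_scale:
  assumes "z \<in> carrier Free" "represents z u"
  shows "represents (a \<odot>\<^bsub>Free\<^esub> z) (a \<odot>\<^bsub>Z\<^esub> u)"
  using assms bounded_operator.scale[OF Z.functional] pull_lip0(1) by (simp add: represents_def)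

lemma represents_zero: "represents \<zero>\<^bsub>Free\<^esub> \<zero>\<^bsub>Z\<^esub>"
  using bounded_operator.zero[OF Z.functional] pull_lip0(1) by (simp add: represents_def)

lemma represents_delta: "g \<in> carrier G \<Longrightarrow> represents (delta G S g) (f g)"
  using pull_lip0(1) f_closed by (simp add: represents_def) (simp add: pull_def)

text \<open>Representability passes to limits: vectors representing a convergent sequence form a Cauchy
  sequence, and their limit in \<open>Z\<close> represents the limit.\<close>
lemma represents_exists:
  assumes "z \<in> carrier Free" shows "\<exists>v. represents z v"
proof -
  let ?N = "{z \<in> carrier Free. \<exists>v. represents z v}"
  have "?N = carrier Free"
  proof (rule free_induct)
    show "linear_subspace ?N Free"
    proof (rule Free.linear_subspaceI)
      show "\<zero>\<^bsub>Free\<^esub> \<in> ?N" using represents_zero Free.zero_closed by blast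
      show "z \<oplus>\<^bsub>Free\<^esub> w \<in> ?N" if "z \<in> ?N" "w \<in> ?N" for z w
        using represents_add Free.a_closed that by blast
      show "a \<odot>\<^bsub>Free\<^esub> z \<in> ?N" if "z \<in> ?N" for a z
        using represents_scale Free.scale_closed that by blast
    qed blast
    show "delta G S g \<in> ?N" if "g \<in> carrier G" for g
      using that represents_delta delta_free by blast
    show "Free.norm_closed ?N"
      unfolding Free.norm_closed_def
    proof (intro ballI impI)
      fix z assume z: "z \<in> carrier Free"
        and approx: "\<forall>e>0. \<exists>w\<in>?N. vnorm Free (w \<ominus>\<^bsub>Free\<^esub> z) < e"
      have "\<exists>w u. w \<in> carrier Free \<and> represents w u \<and> vnorm Free (w \<ominus>\<^bsub>Free\<^esub> z) < 1 / Suc n" for n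
        using approx[rule_format, of "1 / Suc n"] by auto
      then obtain w u where w: "\<And>n. w n \<in> carrier Free" and wu: "\<And>n. represents (w n) (u n)"
        and wz: "\<And>n. vnorm Free (w n \<ominus>\<^bsub>Free\<^esub> z) < 1 / Suc n"
        by metis
      have u: "u n \<in> carrier Z" for n using wu by (simp add: represents_def)
      have L0: "0 \<le> L" by (rule lip_const_nonneg[OF f])
      have "\<exists>v. Z.norm_limit u v"
      proof (rule Z.banach_limit[OF Z u])
        fix e :: real assume e: "e > 0"
        \<comment> \<open>The constant \<open>L\<close> may vanish, so the division is by \<open>L + 1\<close>.\<close>
        obtain N where N: "1 / Suc N < e / (L + 1) / 2"
          using nat_approx_posE[of "e / (L + 1) / 2"] e L0 by auto
        have "vnorm Z (u m \<ominus>\<^bsub>Z\<^esub> u n) < e" if mn: "m \<ge> N" "n \<ge> N" for m n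
        proof -
          have small: "vnorm Free (w k \<ominus>\<^bsub>Free\<^esub> z) < e / (L + 1) / 2" if "k \<ge> N" for k
          proof -
            have "1 / real (Suc k) \<le> 1 / Suc N" using that by (simp add: frac_le)
            then show ?thesis using wz[of k] N by linarith
          qed
          have "vnorm Free (w m \<ominus>\<^bsub>Free\<^esub> w n) \<le> vnorm Free (w m \<ominus>\<^bsub>Free\<^esub> z) + vnorm Free (w n \<ominus>\<^bsub>Free\<^esub> z)"
            using Free.norm_minus_triangle[OF w z w, of m n] Free.norm_minus_commute[OF w z, of n] by simp
          also have "\<dots> \<le> e / (L + 1)"
            using small[OF mn(1)] small[OF mn(2)] by linarith
          finally have "L * vnorm Free (w m \<ominus>\<^bsub>Free\<^esub> w n) \<le> L * (e / (L + 1))"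
            by (rule mult_left_mono[OF _ L0])
          also have "\<dots> < e" using e L0 by (simp add: field_simps)
          finally show ?thesis using represents_diff[OF w w wu wu, of m n] by simp
        qed
        then show "\<exists>N. \<forall>m\<ge>N. \<forall>n\<ge>N. vnorm Z (u m \<ominus>\<^bsub>Z\<^esub> u n) < e" by blast
      qed blast
      then obtain v where v: "Z.norm_limit u v" by blast
      have "Free.norm_limit w z"
        unfolding Free.norm_limit_def
      proof
        show "(\<lambda>n. vnorm Free (w n \<ominus>\<^bsub>Free\<^esub> z)) \<longlonglongrightarrow> 0"
        proof (rule tendsto_sandwich[OF _ _ tendsto_const LIMSEQ_Suc[OF lim_inverse_n']])
          show "\<forall>\<^sub>F n in sequentially. 0 \<le> vnorm Free (w n \<ominus>\<^bsub>Free\<^esub> z)"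
            by (intro always_eventually allI Free.norm_nonneg Free.minus_closed' w z)
          show "\<forall>\<^sub>F n in sequentially. vnorm Free (w n \<ominus>\<^bsub>Free\<^esub> z) \<le> 1 / real (Suc n)"
            by (intro always_eventually allI less_imp_le wz)
        qed
      qed (rule z)
      moreover have "represents z v"
        unfolding represents_def
      proof (intro conjI ballI)
        show "v \<in> carrier Z" using v by (simp add: Z.norm_limit_def)
        fix \<phi> assume \<phi>: "\<phi> \<in> bounded_operators Z real_line"
        interpret ev: bounded_operator Free real_line "\<lambda>z\<in>carrier Free. z (pull \<phi> f)"
          by (rule eval_bounded_operator[OF pull_lip0(1)[OF \<phi>]])
        have "real_line.norm_limit (\<lambda>n. \<phi> (u n)) (\<phi> v)"
          by (rule bounded_operator.norm_limit[OF Z.functional[OF \<phi>] u v])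
        moreover have "(\<lambda>n. \<phi> (u n)) = (\<lambda>n. (\<lambda>z\<in>carrier Free. z (pull \<phi> f)) (w n))"
          using wu w \<phi> by (auto simp: represents_def)
        moreover have "real_line.norm_limit (\<lambda>n. (\<lambda>z\<in>carrier Free. z (pull \<phi> f)) (w n))
            ((\<lambda>z\<in>carrier Free. z (pull \<phi> f)) z)"
          by (rule ev.norm_limit[OF w \<open>Free.norm_limit w z\<close>])
        ultimately have "\<phi> v = (\<lambda>z\<in>carrier Free. z (pull \<phi> f)) z"
          by (metis (no_types, lifting) real_line.norm_limit_unique real_line_simps(1) UNIV_I)
        then show "\<phi> v = z (pull \<phi> f)" using z by simp
      qed
      ultimately show "z \<in> ?N" using z by blast
    qed
  qed
  then show ?thesis using assms by blast
qed

text \<open>The linear extension is recorded together with its weak description, from which its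
  behaviour on preannihilators can be read off.\<close>
theorem free_space_extension:
  obtains T where "T \<in> bounded_operators Free Z" "\<And>g. g \<in> carrier G \<Longrightarrow> T (delta G S g) = f g"
    "\<And>z. z \<in> carrier Free \<Longrightarrow> vnorm Z (T z) \<le> L * vnorm Free z"
    "\<And>z \<phi>. \<lbrakk>z \<in> carrier Free; \<phi> \<in> bounded_operators Z real_line\<rbrakk> \<Longrightarrow> \<phi> (T z) = z (pull \<phi> f)"
proof -
  define T where "T z = (SOME v. represents z v)" for z
  have T: "represents z (T z)" if "z \<in> carrier Free" for z
    unfolding T_def by (rule someI_ex[OF represents_exists[OF that]])
  have unique: "u = v" if "z \<in> carrier Free" "represents z u" "represents z v" for z u v
  proof -
    have uv: "u \<in> carrier Z" "v \<in> carrier Z" using that by (auto simp: represents_def)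
    have "vnorm Z (u \<ominus>\<^bsub>Z\<^esub> v) \<le> 0"
      using represents_diff[OF that(1,1,2,3)] that(1) Free.minus_self[OF that(1)] Free.norm_zero
      by (simp del: free_simps)
    then have "vnorm Z (u \<ominus>\<^bsub>Z\<^esub> v) = 0" using uv by (intro antisym) auto
    then show ?thesis by (rule Z.norm_minus_zero_imp_eq[OF uv])
  qed
  have bound: "vnorm Z (T z) \<le> L * vnorm Free z" if z: "z \<in> carrier Free" for z
  proof -
    have "T z \<in> carrier Z" using T[OF z] by (simp add: represents_def)
    then show ?thesis
      using represents_diff[OF z Free.zero_closed T[OF z] represents_zero] z
      by (simp del: free_simps)
  qed
  have "(\<lambda>z\<in>carrier Free. T z) \<in> bounded_operators Free Z"
  proof (rule bounded_operatorsI[where B = L])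
    show "T z \<in> carrier Z" if "z \<in> carrier Free" for z
      using T[OF that] by (simp add: represents_def)
    show "T (z \<oplus>\<^bsub>Free\<^esub> w) = T z \<oplus>\<^bsub>Z\<^esub> T w" if "z \<in> carrier Free" "w \<in> carrier Free" for z w
      by (rule unique[OF Free.a_closed[OF that] T[OF Free.a_closed[OF that]]
            represents_add[OF that T[OF that(1)] T[OF that(2)]]])
    show "T (a \<odot>\<^bsub>Free\<^esub> z) = a \<odot>\<^bsub>Z\<^esub> T z" if "z \<in> carrier Free" for a z
      by (rule unique[OF Free.scale_closed[OF that] T[OF Free.scale_closed[OF that]]
            represents_scale[OF that T[OF that]]])
  qed (use bound Free.normed in auto)
  moreover have "T (delta G S g) = f g" if "g \<in> carrier G" for g
    by (rule unique[OF delta_free[OF that] T[OF delta_free[OF that]] represents_delta[OF that]])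
  moreover have "\<phi> (T z) = z (pull \<phi> f)"
    if "z \<in> carrier Free" "\<phi> \<in> bounded_operators Z real_line" for z \<phi>
    using T[OF that(1)] that(2) by (simp add: represents_def)
  ultimately show thesis
    using bound delta_free by (intro that[of "\<lambda>z\<in>carrier Free. T z"]) simp_all
qed

end

end

section \<open>The universal property of the quotient\<close>

text \<open>Convolution with a finitely supported function is a finite linear combination of translates, so
  bounded operators commute with it.\<close>
lemma (in bounded_operator) convolve_compose:
  assumes G: "group G" and x: "x \<in> group_algebra G" and f: "\<And>g. g \<in> carrier G \<Longrightarrow> f g \<in> carrier E"
    and f': "\<And>g. g \<in> carrier G \<Longrightarrow> f' g = T (f g)" and g: "g \<in> carrier G"
  shows "convolve G Z f' x g = T (convolve G E f x g)"
proof -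
  interpret G: group G by fact
  let ?A = "{h \<in> carrier G. x h \<noteq> 0}"
  have fin: "finite ?A" using x by (simp add: group_algebra_def)
  have "T (\<Oplus>\<^bsub>E\<^esub>h\<in>?A. x h \<odot>\<^bsub>E\<^esub> f (g \<otimes>\<^bsub>G\<^esub> inv\<^bsub>G\<^esub> h)) = (\<Oplus>\<^bsub>Z\<^esub>h\<in>?A. T (x h \<odot>\<^bsub>E\<^esub> f (g \<otimes>\<^bsub>G\<^esub> inv\<^bsub>G\<^esub> h)))"
    using f g by (intro finsum fin) auto
  also have "\<dots> = (\<Oplus>\<^bsub>Z\<^esub>h\<in>?A. x h \<odot>\<^bsub>Z\<^esub> f' (g \<otimes>\<^bsub>G\<^esub> inv\<^bsub>G\<^esub> h))"
    using f g by (intro Z.finsum_cong') (auto simp: scale f')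
  finally show ?thesis using g by (simp add: convolve_def)
qed

lemma operator_diff:
  assumes E: "normed_space E" and Z: "normed_space Z"
    and T: "T \<in> bounded_operators E Z" "T' \<in> bounded_operators E Z"
  shows "(\<lambda>x\<in>carrier E. T x \<ominus>\<^bsub>Z\<^esub> T' x) \<in> bounded_operators E Z"
proof -
  interpret T: bounded_operator E Z T using assms by (intro bounded_operatorI)
  interpret T': bounded_operator E Z T' using assms by (intro bounded_operatorI)
  show ?thesis
  proof (rule bounded_operatorsI[where B = "op_norm E Z T + op_norm E Z T'"])
    show "vnorm Z (T x \<ominus>\<^bsub>Z\<^esub> T' x) \<le> (op_norm E Z T + op_norm E Z T') * vnorm E x"
      if x: "x \<in> carrier E" for x
    proof -
      have "vnorm Z (T x \<ominus>\<^bsub>Z\<^esub> T' x) \<le> vnorm Z (T x) + vnorm Z (T' x)"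
        using T.Z.norm_add_le[of "T x" "\<ominus>\<^bsub>Z\<^esub> T' x"] x by (simp add: T.Z.minus_eq)
      then show ?thesis
        using T.norm_le_op_norm[OF x] T'.norm_le_op_norm[OF x] by (simp add: algebra_simps)
    qed
  qed (auto simp: T.add T'.add T.scale T'.scale T.Z.add_minus_add T.Z.scale_minus E)
qed

lemma (in cayley_graph) free_operator_eqI:
  assumes Z: "normed_space Z" and T: "T \<in> bounded_operators Free Z" "T' \<in> bounded_operators Free Z"
    and eq: "\<And>g. g \<in> carrier G \<Longrightarrow> T (delta G S g) = T' (delta G S g)"
  shows "T = T'"
proof -
  interpret T: bounded_operator Free Z T using assms Free.normed by (intro bounded_operatorI)
  interpret T': bounded_operator Free Z T' using assms Free.normed by (intro bounded_operatorI)
  interpret D: bounded_operator Free Z "\<lambda>z\<in>carrier Free. T z \<ominus>\<^bsub>Z\<^esub> T' z"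
    by (intro bounded_operatorI Free.normed Z operator_diff T)
  have all: "{z \<in> carrier Free. (\<lambda>z\<in>carrier Free. T z \<ominus>\<^bsub>Z\<^esub> T' z) z = \<zero>\<^bsub>Z\<^esub>} = carrier Free"
    by (rule free_induct[OF D.kernel_subspace D.kernel_closed]) (use eq delta_free in auto)
  have "T z \<ominus>\<^bsub>Z\<^esub> T' z = \<zero>\<^bsub>Z\<^esub>" if z: "z \<in> carrier Free" for z
    using equalityD2[OF all] z by auto
  then have "T z = T' z" if "z \<in> carrier Free" for z
    using that T.Z.eq_iff_minus[OF T.closed T'.closed] by blast
  then have "T z = T' z" for z
    using T.extensional[of z] T'.extensional[of z] by (cases "z \<in> carrier Free") simp_all
  then show ?thesis by (rule ext)
qed

locale convolution_subspace = cayley_graph +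
  fixes X :: "('a \<Rightarrow> real) set" and x :: "nat \<Rightarrow> 'a \<Rightarrow> real"
  assumes X_sub: "linear_subspace X (lip0 G S)"
    and x_alg: "\<And>n. x n \<in> group_algebra G"
    and X_eq: "plus_constants G X = plus_constants G (carrier (lip0 G S)) \<inter> (\<Inter>n. ker_P G (x n))"
begin

text \<open>The constants in the hypothesis disappear because both sides are normalised at the identity.\<close>
lemma X_iff:
  "f \<in> X \<longleftrightarrow> f \<in> carrier Lip \<and> (\<forall>n. convolve G real_line f (x n) = (\<lambda>g\<in>carrier G. 0))"
proof
  have XL: "X \<subseteq> carrier Lip" by (rule Lip.linear_subspaceD(1)[OF X_sub])
  have self: "f \<in> plus_constants G Y" if "f \<in> Y" "f \<in> carrier Lip" for f Y
  proof -
    have "f = (\<lambda>g\<in>carrier G. f g + 0)"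
      using that by (simp add: lip0_carrier_iff extensional_restrict)
    then show ?thesis unfolding plus_constants_def using that by blast
  qed
  {
    assume f: "f \<in> X"
    then have "f \<in> plus_constants G X" using self XL by blast
    then have "\<forall>n. f \<in> ker_P G (x n)" using X_eq by blast
    then show "f \<in> carrier Lip \<and> (\<forall>n. convolve G real_line f (x n) = (\<lambda>g\<in>carrier G. 0))"
      using f XL by (auto simp: ker_P_def)
  next
    assume f: "f \<in> carrier Lip \<and> (\<forall>n. convolve G real_line f (x n) = (\<lambda>g\<in>carrier G. 0))"
    then have "f \<in> plus_constants G (carrier Lip)" using self by blast
    moreover have "f \<in> ker_P G (x n)" for n
      using f by (simp add: ker_P_def lip0_carrier_iff PiE_def)
    ultimately have "f \<in> plus_constants G X" using X_eq by blast
    then obtain f' c where f': "f' \<in> X" "f = (\<lambda>g\<in>carrier G. f' g + c)"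
      by (auto simp: plus_constants_def)
    have f'L: "f' \<in> carrier Lip" using f'(1) XL by blast
    then have "c = 0" using f f'(2) by (simp add: lip0_carrier_iff)
    then have "f = f'" using f f'(2) f'L by (intro lip0_eqI) auto
    then show "f \<in> X" using f' by simp
  }
qed

lemma X_sub_lip0: "f \<in> X \<Longrightarrow> f \<in> carrier Lip"
  by (simp add: X_iff)

abbreviation N where "N \<equiv> preannihilator G S X"
abbreviation FX where "FX \<equiv> free_quotient G S X"
abbreviation Q where "Q \<equiv> free_quotient_map G S X"

lemma preannihilator_subspace: "linear_subspace N Free"
proof (rule Free.linear_subspaceI)
  show "z \<oplus>\<^bsub>Free\<^esub> w \<in> N" if "z \<in> N" "w \<in> N" for z w
    using that Free.a_closed[of z w] X_sub_lip0 by (simp add: preannihilator_def)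
  show "a \<odot>\<^bsub>Free\<^esub> z \<in> N" if "z \<in> N" for a z
    using that Free.scale_closed[of z a] X_sub_lip0 by (simp add: preannihilator_def)
  show "\<zero>\<^bsub>Free\<^esub> \<in> N"
    using Free.zero_closed X_sub_lip0 by (simp add: preannihilator_def)
qed (simp add: preannihilator_def)

text \<open>The preannihilator is an intersection of kernels of evaluations.\<close>
lemma preannihilator_closed: "Free.norm_closed N"
  unfolding Free.norm_closed_def
proof (intro ballI impI)
  fix z assume z: "z \<in> carrier Free" and approx: "\<forall>e>0. \<exists>w\<in>N. vnorm Free (w \<ominus>\<^bsub>Free\<^esub> z) < e"
  have "z f = 0" if f: "f \<in> X" for f
  proof -
    interpret ev: bounded_operator Free real_line "\<lambda>z\<in>carrier Free. z f"
      by (rule eval_bounded_operator[OF X_sub_lip0[OF f]])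
    have "N \<subseteq> {z \<in> carrier Free. (\<lambda>z\<in>carrier Free. z f) z = \<zero>\<^bsub>real_line\<^esub>}"
      using f by (auto simp: preannihilator_def)
    then have "z \<in> {z \<in> carrier Free. (\<lambda>z\<in>carrier Free. z f) z = \<zero>\<^bsub>real_line\<^esub>}"
      using ev.kernel_closed z approx unfolding Free.norm_closed_def by blast
    then show ?thesis using z by simp
  qed
  then show "z \<in> N" using z by (simp add: preannihilator_def)
qed

sublocale FX: closed_subspace_quotient Free N
  rewrites "quotient_space Free N = FX"
proof -
  show "closed_subspace_quotient Free N"
    by unfold_locales (simp_all add: preannihilator_subspace preannihilator_closed)
qed (simp add: free_quotient_def)

lemma Q_operator: "(\<lambda>z\<in>carrier Free. Q z) \<in> bounded_operators Free FX"
  using FX.quotient_map_operator by (simp add: free_quotient_map_def cong: restrict_cong)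

sublocale Q: bounded_operator Free FX "\<lambda>z\<in>carrier Free. Q z"
  by (intro bounded_operatorI Free.normed FX.normed_quotient Q_operator)

lemma Q_norm_le: "z \<in> carrier Free \<Longrightarrow> vnorm FX (Q z) \<le> vnorm Free z"
  unfolding free_quotient_map_def by (intro FX.quotient_norm_le FX.coset_self)

lemma carrier_FX: "carrier FX = Q ` carrier Free"
  using FX.carrier_quotient by (simp add: free_quotient_map_def)

lemma quotient_operator_eqI:
  assumes Z: "normed_space Z" and F: "F \<in> bounded_operators FX Z" "F' \<in> bounded_operators FX Z"
    and eq: "\<And>g. g \<in> carrier G \<Longrightarrow> F (Q (delta G S g)) = F' (Q (delta G S g))"
  shows "F = F'"
proof -
  interpret F: bounded_operator FX Z F using Z F FX.normed_quotient by (intro bounded_operatorI)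
  interpret F': bounded_operator FX Z F' using Z F FX.normed_quotient by (intro bounded_operatorI)
  have "(\<lambda>z\<in>carrier Free. F ((\<lambda>z\<in>carrier Free. Q z) z)) = (\<lambda>z\<in>carrier Free. F' ((\<lambda>z\<in>carrier Free. Q z) z))"
    by (rule free_operator_eqI[OF Z compose_bounded_operators[OF Q.bounded_operator_axioms F.bounded_operator_axioms]
          compose_bounded_operators[OF Q.bounded_operator_axioms F'.bounded_operator_axioms]])
      (simp add: eq delta_free)
  then have "F (Q z) = F' (Q z)" if "z \<in> carrier Free" for z
    using that by (auto dest!: fun_cong[of _ _ z])
  then have "F C = F' C" for C
    using F.extensional[of C] F'.extensional[of C] by (cases "C \<in> carrier FX") (auto simp: carrier_FX)
  then show ?thesis by (rule ext)
qed

lemma Q_closed: "z \<in> carrier Free \<Longrightarrow> Q z \<in> carrier FX"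
  by (simp add: carrier_FX)

lemma Q_minus:
  assumes "z \<in> carrier Free" "w \<in> carrier Free"
  shows "Q z \<ominus>\<^bsub>FX\<^esub> Q w = Q (z \<ominus>\<^bsub>Free\<^esub> w)"
  using Q.minus[OF assms] by (simp only: restrict_apply' assms Free.minus_closed'[OF assms])

lemma Q_delta_bound:
  assumes "g \<in> carrier G" "h \<in> carrier G"
  shows "vnorm FX (Q (delta G S g) \<ominus>\<^bsub>FX\<^esub> Q (delta G S h)) \<le> d g h"
  unfolding Q_minus[OF delta_free[OF assms(1)] delta_free[OF assms(2)]]
  by (rule order_trans[OF Q_norm_le norm_delta_diff[OF assms]])
    (intro Free.minus_closed' delta_free assms)

text \<open>A convolution of \<open>\<delta>\<close> with \<open>x n\<close> evaluates at \<open>f\<close> to the convolution of \<open>f\<close> with \<open>x n\<close>, which is zero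
  for \<open>f\<close> in \<open>X\<close>.  Hence it lies in the preannihilator and \<open>Q\<close> kills it.\<close>
lemma admissible_Q_delta: "admissible_map G S x FX (Q \<circ> delta G S)"
  and lip_Q_delta: "lip_const (word_metric G S) (norm_metric FX) (Q \<circ> delta G S) \<le> 1"
proof -
  have bound: "mdist (norm_metric FX) ((Q \<circ> delta G S) g) ((Q \<circ> delta G S) h) \<le> 1 * d g h"
    if "g \<in> carrier G" "h \<in> carrier G" for g h
    using Q_delta_bound[OF that] that by (simp add: norm_dist_def Q_closed delta_free)
  then show "lip_const (word_metric G S) (norm_metric FX) (Q \<circ> delta G S) \<le> 1"
    by (intro lip_const_le) auto
  have "convolve G FX (Q \<circ> delta G S) (x n) = (\<lambda>g\<in>carrier G. \<zero>\<^bsub>FX\<^esub>)" for n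
  proof (rule extensionalityI[of _ "carrier G"])
    fix g assume g: "g \<in> carrier G"
    let ?z = "convolve G Free (delta G S) (x n) g"
    have z: "?z \<in> carrier Free"
      using g delta_free by (auto simp: convolve_def simp del: free_simps intro!: Free.finsum_closed)
    have "?z f = 0" if f: "f \<in> X" for f
    proof -
      interpret ev: bounded_operator Free real_line "\<lambda>z\<in>carrier Free. z f"
        by (rule eval_bounded_operator[OF X_sub_lip0[OF f]])
      have "convolve G real_line f (x n) g = ?z f"
        using ev.convolve_compose[OF group_axioms x_alg[of n] delta_free _ g, where f' = f] z X_sub_lip0[OF f]
        by (simp add: delta_free)
      moreover have "convolve G real_line f (x n) g = 0"
        using f g by (simp add: X_iff)
      ultimately show ?thesis by simp
    qed
    then have "?z \<in> N" using z by (simp add: preannihilator_def)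
    then have "Q ?z = \<zero>\<^bsub>FX\<^esub>"
      using FX.coset_eq_iff[OF z Free.zero_closed] z FX.quotient_zero
      by (simp add: free_quotient_map_def del: free_simps)
    moreover have "convolve G FX (Q \<circ> delta G S) (x n) g = Q ?z"
      using Q.convolve_compose[OF group_axioms x_alg[of n] delta_free _ g, where f' = "Q \<circ> delta G S"] z
      by (simp add: delta_free)
    ultimately show "convolve G FX (Q \<circ> delta G S) (x n) g = (\<lambda>g\<in>carrier G. \<zero>\<^bsub>FX\<^esub>) g"
      using g by simp
  qed (auto simp: convolve_def)
  moreover have "Q (delta G S \<one>) = \<zero>\<^bsub>FX\<^esub>"
    using Q.zero Free.zero_closed by (simp add: delta_one del: free_simps)
  moreover have "Lipschitz_continuous_map (word_metric G S) (norm_metric FX) (Q \<circ> delta G S)"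
    unfolding Lipschitz_continuous_map_def
    using bound by (auto intro!: exI[of _ 1] simp: Q_closed delta_free)
  ultimately show "admissible_map G S x FX (Q \<circ> delta G S)"
    by (simp add: admissible_map_def)
qed

lemma admissible_compose:
  assumes T: "bounded_operator E Z T" and f: "admissible_map G S x E f"
  shows "admissible_map G S x Z (\<lambda>g. T (f g))"
proof -
  interpret T: bounded_operator E Z T by fact
  have L: "Lipschitz_continuous_map (word_metric G S) (norm_metric E) f"
    and c: "\<And>n. convolve G E f (x n) = (\<lambda>g\<in>carrier G. \<zero>\<^bsub>E\<^esub>)"
    using f by (auto simp: admissible_map_def)
  have fE: "f g \<in> carrier E" if "g \<in> carrier G" for g
    using Lipschitz_continuous_map_image[OF L] that by auto
  have "convolve G Z (\<lambda>g. T (f g)) (x n) = (\<lambda>g\<in>carrier G. \<zero>\<^bsub>Z\<^esub>)" for n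
  proof (rule extensionalityI[of _ "carrier G"])
    show "convolve G Z (\<lambda>g. T (f g)) (x n) g = (\<lambda>g\<in>carrier G. \<zero>\<^bsub>Z\<^esub>) g" if "g \<in> carrier G" for g
      using T.convolve_compose[OF group_axioms x_alg[of n] fE refl that] c[of n] that by simp
  qed (auto simp: convolve_def)
  then show ?thesis
    using f T.Lipschitz_compose(1)[OF L] by (auto simp: admissible_map_def)
qed

text \<open>The extension of \<open>f\<close> to the free space vanishes on the preannihilator: at \<open>z\<close> in it, any
  functional \<open>\<phi>\<close> takes the value \<open>z (\<phi> \<circ> f)\<close> with \<open>\<phi> \<circ> f\<close> in \<open>X\<close>.\<close>
theorem universal_property:
  assumes Z: "banach_space Z" and f: "admissible_map G S x Z f"
  shows "factors_uniquely G S FX (Q \<circ> delta G S) Z f"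
proof -
  have nZ: "normed_space Z" using Z by (simp add: banach_space_def)
  interpret Z: carrier_normed_space Z using nZ by (simp add: carrier_normed_space_def)
  let ?L = "lip_const (word_metric G S) (norm_metric Z) f"
  have Lf: "Lipschitz_continuous_map (word_metric G S) (norm_metric Z) f" and f1: "f \<one> = \<zero>\<^bsub>Z\<^esub>"
    using f by (auto simp: admissible_map_def)
  have L0: "0 \<le> ?L" by (rule lip_const_nonneg[OF Lf])
  have fZ: "f g \<in> carrier Z" if "g \<in> carrier G" for g
    using Lipschitz_continuous_map_image[OF Lf] that by auto
  obtain T where T: "T \<in> bounded_operators Free Z" "\<And>g. g \<in> carrier G \<Longrightarrow> T (delta G S g) = f g"
    "\<And>z. z \<in> carrier Free \<Longrightarrow> vnorm Z (T z) \<le> ?L * vnorm Free z"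
    "\<And>z \<phi>. \<lbrakk>z \<in> carrier Free; \<phi> \<in> bounded_operators Z real_line\<rbrakk> \<Longrightarrow> \<phi> (T z) = z (pull \<phi> f)"
    using free_space_extension[OF Z Lf f1] by blast
  have TZ: "T z \<in> carrier Z" if "z \<in> carrier Free" for z
    using T(1) that by (auto simp: bounded_operators_def)
  have pull_X: "pull \<phi> f \<in> X" if \<phi>: "\<phi> \<in> bounded_operators Z real_line" for \<phi>
  proof -
    interpret phi: bounded_operator Z real_line \<phi> by (rule Z.functional[OF \<phi>])
    have "convolve G real_line (pull \<phi> f) (x n) = (\<lambda>g\<in>carrier G. 0)" for n
    proof (rule extensionalityI[of _ "carrier G"])
      fix g assume g: "g \<in> carrier G"
      have "convolve G real_line (pull \<phi> f) (x n) g = \<phi> (convolve G Z f (x n) g)"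
        by (rule phi.convolve_compose[OF group_axioms x_alg fZ _ g]) (auto simp: pull_def)
      then show "convolve G real_line (pull \<phi> f) (x n) g = (\<lambda>g\<in>carrier G. 0) g"
        using f g by (simp add: admissible_map_def)
    qed (auto simp: convolve_def)
    then show ?thesis using pull_lip0(1)[OF Z Lf f1 \<phi>] by (simp add: X_iff)
  qed
  have ker: "T z = \<zero>\<^bsub>Z\<^esub>" if z: "z \<in> N" for z
  proof -
    have zF: "z \<in> carrier Free" using z by (simp add: preannihilator_def)
    obtain \<phi> where \<phi>: "\<phi> \<in> bounded_operators Z real_line" "\<phi> (T z) = vnorm Z (T z)"
      using Z.norming_functional[OF TZ[OF zF]] by blast
    have "z (pull \<phi> f) = 0" using z pull_X[OF \<phi>(1)] by (simp add: preannihilator_def)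
    then show ?thesis using T(4)[OF zF \<phi>(1)] \<phi>(2) Z.norm_eq_zero[OF TZ[OF zF]] by simp
  qed
  obtain F where F: "F \<in> bounded_operators FX Z"
    and FQ: "\<And>z. z \<in> carrier Free \<Longrightarrow> F (N +>\<^bsub>Free\<^esub> z) = T z" and F_le: "op_norm FX Z F \<le> ?L"
    using FX.factor_through_quotient[OF nZ T(1) T(3) L0 ker] by blast
  have F_delta: "F (Q (delta G S g)) = f g" if "g \<in> carrier G" for g
    using FQ[OF delta_free[OF that]] T(2)[OF that] by (simp add: free_quotient_map_def)
  interpret F: bounded_operator FX Z F by (intro bounded_operatorI FX.normed_quotient nZ F)
  have "?L \<le> op_norm FX Z F"
  proof (rule lip_const_le[OF F.op_norm_nonneg])
    fix g h assume gh: "g \<in> mspace (word_metric G S)" "h \<in> mspace (word_metric G S)"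
    have "f g \<ominus>\<^bsub>Z\<^esub> f h = F (Q (delta G S g) \<ominus>\<^bsub>FX\<^esub> Q (delta G S h))"
      using gh by (simp add: F.minus Q_closed delta_free F_delta)
    then have "vnorm Z (f g \<ominus>\<^bsub>Z\<^esub> f h)
        \<le> op_norm FX Z F * vnorm FX (Q (delta G S g) \<ominus>\<^bsub>FX\<^esub> Q (delta G S h))"
      using F.norm_le_op_norm[of "Q (delta G S g) \<ominus>\<^bsub>FX\<^esub> Q (delta G S h)"] gh
      by (simp add: Q_closed delta_free)
    also have "\<dots> \<le> op_norm FX Z F * d g h"
      using gh by (intro mult_left_mono Q_delta_bound F.op_norm_nonneg) auto
    finally show "mdist (norm_metric Z) (f g) (f h) \<le> op_norm FX Z F * mdist (word_metric G S) g h"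
      using gh fZ by (simp add: norm_dist_def)
  qed
  then have norm: "op_norm FX Z F = ?L" using F_le by simp
  have unique: "F' = F" if "F' \<in> bounded_operators FX Z" "\<forall>g\<in>carrier G. F' ((Q \<circ> delta G S) g) = f g" for F'
    using quotient_operator_eqI[OF nZ that(1) F] that(2) F_delta by simp
  show ?thesis
    unfolding factors_uniquely_def
  proof (intro conjI allI impI)
    show "\<exists>!F. F \<in> bounded_operators FX Z \<and> (\<forall>g\<in>carrier G. F ((Q \<circ> delta G S) g) = f g)"
    proof (rule ex1I[of _ F])
      show "F \<in> bounded_operators FX Z \<and> (\<forall>g\<in>carrier G. F ((Q \<circ> delta G S) g) = f g)"
        using F F_delta by simp
    qed (use unique in blast)
    show "op_norm FX Z F' = ?L"
      if "F' \<in> bounded_operators FX Z \<and> (\<forall>g\<in>carrier G. F' ((Q \<circ> delta G S) g) = f g)" for F'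
    proof -
      have "F' = F" using unique that by blast
      then show ?thesis using norm by simp
    qed
  qed
qed

end

section \<open>Uniqueness of the universal space\<close>

text \<open>The universal property of a space over the type \<open>'u\<close> concerns target spaces over the same type.
  Scalar-valued maps become available as targets through a copy of the real line inside \<open>'u\<close>.\<close>
definition real_line_copy :: "(real \<Rightarrow> 'u) \<Rightarrow> 'u nspace" where
  "real_line_copy j = \<lparr>carrier = range j, mult = undefined, one = undefined,
     zero = j 0,
     add = (\<lambda>a b. j (the_inv j a + the_inv j b)),
     smult = (\<lambda>r a. j (r * the_inv j a)),
     vnorm = (\<lambda>a. \<bar>the_inv j a\<bar>)\<rparr>"

lemma real_line_copy_simps [simp]:
  "carrier (real_line_copy j) = range j" "\<zero>\<^bsub>real_line_copy j\<^esub> = j 0"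
  "a \<oplus>\<^bsub>real_line_copy j\<^esub> b = j (the_inv j a + the_inv j b)" "r \<odot>\<^bsub>real_line_copy j\<^esub> a = j (r * the_inv j a)"
  "vnorm (real_line_copy j) a = \<bar>the_inv j a\<bar>"
  by (simp_all add: real_line_copy_def)

context
  fixes j :: "real \<Rightarrow> 'u" assumes j: "inj j"
begin

lemma inv_j [simp]: "the_inv j (j r) = r"
  by (rule the_inv_f_f[OF j])

lemma normed_real_line_copy: "normed_space (real_line_copy j)"
  by (rule normed_spaceI) (auto simp: algebra_simps abs_mult)

lemma to_copy: "(\<lambda>r\<in>carrier real_line. j r) \<in> bounded_operators real_line (real_line_copy j)"
  by (rule bounded_operatorsI[where B = 1]) (auto simp: normed_space_real_line)

lemma from_copy: "(\<lambda>a\<in>carrier (real_line_copy j). the_inv j a) \<in> bounded_operators (real_line_copy j) real_line"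
  by (rule bounded_operatorsI[where B = 1]) (auto simp: normed_real_line_copy)

lemma banach_real_line_copy: "banach_space (real_line_copy j)"
proof -
  interpret C: carrier_normed_space "real_line_copy j"
    by (simp add: carrier_normed_space_def normed_real_line_copy)
  interpret P: bounded_operator "real_line_copy j" real_line "\<lambda>a\<in>carrier (real_line_copy j). the_inv j a"
    by (intro bounded_operatorI normed_real_line_copy normed_space_real_line from_copy)
  have diff: "vnorm (real_line_copy j) (a \<ominus>\<^bsub>real_line_copy j\<^esub> b) = \<bar>the_inv j a - the_inv j b\<bar>"
    if "a \<in> range j" "b \<in> range j" for a b
    using P.minus[of a b] C.minus_closed'[of a b] that by simp
  show ?thesis
  proof (rule C.banach_spaceI)
    fix \<sigma> assume \<sigma>: "\<And>n. \<sigma> n \<in> carrier (real_line_copy j)"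
      and fast: "\<And>n. vnorm (real_line_copy j) (\<sigma> (Suc n) \<ominus>\<^bsub>real_line_copy j\<^esub> \<sigma> n) < (1/2)^n"
    have r: "\<sigma> n \<in> range j" for n using \<sigma>[of n] by simp
    have "Cauchy (\<lambda>n. the_inv j (\<sigma> n))"
      using C.fast_imp_Cauchy[OF \<sigma> fast] unfolding diff[OF r r] Cauchy_def dist_real_def by blast
    then obtain l where "(\<lambda>n. the_inv j (\<sigma> n)) \<longlonglongrightarrow> l"
      using Cauchy_convergent convergent_def by blast
    then have "(\<lambda>n. \<bar>the_inv j (\<sigma> n) - l\<bar>) \<longlonglongrightarrow> 0"
      by (simp add: LIM_zero tendsto_rabs_zero)
    then have "C.norm_limit \<sigma> (j l)"
      unfolding C.norm_limit_def using diff[OF r, of "j l"] by simp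
    then show "\<exists>l. C.norm_limit \<sigma> l" by blast
  qed
qed

end

context convolution_subspace
begin

text \<open>Apart from \<open>\<iota>\<close> itself only functionals are extended from the group to \<open>E\<close>.  Extending those
  of the quotient of the free space shows that the induced operator \<open>F\<close> loses no norm;
  uniqueness of extensions shows that its range is dense.\<close>

theorem universal_space_isometric:
  fixes E :: "'u nspace" and \<iota> :: "'a \<Rightarrow> 'u" and j :: "real \<Rightarrow> 'u"
  assumes j: "inj j" and E: "banach_space E" and \<iota>: "admissible_map G S x E \<iota>"
    and univ: "\<And>(Z :: 'u nspace) f. \<lbrakk>banach_space Z; admissible_map G S x Z f\<rbrakk>
      \<Longrightarrow> factors_uniquely G S E \<iota> Z f"
  shows "linearly_isometric E FX"
proof -
  let ?lip = "\<lambda>Z f. lip_const (word_metric G S) (norm_metric Z) f"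
  let ?R = "real_line_copy j"
  have nE: "normed_space E" using E by (simp add: banach_space_def)
  interpret E: carrier_normed_space E using nE by (simp add: carrier_normed_space_def)
  interpret J: bounded_operator real_line ?R "\<lambda>r\<in>carrier real_line. j r"
    by (intro bounded_operatorI normed_space_real_line normed_real_line_copy to_copy j)
  interpret J': bounded_operator ?R real_line "\<lambda>a\<in>carrier ?R. the_inv j a"
    by (intro bounded_operatorI normed_space_real_line normed_real_line_copy from_copy j)
  have lip_\<iota>: "Lipschitz_continuous_map (word_metric G S) (norm_metric E) \<iota>"
    using \<iota> by (simp add: admissible_map_def)
  have \<iota>E: "\<iota> g \<in> carrier E" if "g \<in> carrier G" for g
    using Lipschitz_continuous_map_image[OF lip_\<iota>] that by auto

  \<comment> \<open>The identity is the operator through which \<open>\<iota>\<close> factors, so \<open>\<iota>\<close> has Lipschitz constant at most 1.\<close>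
  have id: "(\<lambda>v\<in>carrier E. v) \<in> bounded_operators E E"
    by (rule bounded_operatorsI[where B = 1]) (auto simp: nE)
  have "op_norm E E (\<lambda>v\<in>carrier E. v) = ?lip E \<iota>"
    using univ[OF E \<iota>] id \<iota>E unfolding factors_uniquely_def by (simp add: id)
  moreover have "op_norm E E (\<lambda>v\<in>carrier E. v) \<le> 1"
    by (rule bounded_operator.op_norm_le[OF bounded_operatorI[OF nE nE id]]) auto
  ultimately have lip_\<iota>_le: "?lip E \<iota> \<le> 1" by simp

  obtain F where F: "F \<in> bounded_operators FX E" "\<And>g. g \<in> carrier G \<Longrightarrow> F (Q (delta G S g)) = \<iota> g"
    "op_norm FX E F \<le> 1"
    using universal_property[OF E \<iota>] lip_\<iota>_le unfolding factors_uniquely_def by force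
  interpret F: bounded_operator FX E F by (intro bounded_operatorI FX.normed_quotient nE F)

  have extend: "\<exists>\<Psi>\<in>bounded_operators E real_line. op_norm E real_line \<Psi> \<le> op_norm FX real_line \<psi> \<and>
      (\<forall>g\<in>carrier G. \<Psi> (\<iota> g) = \<psi> (Q (delta G S g)))"
    if \<psi>: "\<psi> \<in> bounded_operators FX real_line" for \<psi>
  proof -
    interpret psi: bounded_operator FX real_line \<psi> by (rule FX.Q.functional[OF \<psi>])
    let ?f = "\<lambda>g. j (\<psi> (Q (delta G S g)))"
    have adm_psi: "admissible_map G S x real_line (\<lambda>g. \<psi> ((Q \<circ> delta G S) g))"
      by (rule admissible_compose[OF psi.bounded_operator_axioms admissible_Q_delta])
    have adm: "admissible_map G S x ?R ?f"
      using admissible_compose[OF J.bounded_operator_axioms adm_psi] by simp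
    have "?lip real_line (\<lambda>g. \<psi> ((Q \<circ> delta G S) g)) \<le> op_norm FX real_line \<psi> * ?lip FX (Q \<circ> delta G S)"
      using admissible_Q_delta by (intro psi.Lipschitz_compose(2)) (auto simp: admissible_map_def)
    also have "\<dots> \<le> op_norm FX real_line \<psi> * 1"
      by (intro mult_left_mono lip_Q_delta psi.op_norm_nonneg)
    finally have lip_psi: "?lip real_line (\<lambda>g. \<psi> ((Q \<circ> delta G S) g)) \<le> op_norm FX real_line \<psi>" by simp
    have "op_norm real_line ?R (\<lambda>r\<in>carrier real_line. j r) \<le> 1"
      by (rule J.op_norm_le) (auto simp: j)
    then have "op_norm real_line ?R (\<lambda>r\<in>carrier real_line. j r) * ?lip real_line (\<lambda>g. \<psi> ((Q \<circ> delta G S) g))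
        \<le> 1 * ?lip real_line (\<lambda>g. \<psi> ((Q \<circ> delta G S) g))"
      using adm_psi by (intro mult_right_mono lip_const_nonneg) (auto simp: admissible_map_def)
    moreover have "?lip ?R ?f
        \<le> op_norm real_line ?R (\<lambda>r\<in>carrier real_line. j r) * ?lip real_line (\<lambda>g. \<psi> ((Q \<circ> delta G S) g))"
      using adm_psi by (intro J.Lipschitz_compose(2)) (auto simp: admissible_map_def)
    ultimately have lip_f: "?lip ?R ?f \<le> op_norm FX real_line \<psi>" using lip_psi by linarith
    obtain H where H: "H \<in> bounded_operators E ?R" "\<And>g. g \<in> carrier G \<Longrightarrow> H (\<iota> g) = ?f g"
      "op_norm E ?R H = ?lip ?R ?f"
      using univ[OF banach_real_line_copy[OF j] adm] unfolding factors_uniquely_def by blast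
    interpret H: bounded_operator E ?R H by (intro bounded_operatorI nE normed_real_line_copy j H(1))
    define \<Psi> where "\<Psi> = (\<lambda>v\<in>carrier E. (\<lambda>a\<in>carrier ?R. the_inv j a) (H v))"
    have \<Psi>: "\<Psi> \<in> bounded_operators E real_line"
      unfolding \<Psi>_def by (rule compose_bounded_operators[OF H.bounded_operator_axioms J'.bounded_operator_axioms])
    have "\<bar>\<Psi> v\<bar> \<le> op_norm FX real_line \<psi> * vnorm E v" if v: "v \<in> carrier E" for v
    proof -
      have "\<bar>\<Psi> v\<bar> = vnorm ?R (H v)" using H.closed[OF v] v by (simp add: \<Psi>_def)
      also have "\<dots> \<le> ?lip ?R ?f * vnorm E v" using H.norm_le_op_norm[OF v] H(3) by simp
      also have "\<dots> \<le> op_norm FX real_line \<psi> * vnorm E v"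
        by (intro mult_right_mono lip_f E.norm_nonneg v)
      finally show ?thesis .
    qed
    then have "op_norm E real_line \<Psi> \<le> op_norm FX real_line \<psi>"
      by (intro E.op_norm_functional_le \<Psi> psi.op_norm_nonneg)
    moreover have "\<Psi> (\<iota> g) = \<psi> (Q (delta G S g))" if "g \<in> carrier G" for g
      using \<iota>E[OF that] H(2)[OF that] by (simp add: \<Psi>_def inv_j[OF j])
    ultimately show ?thesis using \<Psi> by blast
  qed

  \<comment> \<open>Functionals on \<open>E\<close> are determined by their values on the image of the group.\<close>
  have functional_unique: "\<Psi> = \<Psi>'"
    if \<Psi>: "\<Psi> \<in> bounded_operators E real_line" "\<Psi>' \<in> bounded_operators E real_line"
      and eq: "\<And>g. g \<in> carrier G \<Longrightarrow> \<Psi> (\<iota> g) = \<Psi>' (\<iota> g)" for \<Psi> \<Psi>'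
  proof -
    let ?J = "\<lambda>\<Psi>. \<lambda>v\<in>carrier E. (\<lambda>r\<in>carrier real_line. j r) (\<Psi> v)"
    have op: "?J \<Psi> \<in> bounded_operators E ?R" "?J \<Psi>' \<in> bounded_operators E ?R"
      by (rule compose_bounded_operators[OF E.functional J.bounded_operator_axioms]; rule \<Psi>)+
    have "admissible_map G S x ?R (\<lambda>g. ?J \<Psi> (\<iota> g))"
      by (rule admissible_compose[OF bounded_operatorI[OF nE normed_real_line_copy[OF j] op(1)] \<iota>])
    then have "\<exists>!F. F \<in> bounded_operators E ?R \<and> (\<forall>g\<in>carrier G. F (\<iota> g) = ?J \<Psi> (\<iota> g))"
      using univ[OF banach_real_line_copy[OF j]] unfolding factors_uniquely_def by blast
    moreover have "\<forall>g\<in>carrier G. ?J \<Psi>' (\<iota> g) = ?J \<Psi> (\<iota> g)" using eq \<iota>E by simp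
    ultimately have same: "?J \<Psi> = ?J \<Psi>'" using op by blast
    show ?thesis
    proof (rule E.functional_eqI[OF \<Psi>])
      show "\<Psi> v = \<Psi>' v" if v: "v \<in> carrier E" for v
        using fun_cong[OF same, of v] v injD[OF j] by simp
    qed
  qed

  have isometric: "vnorm E (F C) = vnorm FX C" if C: "C \<in> carrier FX" for C
  proof (rule antisym)
    show "vnorm E (F C) \<le> vnorm FX C"
      using F.norm_le_op_norm[OF C] mult_right_mono[OF F(3) FX.Q.norm_nonneg[OF C]] by simp
    obtain \<psi> where \<psi>: "\<psi> \<in> bounded_operators FX real_line" "\<psi> C = vnorm FX C"
      "\<And>D. D \<in> carrier FX \<Longrightarrow> \<bar>\<psi> D\<bar> \<le> vnorm FX D"
      using FX.Q.norming_functional[OF C] by blast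
    have psi_le: "op_norm FX real_line \<psi> \<le> 1"
      using \<psi>(3) by (intro FX.Q.op_norm_functional_le \<psi>(1)) auto
    obtain \<Psi> where \<Psi>: "\<Psi> \<in> bounded_operators E real_line"
      "op_norm E real_line \<Psi> \<le> op_norm FX real_line \<psi>"
      "\<And>g. g \<in> carrier G \<Longrightarrow> \<Psi> (\<iota> g) = \<psi> (Q (delta G S g))"
      using extend[OF \<psi>(1)] by blast
    have "(\<lambda>C\<in>carrier FX. \<Psi> (F C)) = \<psi>"
      by (rule quotient_operator_eqI[OF normed_space_real_line
            compose_bounded_operators[OF F.bounded_operator_axioms E.functional[OF \<Psi>(1)]] \<psi>(1)])
        (simp add: \<Psi>(3) F(2) Q_closed delta_free)
    then have "vnorm FX C = \<Psi> (F C)" using \<psi>(2) C by (auto dest: fun_cong[of _ _ C])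
    also have "\<dots> \<le> op_norm E real_line \<Psi> * vnorm E (F C)"
      using E.functional_norm_le[OF \<Psi>(1) F.closed[OF C]] by simp
    also have "\<dots> \<le> 1 * vnorm E (F C)"
      using \<Psi>(2) psi_le by (intro mult_right_mono E.norm_nonneg F.closed C) simp
    finally show "vnorm FX C \<le> vnorm E (F C)" by simp
  qed
  have isometric_diff: "vnorm FX (C \<ominus>\<^bsub>FX\<^esub> D) = vnorm E (F C \<ominus>\<^bsub>E\<^esub> F D)"
    if "C \<in> carrier FX" "D \<in> carrier FX" for C D
    using isometric[of "C \<ominus>\<^bsub>FX\<^esub> D"] F.minus that by simp
  have inj: "C = D" if "C \<in> carrier FX" "D \<in> carrier FX" "F C = F D" for C D
    using isometric_diff[OF that(1,2)] that F.closed[of D] by (intro FX.Q.norm_minus_zero_imp_eq) auto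

  let ?M = "F ` carrier FX"
  \<comment> \<open>The range of \<open>F\<close> is closed, being an isometric image of a complete space.\<close>
  have M_sub: "linear_subspace ?M E"
  proof (rule E.linear_subspaceI)
    show "u \<oplus>\<^bsub>E\<^esub> v \<in> ?M" if "u \<in> ?M" "v \<in> ?M" for u v
      using that by (auto simp flip: F.add)
    show "a \<odot>\<^bsub>E\<^esub> u \<in> ?M" if "u \<in> ?M" for a u
      using that by (auto simp flip: F.scale)
    show "\<zero>\<^bsub>E\<^esub> \<in> ?M" using F.zero FX.Q.zero_closed by (metis imageI)
  qed auto
  have M_closed: "E.norm_closed ?M"
    unfolding E.norm_closed_def
  proof (intro ballI impI)
    fix v assume v: "v \<in> carrier E" and approx: "\<forall>e>0. \<exists>u\<in>?M. vnorm E (u \<ominus>\<^bsub>E\<^esub> v) < e"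
    \<comment> \<open>The tolerance is halved so that two consecutive errors sum to less than \<open>(1/2)^n\<close>.\<close>
    have "\<exists>C. C \<in> carrier FX \<and> vnorm E (F C \<ominus>\<^bsub>E\<^esub> v) < (1/2)^n / 2" for n
      using approx[rule_format, of "(1/2)^n / 2"] by auto
    then obtain C where C: "\<And>n. C n \<in> carrier FX" "\<And>n. vnorm E (F (C n) \<ominus>\<^bsub>E\<^esub> v) < (1/2)^n / 2"
      by metis
    have fast: "vnorm FX (C (Suc n) \<ominus>\<^bsub>FX\<^esub> C n) < (1/2)^n" for n
    proof -
      have "vnorm FX (C (Suc n) \<ominus>\<^bsub>FX\<^esub> C n) \<le> vnorm E (F (C (Suc n)) \<ominus>\<^bsub>E\<^esub> v) + vnorm E (F (C n) \<ominus>\<^bsub>E\<^esub> v)"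
        using isometric_diff[OF C(1) C(1)] E.norm_minus_triangle[of "F (C (Suc n))" v "F (C n)"]
          E.norm_minus_commute[of v "F (C n)"] C(1) v by simp
      moreover have "(1/2)^Suc n / 2 \<le> (1/2 :: real)^n / 2" by simp
      ultimately show ?thesis using C(2)[of n] C(2)[of "Suc n"] by linarith
    qed
    obtain D where D: "FX.Q.norm_limit C D"
      using FX.Q.banach_limit[OF FX.banach_quotient[OF banach_free] C(1)
          FX.Q.fast_imp_Cauchy[OF C(1) fast]] by blast
    have "E.norm_limit (\<lambda>n. F (C n)) v"
      unfolding E.norm_limit_def
    proof
      show "(\<lambda>n. vnorm E (F (C n) \<ominus>\<^bsub>E\<^esub> v)) \<longlonglongrightarrow> 0"
      proof (rule tendsto_sandwich[OF _ _ tendsto_const])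
        show "(\<lambda>n. (1/2 :: real)^n / 2) \<longlonglongrightarrow> 0"
          using tendsto_divide[OF LIMSEQ_realpow_zero[of "1/2 :: real"] tendsto_const[of 2]] by simp
        show "\<forall>\<^sub>F n in sequentially. 0 \<le> vnorm E (F (C n) \<ominus>\<^bsub>E\<^esub> v)"
          by (intro always_eventually allI E.norm_nonneg E.minus_closed' F.closed C(1) v)
        show "\<forall>\<^sub>F n in sequentially. vnorm E (F (C n) \<ominus>\<^bsub>E\<^esub> v) \<le> (1/2)^n / 2"
          by (intro always_eventually allI less_imp_le C(2))
      qed
    qed (rule v)
    then have "v = F D"
      using F.norm_limit[OF C(1) D] C(1) by (intro E.norm_limit_unique[of "\<lambda>n. F (C n)"]) auto
    then show "v \<in> ?M" using D by (simp add: FX.Q.norm_limit_def)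
  qed
  \<comment> \<open>A functional norming the coset of \<open>v\<close> modulo the range vanishes on the image of the group, hence
    everywhere, so the coset is zero.\<close>
  have onto: "v \<in> ?M" if v: "v \<in> carrier E" for v
  proof -
    interpret M: closed_subspace_quotient E ?M
      by unfold_locales (rule M_sub M_closed)+
    interpret q: bounded_operator E "quotient_space E ?M" "\<lambda>v\<in>carrier E. ?M +>\<^bsub>E\<^esub> v"
      by (intro bounded_operatorI nE M.normed_quotient M.quotient_map_operator)
    have vq: "?M +>\<^bsub>E\<^esub> v \<in> carrier (quotient_space E ?M)" by (rule M.quotient_map_closed[OF v])
    obtain \<theta> where \<theta>: "\<theta> \<in> bounded_operators (quotient_space E ?M) real_line"
      "\<theta> (?M +>\<^bsub>E\<^esub> v) = vnorm (quotient_space E ?M) (?M +>\<^bsub>E\<^esub> v)"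
      using M.Q.norming_functional[OF vq] by blast
    interpret theta: bounded_operator "quotient_space E ?M" real_line \<theta>
      by (rule M.Q.functional[OF \<theta>(1)])
    have zero_op: "(\<lambda>v\<in>carrier E. 0) \<in> bounded_operators E real_line"
      by (rule bounded_operatorsI[where B = 0]) (auto simp: nE)
    have "(\<lambda>u\<in>carrier E. \<theta> ((\<lambda>v\<in>carrier E. ?M +>\<^bsub>E\<^esub> v) u)) = (\<lambda>v\<in>carrier E. 0)"
    proof (rule functional_unique[OF compose_bounded_operators[OF q.bounded_operator_axioms theta.bounded_operator_axioms] zero_op])
      fix g assume g: "g \<in> carrier G"
      have "\<iota> g \<in> ?M" using F(2)[OF g] Q_closed[OF delta_free[OF g]] by (metis imageI)
      then have "?M +>\<^bsub>E\<^esub> \<iota> g = \<zero>\<^bsub>quotient_space E ?M\<^esub>"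
        using M.coset_eq_iff[OF \<iota>E[OF g] E.zero_closed] \<iota>E[OF g] by (simp add: M.quotient_zero)
      then show "(\<lambda>u\<in>carrier E. \<theta> ((\<lambda>v\<in>carrier E. ?M +>\<^bsub>E\<^esub> v) u)) (\<iota> g) = (\<lambda>v\<in>carrier E. 0) (\<iota> g)"
        using \<iota>E[OF g] theta.zero by simp
    qed
    then have "\<theta> (?M +>\<^bsub>E\<^esub> v) = 0" using v by (auto dest: fun_cong[of _ _ v])
    then have "?M +>\<^bsub>E\<^esub> v = \<zero>\<^bsub>quotient_space E ?M\<^esub>"
      using \<theta>(2) M.Q.norm_eq_zero[OF vq] by simp
    then show ?thesis
      using M.coset_eq_iff[OF v E.zero_closed] v by (simp add: M.quotient_zero)
  qed

  have bij: "bij_betw F (carrier FX) (carrier E)"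
    unfolding bij_betw_def using inj onto F.closed by (auto intro!: inj_onI)
  define T where "T = inv_into (carrier FX) F"
  have T: "T v \<in> carrier FX" "F (T v) = v" if "v \<in> carrier E" for v
    using bij that unfolding T_def bij_betw_def by (auto intro: inv_into_into f_inv_into_f)
  have T_eqI: "T v = C" if "C \<in> carrier FX" "F C = v" for v C
    using that inj[of "T v" C] T[of v] F.closed[of C] by auto
  have T_norm: "vnorm FX (T v) = vnorm E v" if "v \<in> carrier E" for v
    using isometric[OF T(1)[OF that]] T(2)[OF that] by simp
  have "(\<lambda>v\<in>carrier E. T v) \<in> bounded_operators E FX"
  proof (rule bounded_operatorsI[where B = 1])
    show "T (u \<oplus>\<^bsub>E\<^esub> v) = T u \<oplus>\<^bsub>FX\<^esub> T v" if "u \<in> carrier E" "v \<in> carrier E" for u v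
      using that T by (intro T_eqI) (auto simp: F.add)
    show "T (a \<odot>\<^bsub>E\<^esub> v) = a \<odot>\<^bsub>FX\<^esub> T v" if "v \<in> carrier E" for a v
      using that T by (intro T_eqI) (auto simp: F.scale)
  qed (auto simp: T T_norm nE)
  moreover have "bij_betw (\<lambda>v\<in>carrier E. T v) (carrier E) (carrier FX)"
    using bij_betw_inv_into[OF bij] unfolding T_def by (simp add: bij_betw_restrict_eq)
  ultimately show ?thesis
    unfolding linearly_isometric_def using T_norm by (intro bexI[of _ "\<lambda>v\<in>carrier E. T v"]) auto
qed

end

theorem proposition4p3:
  fixes G :: "('g, 'm) monoid_scheme" and S :: "'g set"
    and X :: "('g \<Rightarrow> real) set" and x :: "nat \<Rightarrow> 'g \<Rightarrow> real"
  assumes "group G" and "infinite (carrier G)"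
    and "finite S" and "S \<subseteq> carrier G" and "\<forall>s\<in>S. inv\<^bsub>G\<^esub> s \<in> S" and "generate G S = carrier G"
    and "linear_subspace X (lip0 G S)" and "invariant G X" and "pointwise_closed G S X"
    and "\<forall>n. x n \<in> group_algebra G"
    and "plus_constants G X = plus_constants G (carrier (lip0 G S)) \<inter> (\<Inter>n. ker_P G (x n))"
  shows "(\<forall>(Z :: 'z nspace) f. banach_space Z \<and> admissible_map G S x Z f \<longrightarrow>
            factors_uniquely G S (free_quotient G S X) (free_quotient_map G S X \<circ> delta G S) Z f)
       \<and> ((UNIV :: real set) \<lesssim> (UNIV :: 'u set) \<longrightarrow>
          (\<forall>(E :: 'u nspace) \<iota>. banach_space E \<and> admissible_map G S x E \<iota> \<and>
             (\<forall>(Z :: 'u nspace) f. banach_space Z \<and> admissible_map G S x Z f \<longrightarrow>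
                factors_uniquely G S E \<iota> Z f) \<longrightarrow>
             linearly_isometric E (free_quotient G S X)))"
proof -
  interpret convolution_subspace G S X x
    using assms by (intro convolution_subspace.intro cayley_graph.intro cayley_graph_axioms.intro
        convolution_subspace_axioms.intro) auto
  show ?thesis
  proof (intro conjI allI impI)
    show "factors_uniquely G S FX (Q \<circ> delta G S) Z f"
      if "banach_space Z \<and> admissible_map G S x Z f" for Z :: "'z nspace" and f
      using that universal_property by blast
    fix E :: "'u nspace" and \<iota>
    assume "(UNIV :: real set) \<lesssim> (UNIV :: 'u set)"
    then obtain j :: "real \<Rightarrow> 'u" where "inj j" by (auto simp: lepoll_def)
    assume "banach_space E \<and> admissible_map G S x E \<iota> \<and>
      (\<forall>(Z :: 'u nspace) f. banach_space Z \<and> admissible_map G S x Z f \<longrightarrow> factors_uniquely G S E \<iota> Z f)"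
    then show "linearly_isometric E FX"
      using universal_space_isometric[OF \<open>inj j\<close>, of E \<iota>] by blast
  qed
qed

end
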